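(* Let $T\in(\mathbb{R}^n)^{\otimes d}$ be a symmetric, nondegenerate tensor, and for each integer $\lambda$ let $c_\lambda$ be the number of critical points of index $\lambda$ of $f|_{S^{n-1}}$, where $f$ is the homogeneous polynomial corresponding to $T$ (equivalently, the number of unit eigenvectors of $T$ of index $\lambda$). Then: (i) If $c_0\neq 1$, then $c_1>0$. (ii) If, for $\lambda\in\{2,3,\ldots,n-2\}$, $c_\lambda>0$, then at least one of $c_{\lambda-1},c_{\lambda+1}$ is $>0$. (iii) If $c_n>0$, then $c_{n-1}>0$. (iv) If $c_{n-1}\neq 1$, then at least one of $c_{n-2},c_n$ is $>0$.
   Context: $\mathbb{R}^n$ carries the standard inner product and Euclidean norm, and $S^{n-1}$ is its unit sphere. A symmetric tensor $T=[T_{i_1\cdots i_d}]\in(\mathbb{R}^n)^{\otimes d}$ corresponds to the homogeneous polynomial $f(x)=\sum_{1\le i_1,\ldots,i_d\le n}T_{i_1\cdots i_d}x_{i_1}\cdots x_{i_d}$ of degree $d$. The unit eigenvectors of $T$ are the critical points of the restriction $f|_{S^{n-1}}\colon S^{n-1}\to\mathbb{R}$. An eigenvector is nondegenerate if it is a nondegenerate critical point of $f|_{S^{n-1}}$, i.e. the Hessian of $f|_{S^{n-1}}$ in local coordinates on $S^{n-1}$ is nonsingular there; its index is then its (Morse) index as a nondegenerate critical point, i.e. the number of negative eigenvalues of that Hessian counted with multiplicity. The tensor $T$ is nondegenerate if all its unit eigenvectors are nondegenerate. When no critical point of index $\lambda$ exists, $c_\lambda=0$.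
   Formalization: The formal theorem assumes n ≥ 2; for n = 1 the sphere S^0 consists of two nondegenerate critical points of index 0, so c_0 = 2 and c_1 = 0, and (i) and (iv) fail as stated. *)

theory Defs
  imports "HOL-Analysis.Analysis" "HOL-Combinatorics.Combinatorics"
begin

section \<open>Symmetric tensors\<close>

text \<open>A tensor of order \<open>d\<close> over \<open>real ^ 'n\<close> is given by its entries: the list
  \<open>[i\<^sub>1, \<dots>, i\<^sub>d]\<close> is mapped to \<open>T\<^bsub>i\<^sub>1 \<dots> i\<^sub>d\<^esub>\<close>. Only the values on lists of
  length \<open>d\<close> matter.\<close>

type_synonym 'n tensor = "'n list \<Rightarrow> real"

definition symmetric_tensor :: "nat \<Rightarrow> 'n tensor \<Rightarrow> bool" where
  "symmetric_tensor d T \<longleftrightarrow>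
     (\<forall>\<sigma> is. \<sigma> permutes {..<d} \<and> length is = d \<longrightarrow> T (permute_list \<sigma> is) = T is)"

definition tensor_poly :: "nat \<Rightarrow> 'n::finite tensor \<Rightarrow> real ^ 'n \<Rightarrow> real" where
  "tensor_poly d T x = (\<Sum>is | length is = d. T is * (\<Prod>i\<leftarrow>is. x $ i))"

section \<open>Local coordinates on the unit sphere\<close>

fun C_k_on :: "nat \<Rightarrow> ('a::euclidean_space \<Rightarrow> 'b::euclidean_space) \<Rightarrow> 'a set \<Rightarrow> bool" where
  "C_k_on 0 f U \<longleftrightarrow> continuous_on U f"
| "C_k_on (Suc k) f U \<longleftrightarrow>
     (\<forall>x\<in>U. f differentiable (at x)) \<and>
     (\<forall>v. C_k_on k (\<lambda>x. frechet_derivative f (at x) v) U)"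

text \<open>This is \<open>C\<^sup>\<infinity>\<close> for open \<open>U\<close>; it is only used for such \<open>U\<close>.\<close>

definition smooth_on :: "('a::euclidean_space \<Rightarrow> 'b::euclidean_space) \<Rightarrow> 'a set \<Rightarrow> bool" where
  "smooth_on f U \<longleftrightarrow> (\<forall>k. C_k_on k f U)"

text \<open>Local coordinates are given by smooth regular parametrizations \<open>\<phi>\<close> of open pieces of the
  sphere. The coordinate space is \<open>real ^ 'm\<close>; since the sphere in \<open>real ^ 'n\<close> has dimension
  \<open>CARD('n) - 1\<close>, the notions below are meaningful when \<open>CARD('n) = CARD('m) + 1\<close>
  (otherwise there are no local coordinates at all).\<close>

definition sphere_coords :: "(real ^ 'm) set \<Rightarrow> (real ^ 'm \<Rightarrow> real ^ 'n) \<Rightarrow> bool" where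
  "sphere_coords U \<phi> \<longleftrightarrow>
     open U \<and> smooth_on \<phi> U \<and>
     openin (top_of_set (sphere 0 1)) (\<phi> ` U) \<and>
     (\<exists>\<psi>. homeomorphism U (\<phi> ` U) \<phi> \<psi>) \<and>
     (\<forall>u\<in>U. inj (frechet_derivative \<phi> (at u)))"

section \<open>Critical points of functions on the sphere\<close>

definition hessian :: "(real ^ 'm \<Rightarrow> real) \<Rightarrow> real ^ 'm \<Rightarrow> real ^ 'm ^ 'm" where
  "hessian g u =
     (\<chi> i j. frechet_derivative (\<lambda>y. frechet_derivative g (at y) (axis j 1)) (at u) (axis i 1))"

text \<open>Each eigenvalue is counted with the dimension of its eigenspace. As Hessians of smooth
  functions are symmetric, this agrees with its multiplicity as a root of the characteristic
  polynomial.\<close>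

definition num_neg_eigenvalues :: "real ^ 'm ^ 'm \<Rightarrow> nat" where
  "num_neg_eigenvalues A =
     (\<Sum>\<mu> | \<mu> < 0 \<and> (\<exists>v. v \<noteq> 0 \<and> A *v v = \<mu> *\<^sub>R v). dim {v. A *v v = \<mu> *\<^sub>R v})"

text \<open>In the following, \<open>F\<close> enters only through its restriction to the unit sphere. Whether
  \<open>x\<close> is critical does not depend on the local coordinates around \<open>x\<close>, and at a critical point
  a change of coordinates replaces the Hessian by a congruent matrix. Hence "some" local
  coordinates could be replaced by "all" in each definition.\<close>

definition sphere_critical_point ::
    "'m::finite itself \<Rightarrow> (real ^ 'n \<Rightarrow> real) \<Rightarrow> real ^ 'n \<Rightarrow> bool" where
  "sphere_critical_point TYPE('m) F x \<longleftrightarrow>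
     (\<exists>U (\<phi> :: real ^ 'm \<Rightarrow> real ^ 'n). \<exists>u\<in>U. sphere_coords U \<phi> \<and> \<phi> u = x \<and>
        ((F \<circ> \<phi>) has_derivative (\<lambda>_. 0)) (at u))"

definition nondegenerate_critical_point ::
    "'m::finite itself \<Rightarrow> (real ^ 'n \<Rightarrow> real) \<Rightarrow> real ^ 'n \<Rightarrow> bool" where
  "nondegenerate_critical_point TYPE('m) F x \<longleftrightarrow>
     (\<exists>U (\<phi> :: real ^ 'm \<Rightarrow> real ^ 'n). \<exists>u\<in>U. sphere_coords U \<phi> \<and> \<phi> u = x \<and>
        ((F \<circ> \<phi>) has_derivative (\<lambda>_. 0)) (at u) \<and>
        invertible (hessian (F \<circ> \<phi>) u))"

definition critical_point_of_index ::
    "'m::finite itself \<Rightarrow> (real ^ 'n \<Rightarrow> real) \<Rightarrow> int \<Rightarrow> real ^ 'n \<Rightarrow> bool" where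
  "critical_point_of_index TYPE('m) F k x \<longleftrightarrow>
     (\<exists>U (\<phi> :: real ^ 'm \<Rightarrow> real ^ 'n). \<exists>u\<in>U. sphere_coords U \<phi> \<and> \<phi> u = x \<and>
        ((F \<circ> \<phi>) has_derivative (\<lambda>_. 0)) (at u) \<and>
        invertible (hessian (F \<circ> \<phi>) u) \<and>
        int (num_neg_eigenvalues (hessian (F \<circ> \<phi>) u)) = k)"

section \<open>Eigenvectors of tensors\<close>

definition unit_eigenvector ::
    "'m::finite itself \<Rightarrow> nat \<Rightarrow> 'n::finite tensor \<Rightarrow> real ^ 'n \<Rightarrow> bool" where
  "unit_eigenvector TYPE('m) d T x \<longleftrightarrow> sphere_critical_point TYPE('m) (tensor_poly d T) x"

definition nondegenerate_tensor ::
    "'m::finite itself \<Rightarrow> nat \<Rightarrow> 'n::finite tensor \<Rightarrow> bool" where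
  "nondegenerate_tensor TYPE('m) d T \<longleftrightarrow>
     (\<forall>x. unit_eigenvector TYPE('m) d T x \<longrightarrow>
        nondegenerate_critical_point TYPE('m) (tensor_poly d T) x)"

text \<open>For a nondegenerate tensor the sets counted here are finite, because nondegenerate critical
  points are isolated and the sphere is compact.\<close>

definition num_critical ::
    "'m::finite itself \<Rightarrow> nat \<Rightarrow> 'n::finite tensor \<Rightarrow> int \<Rightarrow> nat" where
  "num_critical TYPE('m) d T k =
     card {x. critical_point_of_index TYPE('m) (tensor_poly d T) k x}"

end

theory Submission
  imports Defs "HOL-Homology.Homology"
begin

text \<open>The proof is Morse theory on the sphere \<open>S\<close> of dimension \<open>m = n - 1\<close> by singular homology, without
  gradient flows or the Morse lemma. Write \<open>M\<^sub>c\<close> for the part of \<open>S\<close> where \<open>f \<le> c\<close>. If no critical point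
  has index \<open>j\<close>, then \<open>H\<^sub>j(M\<^sub>b, M\<^sub>a) = 0\<close> for all regular values \<open>a \<le> b\<close>. On the other hand, passing a
  critical point \<open>p\<close> of index \<open>k\<close> at level \<open>c\<close> makes \<open>H\<^sub>k(M\<^bsub>c + \<epsilon>\<^esub>, M\<^bsub>c - \<epsilon>\<^esub>)\<close> nonzero, since the unstable disk
  of \<open>p\<close> crosses the stable one exactly once.

  For (ii), suppose that there are no points of index \<open>k - 1\<close> and \<open>k + 1\<close>. Then \<open>H\<^bsub>k-1\<^esub>(M\<^bsub>c - \<epsilon>\<^esub>) = 0\<close> and
  \<open>H\<^bsub>k+1\<^esub>(S, M\<^bsub>c + \<epsilon>\<^esub>) = 0\<close>; since \<open>H\<^sub>k(S) = 0\<close>, also \<open>H\<^sub>k(M\<^bsub>c + \<epsilon>\<^esub>) = 0\<close>, and the exact sequence of the pair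
  gives a contradiction. For (iv), let \<open>p\<close> and \<open>q\<close> be two points of index \<open>m\<close> with \<open>f p \<le> f q\<close>; the same
  argument applies to the contractible space \<open>S - {q}\<close> in place of \<open>M\<^bsub>c + \<epsilon>\<^esub>\<close>. Statement (i) is (iv) for \<open>-f\<close>,
  and (iii) is vacuous because an index is at most \<open>m\<close>.\<close>

section \<open>Relative homology of subspaces\<close>

text \<open>Vanishing is a statement about maps: near a critical point of index k the inclusion of
  the local pair into (M_{c+\<epsilon>}, M_{c-\<epsilon>}) is homotopic to a map through a k-disk
  modulo its boundary, so it is zero in degrees other than k. All that this asks of a chart is
  quadratic bounds for f and monotonicity along hyperbolas, and both follow from approximating the
  derivative by the Hessian. The role of a flow is taken by single deformations, one for each
  neighbourhood U of the critical set and each e > 0: points move by less than e, f never increases,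
  and it drops by a fixed \<delta> outside U. The bound e keeps a point that starts near a critical
  point inside its neighbourhood. Unreduced homology is exceptional in degree 0, so vanishing is
  stated for j \<ge> 1. Hence k \<ge> 2 in the argument for (ii), while the circle, m = 1, is
  settled in (i) and (iv) by the minimum and the maximum. In degree m the group of S itself is
  nonzero, which blocks the argument of (ii) there; removing q restores vanishing, and f p \<le> f q
  keeps q out of M_{c-\<epsilon>}. Passing to -f merely exchanges the two factors of a
  chart.\<close>

lemma trivial_group_middle:
  assumes "exact_seq ([C, B, A], [g, f])" "trivial_group A" "trivial_group C"
  shows "trivial_group B"
proof -
  have AB: "group A" "group B" "group C" "f \<in> hom A B" "g \<in> hom B C" and k: "kernel B C g = f ` carrier A"
    using assms(1) by (auto simp: group_hom_def group_hom_axioms_def)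
  have "f ` carrier A = {\<one>\<^bsub>B\<^esub>}"
    using assms(2) AB hom_one by (force simp: trivial_group_def)
  moreover have "kernel B C g = carrier B"
    using assms(3) AB by (auto simp: kernel_def trivial_group_def hom_def)
  ultimately show ?thesis
    using k AB by (simp add: trivial_group_def)
qed

lemma trivial_groupI: "group G \<Longrightarrow> (\<And>z. z \<in> carrier G \<Longrightarrow> z = \<one>\<^bsub>G\<^esub>) \<Longrightarrow> trivial_group G"
  using group.is_monoid monoid.one_closed unfolding trivial_group_def by blast

lemma iso_surjE:
  assumes "f \<in> iso G H" "y \<in> carrier H"
  obtains x where "x \<in> carrier G" "f x = y"
proof -
  have "y \<in> f ` carrier G" using assms by (simp add: iso_def bij_betw_def)
  then show ?thesis using that by blast
qed

abbreviation rel_homology :: "int \<Rightarrow> 'a::topological_space set \<Rightarrow> 'a set \<Rightarrow> 'a chain set monoid" where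
  "rel_homology j X A \<equiv> relative_homology_group j (top_of_set X) A"

abbreviation rel_map ::
    "int \<Rightarrow> 'a::topological_space set \<Rightarrow> 'a set \<Rightarrow> 'b::topological_space set \<Rightarrow> 'b set \<Rightarrow> ('a \<Rightarrow> 'b) \<Rightarrow> 'a chain set \<Rightarrow> 'b chain set" where
  "rel_map j X A Y B f \<equiv> hom_induced j (top_of_set X) A (top_of_set Y) B f"

abbreviation rel_one :: "int \<Rightarrow> 'a::topological_space set \<Rightarrow> 'a set \<Rightarrow> 'a chain set" where
  "rel_one j X A \<equiv> \<one>\<^bsub>rel_homology j X A\<^esub>"

abbreviation no_homology :: "int \<Rightarrow> 'a::topological_space set \<Rightarrow> 'a set \<Rightarrow> bool" where
  "no_homology j X A \<equiv> trivial_group (rel_homology j X A)"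

lemma subtopology_top_of_set: "A \<subseteq> X \<Longrightarrow> subtopology (top_of_set X) A = top_of_set A"
  by (simp add: subtopology_subtopology inf_absorb2)

text \<open>Exactness of H_j(B, A) -> H_j(X, A) -> H_j(X, B). This glues adjacent intervals of
  levels.\<close>

lemma trivial_rel_homology_triple:
  assumes "A \<subseteq> B" "B \<subseteq> X" "no_homology j X B" "no_homology j B A"
  shows "no_homology j X A"
  using trivial_group_middle[OF homology_exactness_triple_3[OF assms(1), of j "top_of_set X"]] assms
  by (simp add: subtopology_top_of_set)

lemma trivial_rel_homology_of_space:
  assumes "A \<subseteq> X" "no_homology j X {}" "no_homology (j - 1) A {}"
  shows "no_homology j X A"
  using trivial_group_middle[OF homology_exactness_axiom_1[of j "top_of_set X" A]] assms
  by (simp add: subtopology_top_of_set)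

text \<open>Exactness of H_{j+1}(X, A) -> H_j(A) -> H_j(X); the boundary map accounts for the degree
  \<open>j + 1\<close>.\<close>

lemma trivial_homology_subspace:
  assumes "A \<subseteq> X" "no_homology (j + 1) X A" "no_homology j X {}"
  shows "no_homology j A {}"
  using trivial_group_middle[OF homology_exactness_axiom_2[of "j + 1" "top_of_set X" A]] assms
  by (simp add: subtopology_top_of_set)

text \<open>The homotopy axiom in terms of \<open>continuous_on\<close>. The ends of the homotopy
  have to agree with \<open>f\<close> and \<open>g\<close> on \<open>X\<close> only, so maps given
  by formulas that are meaningless outside \<open>X\<close> can be used as they are.\<close>

lemma rel_map_homotopic:
  assumes "continuous_on ({0..1::real} \<times> X) (\<lambda>(t, x). h t x)"
    and "\<And>t x. t \<in> {0..1} \<Longrightarrow> x \<in> X \<Longrightarrow> h t x \<in> Y"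
    and "\<And>t x. t \<in> {0..1} \<Longrightarrow> x \<in> A \<Longrightarrow> h t x \<in> B"
    and "A \<subseteq> X" "\<And>x. x \<in> X \<Longrightarrow> h 0 x = f x" "\<And>x. x \<in> X \<Longrightarrow> h 1 x = g x"
  shows "rel_map j X A Y B f = rel_map j X A Y B g"
proof (rule homology_homotopy_axiom)
  show "homotopic_with (\<lambda>h. h \<in> A \<rightarrow> B) (top_of_set X) (top_of_set Y) f g"
  proof (subst homotopic_with)
    fix h k :: "'a \<Rightarrow> 'b" assume "\<And>x. x \<in> topspace (top_of_set X) \<Longrightarrow> h x = k x"
    then show "(h \<in> A \<rightarrow> B) = (k \<in> A \<rightarrow> B)" using \<open>A \<subseteq> X\<close> by (auto simp: Pi_iff subset_iff)
  next
    have "prod_topology (top_of_set {0..1::real}) (top_of_set X) = top_of_set ({0..1} \<times> X)"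
      by (simp add: subtopology_Times)
    then have "continuous_map (prod_topology (top_of_set {0..1}) (top_of_set X)) (top_of_set Y) (\<lambda>(t, x). h t x)"
      using assms(1,2) by auto
    then show "\<exists>h. continuous_map (prod_topology (top_of_set {0..1}) (top_of_set X)) (top_of_set Y) h \<and>
        (\<forall>x\<in>topspace (top_of_set X). h (0::real, x) = f x) \<and>
        (\<forall>x\<in>topspace (top_of_set X). h (1, x) = g x) \<and> (\<forall>t\<in>{0..1}. (\<lambda>x. h (t, x)) \<in> A \<rightarrow> B)"
      using assms by (intro exI[of _ "\<lambda>(t, x). h t x"]) auto
  qed
qed

lemma rel_map_factor:
  assumes "continuous_on X f" "f \<in> X \<rightarrow> Y" "f \<in> A \<rightarrow> B" "continuous_on Y g" "g \<in> Y \<rightarrow> Z" "g \<in> B \<rightarrow> C"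
  shows "rel_map j Y B Z C g (rel_map j X A Y B f z) = rel_map j X A Z C (g \<circ> f) z"
  using assms by (intro hom_induced_compose') auto

lemma id_mem_Pi: "A \<subseteq> B \<Longrightarrow> id \<in> A \<rightarrow> B"
  by auto

lemma rel_map_one: "rel_map j X A Y B f (rel_one j X A) = rel_one j Y B"
  by (rule hom_one[OF hom_induced_hom]) auto

lemma rel_map_mult:
  assumes "x \<in> carrier (rel_homology j X A)" "y \<in> carrier (rel_homology j X A)"
  shows "rel_map j X A Y B f (x \<otimes>\<^bsub>rel_homology j X A\<^esub> y) =
    rel_map j X A Y B f x \<otimes>\<^bsub>rel_homology j Y B\<^esub> rel_map j X A Y B f y"
  by (rule hom_mult[OF hom_induced_hom assms])

text \<open>A class that passes through a trivial group dies; this is how relative classes are shown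
  to vanish below.\<close>

lemma rel_map_trivial_factor:
  assumes "no_homology j Y B"
    and "continuous_on X f" "f \<in> X \<rightarrow> Y" "f \<in> A \<rightarrow> B" "continuous_on Y g" "g \<in> Y \<rightarrow> Z" "g \<in> B \<rightarrow> C"
  shows "rel_map j X A Z C (g \<circ> f) z = rel_one j Z C"
proof -
  have "rel_map j X A Y B f z = rel_one j Y B"
    using hom_induced_carrier[of j "top_of_set X" A "top_of_set Y" B f z] assms(1)
    unfolding trivial_group_def by simp
  then show ?thesis
    using rel_map_factor[OF assms(2-), where j=j and z=z] by (simp add: rel_map_one)
qed

text \<open>Excision phrased by the piece \<open>N\<close> that remains. The relatively open
  \<open>V\<close> between \<open>Z\<close> and \<open>B\<close> witnesses that the closure of
  \<open>Z\<close> lies in the interior of \<open>B\<close>.\<close>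

lemma rel_homology_excision:
  assumes "N \<subseteq> X" "B \<subseteq> X" "closedin (top_of_set X) Z" "openin (top_of_set X) V" "Z \<subseteq> V" "V \<subseteq> B" "X - Z = N"
  shows "rel_map j N (B \<inter> N) X B id \<in> iso (rel_homology j N (B \<inter> N)) (rel_homology j X B)"
proof -
  have "top_of_set X closure_of Z \<subseteq> top_of_set X interior_of B"
    using assms by (metis closure_of_closedin interior_of_maximal subset_trans)
  then have "hom_induced j (subtopology (top_of_set X) (X - Z)) (B - Z) (subtopology (top_of_set X) X) B id
    \<in> iso (relative_homology_group j (subtopology (top_of_set X) (X - Z)) (B - Z))
          (relative_homology_group j (subtopology (top_of_set X) X) B)"
    by (rule homology_excision_axiom) (use assms in auto)
  moreover have "B - Z = B \<inter> N" "subtopology (top_of_set X) (X - Z) = top_of_set N"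
    using assms by (auto simp: subtopology_subtopology intro!: arg_cong[where f="subtopology euclidean"])
  ultimately show ?thesis by (simp add: subtopology_subtopology)
qed

text \<open>Every class of \<open>(U \<union> V, C)\<close> is a product of a class from
  \<open>U\<close> and one from \<open>V\<close>. The intermediate set \<open>C \<union> V\<close>
  separates them: excising \<open>V\<close> turns the pair
  \<open>(U \<union> V, C \<union> V)\<close> into \<open>(U, C \<inter> U)\<close>, and excising
  \<open>C \<inter> U\<close> turns \<open>(C \<union> V, C)\<close> into
  \<open>(V, C \<inter> V)\<close>.\<close>

lemma rel_map_zero_Un:
  assumes UV: "openin (top_of_set (U \<union> V)) U" "openin (top_of_set (U \<union> V)) V" "U \<inter> V = {}"
    and C: "C \<subseteq> U \<union> V" "U \<union> V \<subseteq> X" "C \<subseteq> A" "A \<subseteq> X"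
    and zU: "\<And>z. z \<in> carrier (rel_homology j U (C \<inter> U)) \<Longrightarrow> rel_map j U (C \<inter> U) X A id z = rel_one j X A"
    and zV: "\<And>z. z \<in> carrier (rel_homology j V (C \<inter> V)) \<Longrightarrow> rel_map j V (C \<inter> V) X A id z = rel_one j X A"
    and z: "z \<in> carrier (rel_homology j (U \<union> V) C)"
  shows "rel_map j (U \<union> V) C X A id z = rel_one j X A"
proof -
  let ?P = "U \<union> V" and ?Q = "C \<union> V"
  have clV: "closedin (top_of_set ?P) V" "closedin (top_of_set ?P) U"
    using UV by (auto simp: closedin_def Un_Diff Diff_triv Int_commute)
  have 1: "rel_map j U (?Q \<inter> U) ?P ?Q id \<in> iso (rel_homology j U (?Q \<inter> U)) (rel_homology j ?P ?Q)"
    by (rule rel_homology_excision[where V=V and Z=V]) (use UV C clV in auto)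
  have "rel_map j V (C \<inter> V) ?Q C id \<in> iso (rel_homology j V (C \<inter> V)) (rel_homology j ?Q C)"
  proof (rule rel_homology_excision[where V="C \<inter> U" and Z="C \<inter> U"])
    have "C \<inter> U = ?Q \<inter> U" using UV by auto
    then show "closedin (top_of_set ?Q) (C \<inter> U)" "openin (top_of_set ?Q) (C \<inter> U)"
      using openin_subtopology_Int[OF UV(1), of ?Q] closedin_subtopology_Int_closed[OF clV(2), of ?Q]
        subtopology_top_of_set[of ?Q ?P] C by (simp_all add: Int_commute)
  qed (use UV C in auto)
  then have 2: "rel_map j V (C \<inter> V) ?Q C id \<in> iso (rel_homology j V (C \<inter> V)) (rel_homology j ?Q C)" .
  let ?G = "rel_homology j ?P C"
  have QU: "?Q \<inter> U = C \<inter> U" using UV by auto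
  obtain u where u: "u \<in> carrier (rel_homology j U (C \<inter> U))"
      "rel_map j U (C \<inter> U) ?P ?Q id u = rel_map j ?P C ?P ?Q id z"
    using iso_surjE[OF 1[unfolded QU] hom_induced_carrier] .
  define u' where "u' = rel_map j U (C \<inter> U) ?P C id u"
  have u': "u' \<in> carrier ?G" unfolding u'_def by (rule hom_induced_carrier)
  interpret G: group ?G by simp
  interpret K: group "rel_homology j X A" by simp
  \<comment> \<open>\<open>u'\<close> and \<open>z\<close> have the same image in the group of
    \<open>(?P, ?Q)\<close>. So \<open>w\<close> lies in the kernel and comes from
    \<open>(?Q, C)\<close> by the exact sequence of the triple.\<close>
  define w where "w = z \<otimes>\<^bsub>?G\<^esub> inv\<^bsub>?G\<^esub> u'"
  have w: "w \<in> carrier ?G" and zw: "z = w \<otimes>\<^bsub>?G\<^esub> u'"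
    unfolding w_def using z u' by (auto simp: G.m_assoc)
  interpret h: group_hom ?G "rel_homology j ?P ?Q" "rel_map j ?P C ?P ?Q id"
    by (simp add: group_hom_def group_hom_axioms_def hom_induced_hom)
  have "rel_map j ?P C ?P ?Q id u' = rel_map j ?P C ?P ?Q id z"
    unfolding u'_def u(2)[symmetric] by (subst rel_map_factor) auto
  then have "rel_map j ?P C ?P ?Q id w = rel_one j ?P ?Q"
    unfolding w_def using z u' by (simp add: h.hom_mult h.hom_inv)
  then have "w \<in> kernel ?G (rel_homology j ?P ?Q) (rel_map j ?P C ?P ?Q id)"
    using w by (simp add: kernel_def)
  also have "\<dots> = rel_map j ?Q C ?P C id ` carrier (rel_homology j ?Q C)"
    using homology_exactness_triple_3[of C ?Q j "top_of_set ?P"] C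
    by (simp add: subtopology_top_of_set)
  finally obtain v where v: "v \<in> carrier (rel_homology j ?Q C)" "rel_map j ?Q C ?P C id v = w" by blast
  obtain v' where v': "v' \<in> carrier (rel_homology j V (C \<inter> V))" "rel_map j V (C \<inter> V) ?Q C id v' = v"
    using iso_surjE[OF 2 v(1)] .
  then have "rel_map j V (C \<inter> V) ?P C id v' = w"
    using v(2) rel_map_factor[of V id ?Q "C \<inter> V" C id ?P C j v', OF _ id_mem_Pi id_mem_Pi _ id_mem_Pi id_mem_Pi] C by auto
  then have "rel_map j ?P C X A id w = rel_map j V (C \<inter> V) X A id v'"
    using rel_map_factor[of V id ?P "C \<inter> V" C id X A j v', OF _ id_mem_Pi id_mem_Pi _ id_mem_Pi id_mem_Pi] C by auto
  moreover have "rel_map j ?P C X A id u' = rel_map j U (C \<inter> U) X A id u"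
    unfolding u'_def 
    using rel_map_factor[of U id ?P "C \<inter> U" C id X A j u, OF _ id_mem_Pi id_mem_Pi _ id_mem_Pi id_mem_Pi] C by auto
  moreover have "rel_map j ?P C X A id z =
      rel_map j ?P C X A id w \<otimes>\<^bsub>rel_homology j X A\<^esub> rel_map j ?P C X A id u'"
    unfolding zw by (rule rel_map_mult[OF w u'])
  ultimately show ?thesis using zU[OF u(1)] zV[OF v'(1)] by simp
qed

lemma rel_map_zero_Union:
  fixes N :: "'i \<Rightarrow> 'a::topological_space set"
  assumes "finite P" "\<And>p. p \<in> P \<Longrightarrow> openin (top_of_set (\<Union>p\<in>P. N p)) (N p)"
    and "\<And>p q. p \<in> P \<Longrightarrow> q \<in> P \<Longrightarrow> p \<noteq> q \<Longrightarrow> N p \<inter> N q = {}"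
    and "(\<Union>p\<in>P. N p) \<subseteq> X" "C \<subseteq> A" "A \<subseteq> X"
    and "\<And>p z. p \<in> P \<Longrightarrow> z \<in> carrier (rel_homology j (N p) (C \<inter> N p)) \<Longrightarrow>
      rel_map j (N p) (C \<inter> N p) X A id z = rel_one j X A"
    and "z \<in> carrier (rel_homology j (\<Union>p\<in>P. N p) (C \<inter> (\<Union>p\<in>P. N p)))"
  shows "rel_map j (\<Union>p\<in>P. N p) (C \<inter> (\<Union>p\<in>P. N p)) X A id z = rel_one j X A"
  using assms
proof (induction P arbitrary: z rule: finite_induct)
  case empty
  have "no_homology j ({}::'a set) {}"
    by (rule trivial_relative_homology_group_empty) simp
  then have "z = rel_one j ({}::'a set) {}"
    using empty.prems by (simp add: trivial_group_def)
  then show ?case using rel_map_one[of j "{}::'a set" "{}" X A id] by (simp add: id_def)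
next
  case (insert q P)
  let ?M = "\<Union>p\<in>P. N p"
  have eq: "(\<Union>p\<in>insert q P. N p) = N q \<union> ?M" by simp
  have op: "openin (top_of_set ?M) (N p)" if "p \<in> P" for p
    using insert.prems(1)[of p] that by (auto intro: openin_subset_trans)
  have "openin (top_of_set (N q \<union> ?M)) (N q)"
    using insert.prems(1) unfolding eq by auto
  moreover have "openin (top_of_set (N q \<union> ?M)) ?M"
    using insert.prems(1) unfolding eq by (intro openin_Union) auto
  moreover have "N q \<inter> ?M = {}" using insert.prems(2) insert.hyps by fastforce
  ultimately show ?case
    unfolding eq
  proof (rule rel_map_zero_Un)
    fix z assume "z \<in> carrier (rel_homology j ?M (C \<inter> (N q \<union> ?M) \<inter> ?M))"
    moreover have e: "C \<inter> (N q \<union> ?M) \<inter> ?M = C \<inter> ?M" by auto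
    ultimately show "rel_map j ?M (C \<inter> (N q \<union> ?M) \<inter> ?M) X A id z = rel_one j X A"
      unfolding e using insert.prems op by (intro insert.IH) auto
  next
    fix z assume "z \<in> carrier (rel_homology j (N q) (C \<inter> (N q \<union> ?M) \<inter> N q))"
    moreover have e: "C \<inter> (N q \<union> ?M) \<inter> N q = C \<inter> N q" by auto
    ultimately show "rel_map j (N q) (C \<inter> (N q \<union> ?M) \<inter> N q) X A id z = rel_one j X A"
      unfolding e by (intro insert.prems) auto
  qed (use insert.prems in auto)
qed

text \<open>If a deformation of \<open>(X, A)\<close> compresses \<open>X\<close> into \<open>A\<close> together with small pieces \<open>N p\<close>, then all of
  the relative homology comes from these pieces. The slightly smaller set \<open>A'\<close> gives the room
  needed for excision.\<close>

lemma trivial_rel_homology_deformation: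
  assumes h: "continuous_on ({0..1::real} \<times> X) (\<lambda>(t, x). h t x)"
    "\<And>t x. t \<in> {0..1} \<Longrightarrow> x \<in> X \<Longrightarrow> h t x \<in> X"
    "\<And>t x. t \<in> {0..1} \<Longrightarrow> x \<in> A \<Longrightarrow> h t x \<in> A"
    "\<And>x. x \<in> X \<Longrightarrow> h 0 x = x"
    "\<And>x. x \<in> X \<Longrightarrow> h 1 x \<in> A' \<union> (\<Union>p\<in>P. N p)"
    and A: "A' \<subseteq> V" "V \<subseteq> A" "A \<subseteq> X" "openin (top_of_set X) V" "closedin (top_of_set X) A'"
    and P: "finite P" "\<And>p. p \<in> P \<Longrightarrow> openin (top_of_set X) (N p)"
      "\<And>p q. p \<in> P \<Longrightarrow> q \<in> P \<Longrightarrow> p \<noteq> q \<Longrightarrow> N p \<inter> N q = {}"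
    and zero: "\<And>p z. p \<in> P \<Longrightarrow> z \<in> carrier (rel_homology j (N p) (A \<inter> N p)) \<Longrightarrow>
      rel_map j (N p) (A \<inter> N p) X A id z = rel_one j X A"
  shows "no_homology j X A"
proof -
  let ?N = "\<Union>p\<in>P. N p"
  \<comment> \<open>\<open>Y\<close> is the set into which \<open>h 1\<close> compresses
    \<open>X\<close>. The identity of \<open>(X, A)\<close> therefore factors up to homotopy through
    \<open>(Y, A \<inter> Y)\<close>, and excising the closed set \<open>A' - ?N\<close>, which lies
    in the open part \<open>V \<inter> Y\<close> of \<open>A\<close>, leaves only the small
    pieces.\<close>
  define Y where "Y = A' \<union> ?N"
  have NX: "N p \<subseteq> X" if "p \<in> P" for p using P(2)[OF that] openin_imp_subset by blast
  have YX: "Y \<subseteq> X" using A NX by (fastforce simp: Y_def)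
  have opN: "openin (top_of_set X) ?N" using P by blast
  have exc: "rel_map j ?N ((A \<inter> Y) \<inter> ?N) Y (A \<inter> Y) id
      \<in> iso (rel_homology j ?N ((A \<inter> Y) \<inter> ?N)) (rel_homology j Y (A \<inter> Y))"
  proof (rule rel_homology_excision[where Z="A' - ?N" and V="V \<inter> Y"])
    have "openin (top_of_set Y) (V \<inter> Y)"
      using openin_subtopology_Int[OF A(4), of Y] YX by (simp add: subtopology_top_of_set)
    then show "openin (top_of_set Y) (V \<inter> Y)" .
    have "closedin (top_of_set X) (A' - ?N)" using A(5) opN by (rule closedin_diff)
    then show "closedin (top_of_set Y) (A' - ?N)"
      by (rule closedin_subset_trans) (use YX in \<open>auto simp: Y_def\<close>)
  qed (use A in \<open>auto simp: Y_def\<close>)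
  have e: "(A \<inter> Y) \<inter> ?N = A \<inter> ?N" by (auto simp: Y_def)
  have "z = rel_one j X A" if z: "z \<in> carrier (rel_homology j X A)" for z
  proof -
    have hc: "continuous_on X (h 1)"
    proof -
      have "continuous_on X ((\<lambda>(t, x). h t x) \<circ> (\<lambda>x. (1, x)))"
        by (rule continuous_on_compose[OF _ continuous_on_subset[OF h(1)]]) (auto intro!: continuous_intros)
      then show ?thesis by (simp add: o_def)
    qed
    have "rel_map j X A X A id = rel_map j X A X A (h 1)"
      by (rule rel_map_homotopic[OF h(1)]) (use h A in auto)
    then have "z = rel_map j X A X A (id \<circ> h 1) z" using hom_induced_id[OF z] by simp
    also have "\<dots> = rel_map j Y (A \<inter> Y) X A id (rel_map j X A Y (A \<inter> Y) (h 1) z)"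
    proof (rule rel_map_factor[symmetric])
      show "h 1 \<in> X \<rightarrow> Y" using h(5) by (auto simp: Y_def)
      then show "h 1 \<in> A \<rightarrow> A \<inter> Y" using h(3)[of 1] A(3) by auto
    qed (use hc YX in auto)
    also obtain y where y: "y \<in> carrier (rel_homology j ?N (A \<inter> ?N))"
       "rel_map j X A Y (A \<inter> Y) (h 1) z = rel_map j ?N (A \<inter> ?N) Y (A \<inter> Y) id y"
      using iso_surjE[OF exc[unfolded e] hom_induced_carrier] by metis
    note y(2)
    also have "rel_map j Y (A \<inter> Y) X A id (rel_map j ?N (A \<inter> ?N) Y (A \<inter> Y) id y)
        = rel_map j ?N (A \<inter> ?N) X A (id \<circ> id) y"
      by (rule rel_map_factor) (use YX in \<open>auto simp: Y_def\<close>)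
    also have "\<dots> = rel_one j X A"
      unfolding o_id
    proof (rule rel_map_zero_Union)
      show "openin (top_of_set ?N) (N p)" if "p \<in> P" for p
        by (rule openin_subset_trans[OF P(2)[OF that]]) (use that NX in auto)
    qed (use y P A NX[THEN subsetD] zero in auto)
    finally show ?thesis .
  qed
  then show ?thesis by (intro trivial_groupI) auto
qed


section \<open>Disks and spheres in linear subspaces, and classes detected by crossing\<close>

lemma nontrivial_group_element:
  assumes "\<not> trivial_group G" "group G"
  obtains z where "z \<in> carrier G" "z \<noteq> \<one>\<^bsub>G\<^esub>"
  using assms group.is_monoid monoid.one_closed unfolding trivial_group_def by blast

text \<open>An orthonormal basis of \<open>E\<close> identifies its unit sphere with
  \<open>nsphere (dim E - 1)\<close>, and scaling changes the radius.\<close>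

lemma reduced_homology_sphere_in_subspace:
  fixes E :: "'a::euclidean_space set"
  assumes "subspace E" "dim E \<ge> 1" "r > 0"
  shows "trivial_group (reduced_homology_group j (top_of_set (E \<inter> sphere 0 r))) \<longleftrightarrow> j \<noteq> int (dim E) - 1"
proof -
  obtain B where B: "B \<subseteq> E" "pairwise orthogonal B" "\<And>x. x \<in> B \<Longrightarrow> norm x = 1" "independent B"
      "card B = dim E" "span B = E"
    using orthonormal_basis_subspace[OF assms(1)] by metis
  obtain f :: "(nat \<Rightarrow> real) \<Rightarrow> 'a" and g
    where "homeomorphic_maps (nsphere (dim E - 1)) (top_of_set (sphere 0 1 \<inter> span B)) f g"
    using homeomorphic_maps_nsphere_euclidean_sphere[OF B(4,2,5) _ B(3)] assms(2) by (metis not_one_le_zero)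
  then have 1: "nsphere (dim E - 1) homeomorphic_space top_of_set (E \<inter> sphere 0 1)"
    unfolding homeomorphic_space_def B(6) by (metis Int_commute)
  have "homeomorphism (E \<inter> sphere 0 1) (E \<inter> sphere 0 r) (\<lambda>x. r *\<^sub>R x) (\<lambda>x. (1 / r) *\<^sub>R x)"
    by (rule homeomorphismI) (use assms in \<open>auto simp: subspace_scale intro!: continuous_intros\<close>)
  then have 2: "top_of_set (E \<inter> sphere 0 1) homeomorphic_space top_of_set (E \<inter> sphere 0 r)"
    by (auto simp: homeomorphic_def)
  have "reduced_homology_group j (nsphere (dim E - 1)) \<cong> reduced_homology_group j (top_of_set (E \<inter> sphere 0 r))"
    by (rule homeomorphic_space_imp_isomorphic_reduced_homology_groups[OF homeomorphic_space_trans[OF 1 2]])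
  then show ?thesis
    using isomorphic_group_triviality[of "reduced_homology_group j (nsphere (dim E - 1))"
        "reduced_homology_group j (top_of_set (E \<inter> sphere 0 r))"]
      trivial_reduced_homology_group_nsphere[of j "dim E - 1"] assms(2) by (simp add: of_nat_diff)
qed

lemma contractible_space_convex: "convex S \<Longrightarrow> contractible_space (top_of_set (S::'a::real_normed_vector set))"
  by (simp add: convex_imp_contractible)

lemma trivial_homology_contractible:
  assumes "contractible S" "j \<noteq> 0"
  shows "no_homology j S {}"
  using trivial_reduced_homology_group_contractible_space[of "top_of_set S" j] assms
  by (simp add: un_reduced_homology_group)

lemma convex_disk: "subspace E \<Longrightarrow> convex (E \<inter> cball 0 (r::real) :: 'a::euclidean_space set)"
  by (simp add: convex_Int subspace_imp_convex)

lemma sphere_in_subspace_nonempty: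
  fixes E :: "'a::euclidean_space set"
  assumes "subspace E" "dim E \<ge> 1" "r > 0"
  obtains x where "x \<in> E" "norm x = r"
proof -
  obtain x where "x \<in> E" "x \<noteq> 0"
    using assms(2) by (metis dim_eq_0 not_one_le_zero subset_singleton_iff singletonI subsetI)
  then show ?thesis using assms that[of "(r / norm x) *\<^sub>R x"] by (simp add: subspace_scale)
qed

text \<open>The disk is contractible, so the boundary map shifts the question to degree
  \<open>j - 1\<close> on the sphere. For \<open>E = {0}\<close> the sphere is empty and the pair is
  a point, with homology in degree 0 only.\<close>

lemma trivial_homology_disk_boundary:
  fixes E :: "'a::euclidean_space set"
  assumes E: "subspace E" "r > 0" and j: "j \<ge> 1" "j \<noteq> int (dim E)"
  shows "no_homology j (E \<inter> cball 0 r) (E \<inter> sphere 0 r)"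
proof (cases "dim E = 0")
  case True
  then have "E \<inter> sphere 0 r = {}" using E subspace_0 by (auto simp: subset_iff)
  then show ?thesis
    using trivial_homology_contractible[OF convex_imp_contractible[OF convex_disk[OF E(1)]]] j by auto
next
  case False
  then obtain x where "x \<in> E" "norm x = r"
    using sphere_in_subspace_nonempty[OF E(1) _ E(2)] by (metis One_nat_def Suc_leI neq0_conv)
  then have "topspace (top_of_set (E \<inter> cball 0 r)) \<inter> (E \<inter> sphere 0 r) \<noteq> {}" by auto
  then have "rel_homology j (E \<inter> cball 0 r) (E \<inter> sphere 0 r) \<cong>
      reduced_homology_group (j - 1) (subtopology (top_of_set (E \<inter> cball 0 r)) (E \<inter> sphere 0 r))"
    using contractible_space_convex[OF convex_disk[OF E(1)]]
    by (intro isomorphic_group_relative_homology_of_contractible)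
  moreover have "subtopology (top_of_set (E \<inter> cball 0 r)) (E \<inter> sphere 0 r) = top_of_set (E \<inter> sphere 0 r)"
    by (rule subtopology_top_of_set) auto
  ultimately show ?thesis
    using reduced_homology_sphere_in_subspace[OF E(1) _ E(2), of "j - 1"] False j
     isomorphic_group_triviality[of "rel_homology j (E \<inter> cball 0 r) (E \<inter> sphere 0 r)"
       "reduced_homology_group (j - 1) (top_of_set (E \<inter> sphere 0 r))"] by simp
qed

text \<open>Take a class \<open>z\<close> whose boundary \<open>w\<close> is nonzero on the sphere.
  If \<open>z\<close> died in \<open>(E, E - {0})\<close>, then by naturality \<open>w\<close> would
  die in \<open>E - {0}\<close>; but the radial retraction onto the sphere recovers
  \<open>w\<close>.\<close>

lemma disk_class_nonzero_in_punctured_space: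
  fixes E :: "'a::euclidean_space set"
  assumes E: "subspace E" "r > 0" "dim E \<ge> 1"
  obtains z where "rel_map (int (dim E)) (E \<inter> cball 0 r) (E \<inter> sphere 0 r) E (E - {0}) id z
    \<noteq> rel_one (int (dim E)) E (E - {0})"
proof -
  let ?k = "int (dim E)" and ?D = "E \<inter> cball 0 r" and ?S = "E \<inter> sphere 0 r" and ?P = "E - {0}"
  obtain x where "x \<in> E" "norm x = r"
    using sphere_in_subspace_nonempty[OF E(1,3,2)] .
  then have "topspace (top_of_set ?D) \<inter> ?S \<noteq> {}" by auto
  moreover have st: "subtopology (top_of_set ?D) ?S = top_of_set ?S" "subtopology (top_of_set E) ?P = top_of_set ?P"
    by (rule subtopology_top_of_set; auto)+
  ultimately have iso: "hom_boundary ?k (top_of_set ?D) ?S \<in> iso (rel_homology ?k ?D ?S) (reduced_homology_group (?k - 1) (top_of_set ?S))"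
    using iso_relative_homology_of_contractible[OF contractible_space_convex[OF convex_disk[OF E(1)], of r], where S="?S" and p="?k"] by simp
  have "\<not> trivial_group (reduced_homology_group (?k - 1) (top_of_set ?S))"
    using reduced_homology_sphere_in_subspace[OF E(1,3,2), of "?k - 1"] by simp
  then obtain w where w: "w \<in> carrier (reduced_homology_group (?k - 1) (top_of_set ?S))"
      "w \<noteq> rel_one (?k - 1) ?S {}"
    by (metis nontrivial_group_element group_reduced_homology_group one_reduced_homology_group)
  obtain z where z: "z \<in> carrier (rel_homology ?k ?D ?S)" "hom_boundary ?k (top_of_set ?D) ?S z = w"
    using iso_surjE[OF iso w(1)] .
  have "rel_map ?k ?D ?S E ?P id z \<noteq> rel_one ?k E ?P"
  proof
    assume 0: "rel_map ?k ?D ?S E ?P id z = rel_one ?k E ?P"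
    have "hom_boundary ?k (top_of_set E) ?P (rel_map ?k ?D ?S E ?P id z) = rel_map (?k - 1) ?S {} ?P {} id w"
      using naturality_hom_induced[of "top_of_set ?D" "top_of_set E" id ?S ?P ?k] z(2) E(2) unfolding st
      by (force simp: o_def fun_eq_iff)
    moreover have "hom_boundary ?k (top_of_set E) ?P (rel_one ?k E ?P) = rel_one (?k - 1) ?P {}"
      using hom_one[OF hom_boundary_hom[of ?k "top_of_set E" ?P]] unfolding st by simp
    ultimately have 1: "rel_map (?k - 1) ?S {} ?P {} id w = rel_one (?k - 1) ?P {}"
      unfolding 0 by simp
    let ?q = "\<lambda>x::'a. (r / norm x) *\<^sub>R x"
    have "rel_map (?k - 1) ?P {} ?S {} ?q (rel_map (?k - 1) ?S {} ?P {} id w) = rel_map (?k - 1) ?S {} ?S {} (?q \<circ> id) w"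
      using E by (intro rel_map_factor) (auto simp: subspace_scale intro!: continuous_intros)
    also have "\<dots> = w"
    proof (rule hom_induced_id_gen)
      have "continuous_on ?S (?q \<circ> id)" using E(2) by (auto intro!: continuous_intros)
      moreover have "(?q \<circ> id) \<in> ?S \<rightarrow> ?S" using E by (auto simp: subspace_scale)
      ultimately show "continuous_map (top_of_set ?S) (top_of_set ?S) (?q \<circ> id)" by auto
      show "w \<in> carrier (rel_homology (?k - 1) ?S {})" using w(1) carrier_reduced_homology_group_subset by blast
    qed (use E in auto)
    finally show False using w(2) unfolding 1 rel_map_one by simp
  qed
  then show thesis by (rule that)
qed

text \<open>The disk \<open>D\<close> crosses \<open>W\<close> exactly once, so it is a nonzero class relative to the complement of \<open>W\<close>.\<close>

lemma nontrivial_rel_homology_crossing: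
  fixes E :: "'a::euclidean_space set" and X :: "'b::topological_space set"
  assumes E: "subspace E" "r > 0" "dim E \<ge> 1"
    and i: "continuous_on (E \<inter> cball 0 r) i" "i \<in> (E \<inter> cball 0 r) \<rightarrow> N" "i \<in> (E \<inter> sphere 0 r) \<rightarrow> A"
    and q: "continuous_on N q" "q \<in> N \<rightarrow> E" "\<And>x. x \<in> N - W \<Longrightarrow> q x \<noteq> 0" "\<And>x. x \<in> E \<inter> cball 0 r \<Longrightarrow> q (i x) = x"
    and N: "openin (top_of_set X) N" "closedin (top_of_set X) W" "W \<subseteq> N" "A \<subseteq> X - W"
  shows "\<not> no_homology (int (dim E)) X A"
proof
  let ?k = "int (dim E)" and ?D = "E \<inter> cball 0 r" and ?S = "E \<inter> sphere 0 r" and ?P = "E - {0}"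
  assume triv: "no_homology ?k X A"
  have NX: "N \<subseteq> X" using N(1) openin_imp_subset by blast
  obtain z where z: "rel_map ?k ?D ?S E ?P id z \<noteq> rel_one ?k E ?P"
    using disk_class_nonzero_in_punctured_space[OF E] .
  have iW: "i \<in> ?S \<rightarrow> (X - W) \<inter> N" using i N(4) by fastforce
  \<comment> \<open>If \<open>(X, A)\<close> had no homology, the class of the disk would vanish
    relative to \<open>X - W\<close>. Excising \<open>X - N\<close> carries this back to
    \<open>N\<close>, so \<open>y\<close> is trivial; but \<open>q\<close> maps \<open>y\<close> to
    the class of the disk in \<open>(E, E - {0})\<close>, because \<open>q\<close> inverts
    \<open>i\<close> on the disk.\<close>
  define y where "y = rel_map ?k ?D ?S N ((X - W) \<inter> N) i z"
  have "rel_map ?k ?D ?S X (X - W) (id \<circ> i) z = rel_one ?k X (X - W)"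
    by (rule rel_map_trivial_factor[OF triv]) (use i NX N(4) in auto)
  moreover have "rel_map ?k N ((X - W) \<inter> N) X (X - W) id y = rel_map ?k ?D ?S X (X - W) (id \<circ> i) z"
    unfolding y_def by (rule rel_map_factor) (use i iW NX in auto)
  moreover have "rel_map ?k N ((X - W) \<inter> N) X (X - W) id \<in> iso (rel_homology ?k N ((X - W) \<inter> N)) (rel_homology ?k X (X - W))"
    by (rule rel_homology_excision[where Z="X - N" and V="X - W"])
      (use N NX in \<open>auto simp: openin_diff closedin_diff\<close>)
  moreover have "y \<in> carrier (rel_homology ?k N ((X - W) \<inter> N))" unfolding y_def by (rule hom_induced_carrier)
  ultimately have y1: "y = rel_one ?k N ((X - W) \<inter> N)"
    using rel_map_one[of ?k N "(X - W) \<inter> N" X "X - W" id]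
    unfolding iso_def bij_betw_def by (metis (no_types, lifting) Int_iff group.is_monoid group_relative_homology_group inj_onD mem_Collect_eq monoid.one_closed)
  have "rel_map ?k N ((X - W) \<inter> N) E ?P q y = rel_map ?k ?D ?S E ?P (q \<circ> i) z"
    unfolding y_def by (rule rel_map_factor) (use i iW q in auto)
  also have "rel_map ?k ?D ?S E ?P (q \<circ> i) = rel_map ?k ?D ?S E ?P id"
    by (rule rel_map_homotopic[where h="\<lambda>t x. x"]) (use q E(2) in \<open>auto intro!: continuous_intros simp: case_prod_unfold\<close>)
  finally show False using z unfolding y1 rel_map_one by simp
qed

section \<open>Critical points in hyperbolic coordinates\<close>

definition coord_box :: "'b::euclidean_space set \<Rightarrow> 'b set \<Rightarrow> real \<Rightarrow> ('b \<times> 'b) set" where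
  "coord_box E F r = (E \<inter> ball 0 r) \<times> (F \<inter> ball 0 r)"

text \<open>Coordinates around a critical point in which \<open>f\<close> is only compared with quadratic forms; this
  replaces the Morse lemma. The last condition says that \<open>f\<close> decreases along the hyperbolas
  \<open>(\<mu> x, y / \<mu>)\<close>.\<close>

definition morse_chart :: "('a::euclidean_space \<Rightarrow> real) \<Rightarrow> 'a set \<Rightarrow> 'a \<Rightarrow> 'b::euclidean_space set \<Rightarrow> 'b set \<Rightarrow> bool" where
  "morse_chart f S p E F \<longleftrightarrow> subspace E \<and> subspace F \<and>
    (\<exists>\<phi> \<psi> r a b. 0 < r \<and> 0 < a \<and> 0 < b \<and> \<phi> (0, 0) = p \<and>
      openin (top_of_set S) (\<phi> ` coord_box E F r) \<and>
      homeomorphism (coord_box E F r) (\<phi> ` coord_box E F r) \<phi> \<psi> \<and>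
      (\<forall>x y. (x, y) \<in> coord_box E F r \<longrightarrow>
         f p - b * (norm x)\<^sup>2 + a * (norm y)\<^sup>2 \<le> f (\<phi> (x, y)) \<and>
         f (\<phi> (x, y)) \<le> f p - a * (norm x)\<^sup>2 + b * (norm y)\<^sup>2) \<and>
      (\<forall>x y \<mu>. (x, y) \<in> coord_box E F r \<and> \<mu> \<ge> 1 \<and> norm (\<mu> *\<^sub>R x) < r \<longrightarrow>
         f (\<phi> (\<mu> *\<^sub>R x, (1 / \<mu>) *\<^sub>R y)) \<le> f (\<phi> (x, y))))"

abbreviation sublevel :: "('a \<Rightarrow> real) \<Rightarrow> 'a set \<Rightarrow> real \<Rightarrow> 'a set" where
  "sublevel f S c \<equiv> {x \<in> S. f x \<le> c}"

text \<open>Swapping the two components exchanges the upper and lower bounds and reverses the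
  hyperbolas: the factor \<open>\<mu>\<close> takes the swapped point
  \<open>(y / \<mu>, \<mu> x)\<close> back to \<open>(y, x)\<close>.\<close>

lemma morse_chart_uminus:
  fixes E :: "'b::euclidean_space set"
  assumes "morse_chart f S p E F"
  shows "morse_chart (\<lambda>x. - f x) S p F E"
proof -
  obtain \<phi> \<psi> r a b where r: "0 < r" "0 < a" "0 < b" "\<phi> (0, 0) = p"
    and op: "openin (top_of_set S) (\<phi> ` coord_box E F r)"
    and hom: "homeomorphism (coord_box E F r) (\<phi> ` coord_box E F r) \<phi> \<psi>"
    and bd: "\<And>x y. (x, y) \<in> coord_box E F r \<Longrightarrow>
         f p - b * (norm x)\<^sup>2 + a * (norm y)\<^sup>2 \<le> f (\<phi> (x, y)) \<and>
         f (\<phi> (x, y)) \<le> f p - a * (norm x)\<^sup>2 + b * (norm y)\<^sup>2"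
    and mono: "\<And>x y \<mu>. (x, y) \<in> coord_box E F r \<and> \<mu> \<ge> 1 \<and> norm (\<mu> *\<^sub>R x) < r \<Longrightarrow>
         f (\<phi> (\<mu> *\<^sub>R x, (1 / \<mu>) *\<^sub>R y)) \<le> f (\<phi> (x, y))"
    and sub: "subspace E" "subspace F"
    using assms unfolding morse_chart_def by blast
  have sw: "prod.swap ` coord_box F E r = coord_box E F r"
    by (auto simp: coord_box_def image_iff)
  have hs: "homeomorphism (coord_box F E r) (coord_box E F r) prod.swap prod.swap"
    by (rule homeomorphismI) (auto simp: coord_box_def intro!: continuous_intros continuous_on_swap)
  have im: "(\<phi> \<circ> prod.swap) ` coord_box F E r = \<phi> ` coord_box E F r"
    unfolding sw[symmetric] by (simp add: image_comp)
  show ?thesis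
    unfolding morse_chart_def
  proof (intro conjI exI allI impI)
    show "openin (top_of_set S) ((\<phi> \<circ> prod.swap) ` coord_box F E r)" unfolding im by (rule op)
    show "homeomorphism (coord_box F E r) ((\<phi> \<circ> prod.swap) ` coord_box F E r) (\<phi> \<circ> prod.swap) (prod.swap \<circ> \<psi>)"
      unfolding im by (rule homeomorphism_compose[OF hs hom])
    fix x y assume "(x, y) \<in> coord_box F E r"
    then have "(y, x) \<in> coord_box E F r" by (auto simp: coord_box_def)
    from bd[OF this] show "- f p - b * (norm x)\<^sup>2 + a * (norm y)\<^sup>2 \<le> - f ((\<phi> \<circ> prod.swap) (x, y))"
      "- f ((\<phi> \<circ> prod.swap) (x, y)) \<le> - f p - a * (norm x)\<^sup>2 + b * (norm y)\<^sup>2"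
      by (auto simp: algebra_simps)
  next
    fix x y \<mu> assume *: "(x, y) \<in> coord_box F E r \<and> 1 \<le> \<mu> \<and> norm (\<mu> *\<^sub>R x) < r"
    have "norm y / \<mu> \<le> norm y / 1" using * by (intro divide_left_mono) auto
    then have "((1 / \<mu>) *\<^sub>R y, \<mu> *\<^sub>R x) \<in> coord_box E F r \<and> 1 \<le> \<mu> \<and> norm (\<mu> *\<^sub>R (1 / \<mu>) *\<^sub>R y) < r"
      using * sub by (auto simp: coord_box_def subspace_scale)
    from mono[OF this] show "- f ((\<phi> \<circ> prod.swap) (\<mu> *\<^sub>R x, (1 / \<mu>) *\<^sub>R y)) \<le> - f ((\<phi> \<circ> prod.swap) (x, y))"
      using * by simp
  qed (use r sub in auto)
qed

lemma coord_box_mono: "r \<le> s \<Longrightarrow> coord_box E F r \<subseteq> coord_box E F s"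
  by (auto simp: coord_box_def)

text \<open>The data hidden in \<open>morse_chart\<close>, on a box shrunk so that its image lies in
  a prescribed open set \<open>O'\<close>. Openness is recorded for every smaller radius, so that
  the box can be shrunk again.\<close>

definition morse_coords :: "('a::euclidean_space \<Rightarrow> real) \<Rightarrow> 'a set \<Rightarrow> 'a \<Rightarrow> 'b::euclidean_space set \<Rightarrow> 'b set \<Rightarrow>
    'a set \<Rightarrow> real \<Rightarrow> real \<Rightarrow> real \<Rightarrow> ('b \<times> 'b \<Rightarrow> 'a) \<Rightarrow> ('a \<Rightarrow> 'b \<times> 'b) \<Rightarrow> bool" where
  "morse_coords f S p E F O' r a b \<phi> \<psi> \<longleftrightarrow>
    0 < r \<and> 0 < a \<and> 0 < b \<and> \<phi> (0, 0) = p \<and> subspace E \<and> subspace F \<and>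
    (\<forall>s\<le>r. openin (top_of_set S) (\<phi> ` coord_box E F s)) \<and>
    continuous_on (coord_box E F r) \<phi> \<and> continuous_on (\<phi> ` coord_box E F r) \<psi> \<and>
    (\<forall>z\<in>coord_box E F r. \<psi> (\<phi> z) = z \<and> \<phi> z \<in> S \<inter> O') \<and>
    (\<forall>x y. (x, y) \<in> coord_box E F r \<longrightarrow>
       f p - b * (norm x)\<^sup>2 + a * (norm y)\<^sup>2 \<le> f (\<phi> (x, y)) \<and>
       f (\<phi> (x, y)) \<le> f p - a * (norm x)\<^sup>2 + b * (norm y)\<^sup>2) \<and>
    (\<forall>x y \<mu>. (x, y) \<in> coord_box E F r \<longrightarrow> \<mu> \<ge> 1 \<longrightarrow> norm (\<mu> *\<^sub>R x) < r \<longrightarrow>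
       f (\<phi> (\<mu> *\<^sub>R x, (1 / \<mu>) *\<^sub>R y)) \<le> f (\<phi> (x, y)))"

lemma morse_chart_coords:
  fixes E :: "'b::euclidean_space set"
  assumes "morse_chart f S p E F" "open O'" "p \<in> O'"
  shows "\<exists>r a b \<phi> \<psi>. morse_coords f S p E F O' r a b \<phi> \<psi>"
proof -
  obtain \<phi> \<psi> r a b where r: "0 < r" "0 < a" "0 < b" "\<phi> (0, 0) = p"
    and op: "openin (top_of_set S) (\<phi> ` coord_box E F r)"
    and hom: "homeomorphism (coord_box E F r) (\<phi> ` coord_box E F r) \<phi> \<psi>"
    and bd: "\<And>x y. (x, y) \<in> coord_box E F r \<Longrightarrow>
         f p - b * (norm x)\<^sup>2 + a * (norm y)\<^sup>2 \<le> f (\<phi> (x, y)) \<and>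
         f (\<phi> (x, y)) \<le> f p - a * (norm x)\<^sup>2 + b * (norm y)\<^sup>2"
    and mono: "\<And>x y \<mu>. (x, y) \<in> coord_box E F r \<and> \<mu> \<ge> 1 \<and> norm (\<mu> *\<^sub>R x) < r \<Longrightarrow>
         f (\<phi> (\<mu> *\<^sub>R x, (1 / \<mu>) *\<^sub>R y)) \<le> f (\<phi> (x, y))"
    and sub: "subspace E" "subspace F"
    using assms(1) unfolding morse_chart_def by blast
  let ?B = "coord_box E F"
  have 0: "(0, 0) \<in> ?B r" using r sub by (auto simp: coord_box_def subspace_0)
  have cont: "continuous_on (?B r) \<phi>" using hom by (auto simp: homeomorphism_def)
  obtain d where d: "d > 0" "\<And>z. z \<in> ?B r \<Longrightarrow> dist z (0, 0) < d \<Longrightarrow> \<phi> z \<in> O'"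
  proof -
    obtain e where e: "e > 0" "ball p e \<subseteq> O'" using assms(2,3) open_contains_ball by blast
    obtain d where "d > 0" "\<And>z. z \<in> ?B r \<Longrightarrow> dist z (0, 0) < d \<Longrightarrow> dist (\<phi> z) (\<phi> (0, 0)) < e"
      using cont 0 e(1) unfolding continuous_on_iff by meson
    then show ?thesis using that[of d] e(2) r(4) by (auto simp: subset_iff dist_commute)
  qed
  define s where "s = min r (d / 2)"
  have s: "0 < s" "s \<le> r" using r d by (auto simp: s_def)
  have sO: "\<phi> z \<in> O'" if "z \<in> ?B s" for z
  proof -
    obtain x y where z: "z = (x, y)" by (cases z)
    have "norm z \<le> norm x + norm y" unfolding z by (rule norm_Pair_le)
    also have "\<dots> < d" using that unfolding z by (auto simp: coord_box_def s_def)
    finally have "dist z (0, 0) < d" by (simp add: zero_prod_def[symmetric])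
    then show ?thesis using d(2)[of z] that coord_box_mono[OF s(2), of E F] by blast
  qed
  have "openin (top_of_set S) (\<phi> ` ?B t)" if "t \<le> s" for t
  proof -
    have t: "t \<le> r" using s that by simp
    have "?B t = ?B r \<inter> ball 0 t \<times> ball 0 t" using t by (auto simp: coord_box_def)
    then have "openin (top_of_set (?B r)) (?B t)"
      by (metis open_Times open_ball openin_open_Int)
    then have "openin (top_of_set (\<phi> ` ?B r)) (\<phi> ` ?B t)"
      using homeomorphism_imp_open_map[OF hom] by blast
    then show "openin (top_of_set S) (\<phi> ` ?B t)" using op openin_trans by blast
  qed
  moreover have "continuous_on (?B s) \<phi>" using cont continuous_on_subset coord_box_mono[OF s(2)] by blast
  moreover have "continuous_on (\<phi> ` ?B s) \<psi>" using hom coord_box_mono[OF s(2)]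
    by (metis continuous_on_subset homeomorphism_def image_mono)
  moreover have "\<psi> (\<phi> z) = z \<and> \<phi> z \<in> S \<inter> O'" if z: "z \<in> ?B s" for z
  proof -
    have z': "z \<in> ?B r" using z coord_box_mono[OF s(2)] by blast
    have "\<psi> (\<phi> z) = z" using z' hom by (auto simp: homeomorphism_def)
    then show ?thesis using sO[OF z] z' openin_imp_subset[OF op] by blast
  qed
  moreover have "f p - b * (norm x)\<^sup>2 + a * (norm y)\<^sup>2 \<le> f (\<phi> (x, y)) \<and>
       f (\<phi> (x, y)) \<le> f p - a * (norm x)\<^sup>2 + b * (norm y)\<^sup>2" if "(x, y) \<in> ?B s" for x y
  proof -
    have "(x, y) \<in> ?B r" using that coord_box_mono[OF s(2)] by blast
    from bd[OF this] show ?thesis .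
  qed
  moreover have "f (\<phi> (\<mu> *\<^sub>R x, (1 / \<mu>) *\<^sub>R y)) \<le> f (\<phi> (x, y))"
    if "(x, y) \<in> ?B s" "1 \<le> \<mu>" "norm (\<mu> *\<^sub>R x) < s" for x y \<mu>
    using that coord_box_mono[OF s(2)] s by (intro mono) auto
  ultimately have "morse_coords f S p E F O' s a b \<phi> \<psi>"
    unfolding morse_coords_def using s(1) r(2-4) sub by blast
  then show ?thesis by blast
qed

text \<open>The disk in the \<open>E\<close> direction meets the disk in the \<open>F\<close>
  direction only at \<open>p\<close>. The threshold \<open>a * R\<^sup>2\<close> serves twice: the
  boundary of the first disk lies below level \<open>f p - \<epsilon>\<close>, and the points on the
  \<open>F\<close> axis beyond radius \<open>R\<close> lie above \<open>f p + \<epsilon>\<close>.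
  The conditions on \<open>X\<close> fit both a sublevel set and, when \<open>F = {0}\<close>, a
  sphere without one point; in that case \<open>O'\<close> keeps the chart away from this
  point.\<close>

lemma nontrivial_homology_at_critical_point:
  fixes E :: "'b::euclidean_space set"
  assumes chart: "morse_chart f S p E F" and dim: "dim E \<ge> 1" and O: "open O'" "p \<in> O'"
  obtains \<epsilon>\<^sub>0 where "\<epsilon>\<^sub>0 > 0"
    "\<And>\<epsilon> X. 0 < \<epsilon> \<Longrightarrow> \<epsilon> < \<epsilon>\<^sub>0 \<Longrightarrow> sublevel f S (f p - \<epsilon>) \<subseteq> X \<Longrightarrow> X \<subseteq> S \<Longrightarrow> {x \<in> S \<inter> O'. f x \<le> f p} \<subseteq> X \<Longrightarrow>
      X \<subseteq> sublevel f S (f p + \<epsilon>) \<or> F = {0} \<Longrightarrow>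
      \<not> no_homology (int (dim E)) X (sublevel f S (f p - \<epsilon>))"
proof -
  let ?B = "coord_box E F"
  obtain r a b \<phi> \<psi> where C: "morse_coords f S p E F O' r a b \<phi> \<psi>"
    using morse_chart_coords[OF chart O] by blast
  have r: "0 < r" "0 < a" "0 < b" "\<phi> (0, 0) = p" and sub: "subspace E" "subspace F"
    and op: "\<And>s. s \<le> r \<Longrightarrow> openin (top_of_set S) (\<phi> ` ?B s)"
    and cont: "continuous_on (?B r) \<phi>" "continuous_on (\<phi> ` ?B r) \<psi>"
    and inv: "\<And>z. z \<in> ?B r \<Longrightarrow> \<psi> (\<phi> z) = z"
    and im: "\<And>z. z \<in> ?B r \<Longrightarrow> \<phi> z \<in> S \<inter> O'"
    and lower: "\<And>x y. (x, y) \<in> ?B r \<Longrightarrow> f p - b * (norm x)\<^sup>2 + a * (norm y)\<^sup>2 \<le> f (\<phi> (x, y))"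
    and upper: "\<And>x y. (x, y) \<in> ?B r \<Longrightarrow> f (\<phi> (x, y)) \<le> f p - a * (norm x)\<^sup>2 + b * (norm y)\<^sup>2"
    and mono: "\<And>x y \<mu>. (x, y) \<in> ?B r \<Longrightarrow> \<mu> \<ge> 1 \<Longrightarrow> norm (\<mu> *\<^sub>R x) < r \<Longrightarrow>
         f (\<phi> (\<mu> *\<^sub>R x, (1 / \<mu>) *\<^sub>R y)) \<le> f (\<phi> (x, y))"
    using C unfolding morse_coords_def by simp_all
  define R where "R = r / 2"
  have R: "0 < R" "R < r" using r by (auto simp: R_def)
  have E0: "(x, 0) \<in> ?B r" if "x \<in> E \<inter> cball 0 R" for x
    using that R sub by (auto simp: coord_box_def subspace_0)
  have F0: "(0, y) \<in> ?B r" if "y \<in> F \<inter> cball 0 R" for y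
    using that R sub by (auto simp: coord_box_def subspace_0)
  show thesis
  proof (rule that[of "a * R\<^sup>2"])
    fix \<epsilon> X assume e: "0 < \<epsilon>" "\<epsilon> < a * R\<^sup>2" and AX: "sublevel f S (f p - \<epsilon>) \<subseteq> X" and XS: "X \<subseteq> S"
      and OX: "{x \<in> S \<inter> O'. f x \<le> f p} \<subseteq> X" and X: "X \<subseteq> sublevel f S (f p + \<epsilon>) \<or> F = {0}"
    \<comment> \<open>Closed in \<open>X\<close> by compactness, and disjoint from the lower
      sublevel set because \<open>f\<close> is at least \<open>f p\<close> on it.\<close>
    define W where "W = X \<inter> \<phi> ` ({0} \<times> (F \<inter> cball 0 R))"
    have "f p \<le> f x" if x: "x \<in> W" for x
    proof -
      obtain y where y: "x = \<phi> (0, y)" "y \<in> F \<inter> cball 0 R" using x by (auto simp: W_def)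
      have "0 \<le> a * (norm y)\<^sup>2" using r by simp
      then show ?thesis using lower[OF F0[OF y(2)]] y(1) by simp
    qed
    then have AW: "sublevel f S (f p - \<epsilon>) \<subseteq> X - W" using AX e by force
    show "\<not> no_homology (int (dim E)) X (sublevel f S (f p - \<epsilon>))"
    proof (rule nontrivial_rel_homology_crossing[OF sub(1) R(1) dim, where N="X \<inter> \<phi> ` ?B r" and i="\<lambda>x. \<phi> (x, 0)" and q="fst \<circ> \<psi>" and W=W])
      show "continuous_on (E \<inter> cball 0 R) (\<lambda>x. \<phi> (x, 0))"
        by (rule continuous_on_compose2[OF cont(1)]) (use E0 in \<open>auto intro!: continuous_intros\<close>)
      have le: "f (\<phi> (x, 0)) \<le> f p - a * (norm x)\<^sup>2" if "x \<in> E \<inter> cball 0 R" for x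
        using upper[OF E0[OF that]] by simp
      have iX: "\<phi> (x, 0) \<in> X" if "x \<in> E \<inter> cball 0 R" for x
      proof -
        have "0 \<le> a * (norm x)\<^sup>2" using r by simp
        then have "f (\<phi> (x, 0)) \<le> f p" using le[OF that] by simp
        then show ?thesis using im[OF E0[OF that]] OX by auto
      qed
      then show "(\<lambda>x. \<phi> (x, 0)) \<in> E \<inter> cball 0 R \<rightarrow> X \<inter> \<phi> ` ?B r" using E0 by auto
      show "(\<lambda>x. \<phi> (x, 0)) \<in> E \<inter> sphere 0 R \<rightarrow> sublevel f S (f p - \<epsilon>)"
      proof
        fix x assume x: "x \<in> E \<inter> sphere 0 R"
        then have "f (\<phi> (x, 0)) \<le> f p - \<epsilon>" using le[of x] e by auto
        then show "\<phi> (x, 0) \<in> sublevel f S (f p - \<epsilon>)" using im[OF E0[of x]] x by auto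
      qed
      have inB: "\<psi> x \<in> ?B r" if "x \<in> X \<inter> \<phi> ` ?B r" for x
        using that inv by auto
      show "continuous_on (X \<inter> \<phi> ` ?B r) (fst \<circ> \<psi>)"
        by (rule continuous_on_subset[of "\<phi> ` ?B r"]) (auto intro!: continuous_on_compose cont(2) continuous_intros)
      show "fst \<circ> \<psi> \<in> X \<inter> \<phi> ` ?B r \<rightarrow> E"
        using inB by (fastforce simp: coord_box_def)
      show "(fst \<circ> \<psi>) (\<phi> (x, 0)) = x" if "x \<in> E \<inter> cball 0 R" for x
        using inv[OF E0[OF that]] by simp
      show "openin (top_of_set X) (X \<inter> \<phi> ` ?B r)"
        using openin_subtopology_Int[OF op[of r], of X] XS by (simp add: subtopology_top_of_set Int_commute)
      have "compact (\<phi> ` ({0} \<times> (F \<inter> cball 0 R)))"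
      proof (rule compact_continuous_image)
        show "continuous_on ({0} \<times> (F \<inter> cball 0 R)) \<phi>"
          by (rule continuous_on_subset[OF cont(1)]) (use F0 in auto)
        show "compact ({0} \<times> (F \<inter> cball 0 R))"
          by (intro compact_Times closed_Int_compact closed_subspace sub) auto
      qed
      then show "closedin (top_of_set X) W"
        unfolding W_def using compact_imp_closed closedin_closed_Int by blast
      show "W \<subseteq> X \<inter> \<phi> ` ?B r" unfolding W_def using F0 by auto
      show "(fst \<circ> \<psi>) x \<noteq> 0" if x: "x \<in> (X \<inter> \<phi> ` ?B r) - W" for x
      proof
        assume "(fst \<circ> \<psi>) x = 0"
        then obtain y where y: "x = \<phi> (0, y)" "(0, y) \<in> ?B r" using x inv by fastforce
        then have yF: "y \<in> F" by (auto simp: coord_box_def)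
        have "norm y > R" using y x yF unfolding W_def by (auto simp: not_le)
        then have "F \<noteq> {0}" "R\<^sup>2 < (norm y)\<^sup>2"
          using yF R by (auto intro: power_strict_mono)
        then have "a * R\<^sup>2 < a * (norm y)\<^sup>2" using r by simp
        then have "f p + a * R\<^sup>2 < f x" using lower[OF y(2)] y(1) by simp
        then show False using X x e \<open>F \<noteq> {0}\<close> by auto
      qed
    qed (use AW in auto)
  qed (use r R in auto)
qed


text \<open>A point near \<open>p\<close> is moved along its hyperbola until its \<open>E\<close>
  component has norm \<open>R\<close> or has been stretched by \<open>1 + T\<close>; then its
  \<open>F\<close> component is contracted to 0. The resulting map factors through the disk of
  radius \<open>R\<close> in \<open>E\<close> modulo its boundary, which has no homology in degree
  \<open>j\<close>. The motion may leave \<open>N\<close> but stays in the chart, which suffices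
  because the target is the global pair. \<open>N\<close> is chosen before
  \<open>\<epsilon>\<close>, so it serves for all small \<open>\<epsilon>\<close>.\<close>

lemma zero_map_near_critical_point:
  fixes E :: "'b::euclidean_space set"
  assumes chart: "morse_chart f S p E F" and j: "j \<ge> 1" "j \<noteq> int (dim E)" and O: "open O'" "p \<in> O'"
  obtains N \<epsilon>\<^sub>0 where "openin (top_of_set S) N" "p \<in> N" "N \<subseteq> O'" "\<epsilon>\<^sub>0 > 0"
    "\<And>\<epsilon> z. 0 < \<epsilon> \<Longrightarrow> \<epsilon> < \<epsilon>\<^sub>0 \<Longrightarrow>
      rel_map j (sublevel f S (f p + \<epsilon>) \<inter> N) (sublevel f S (f p - \<epsilon>) \<inter> N)
        (sublevel f S (f p + \<epsilon>)) (sublevel f S (f p - \<epsilon>)) id z =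
      rel_one j (sublevel f S (f p + \<epsilon>)) (sublevel f S (f p - \<epsilon>))"
proof -
  let ?B = "coord_box E F"
  obtain r a b \<phi> \<psi> where C: "morse_coords f S p E F O' r a b \<phi> \<psi>"
    using morse_chart_coords[OF chart O] by blast
  have r: "0 < r" "0 < a" "0 < b" "\<phi> (0, 0) = p" and sub: "subspace E" "subspace F"
    and op: "\<And>s. s \<le> r \<Longrightarrow> openin (top_of_set S) (\<phi> ` ?B s)"
    and cont: "continuous_on (?B r) \<phi>" "continuous_on (\<phi> ` ?B r) \<psi>"
    and inv: "\<And>z. z \<in> ?B r \<Longrightarrow> \<psi> (\<phi> z) = z"
    and im: "\<And>z. z \<in> ?B r \<Longrightarrow> \<phi> z \<in> S \<inter> O'"
    and lower: "\<And>x y. (x, y) \<in> ?B r \<Longrightarrow> f p - b * (norm x)\<^sup>2 + a * (norm y)\<^sup>2 \<le> f (\<phi> (x, y))"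
    and upper: "\<And>x y. (x, y) \<in> ?B r \<Longrightarrow> f (\<phi> (x, y)) \<le> f p - a * (norm x)\<^sup>2 + b * (norm y)\<^sup>2"
    and mono: "\<And>x y \<mu>. (x, y) \<in> ?B r \<Longrightarrow> \<mu> \<ge> 1 \<Longrightarrow> norm (\<mu> *\<^sub>R x) < r \<Longrightarrow>
         f (\<phi> (\<mu> *\<^sub>R x, (1 / \<mu>) *\<^sub>R y)) \<le> f (\<phi> (x, y))"
    using C unfolding morse_coords_def by simp_all
  define R where "R = r / 2"
  \<comment> \<open>\<open>s\<close> is small against \<open>R\<close>: once the \<open>E\<close>
    component has norm \<open>R\<close>, an \<open>F\<close> component of norm at most
    \<open>s\<close> cannot lift \<open>f\<close> above
    \<open>f p - a * R\<^sup>2 / 2\<close>.\<close>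
  define s where "s = min R (R * sqrt (a / (2 * b)))"
  have R: "0 < R" "R < r" using r by (auto simp: R_def)
  have s: "0 < s" "s \<le> R" "s \<le> r" using R r by (auto simp: s_def)
  have bs: "b * s\<^sup>2 \<le> a * R\<^sup>2 / 2"
  proof -
    have "s\<^sup>2 \<le> (R * sqrt (a / (2 * b)))\<^sup>2" using s(1) by (intro power_mono) (auto simp: s_def)
    also have "\<dots> = R\<^sup>2 * (a / (2 * b))" using r by (simp add: power_mult_distrib)
    finally have "b * s\<^sup>2 \<le> b * (R\<^sup>2 * (a / (2 * b)))" using r by (intro mult_left_mono) auto
    then show ?thesis using r by (simp add: field_simps)
  qed
  let ?N = "\<phi> ` ?B s"
  have Bsr: "?B s \<subseteq> ?B r" using coord_box_mono[OF s(3)] .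
  show thesis
  proof (rule that[of ?N "a * R\<^sup>2 / 2"])
    have "(0, 0) \<in> ?B s" using s sub by (auto simp: coord_box_def subspace_0)
    then show "p \<in> ?N" using r(4) by force
    fix \<epsilon> z assume e: "0 < \<epsilon>" "\<epsilon> < a * R\<^sup>2 / 2"
    let ?X = "sublevel f S (f p + \<epsilon>)" and ?A = "sublevel f S (f p - \<epsilon>)"
    \<comment> \<open>The scale belonging to \<open>\<epsilon>\<close>: an \<open>F\<close>
      component of norm at most \<open>\<sigma>\<close> keeps \<open>f\<close> at or below
      \<open>f p + \<epsilon>\<close>, and a value of at most \<open>f p - \<epsilon>\<close> forces
      an \<open>E\<close> component of norm at least \<open>\<sigma>\<close>.\<close>
    define \<sigma> where "\<sigma> = sqrt (\<epsilon> / b)"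
    have \<sigma>: "0 < \<sigma>" "b * \<sigma>\<^sup>2 = \<epsilon>" using e r by (auto simp: \<sigma>_def)
    \<comment> \<open>Stretching by \<open>1 + T\<close> takes norms of at least
      \<open>\<sigma>\<close> past \<open>R\<close>; dividing by it takes norms up to
      \<open>s \<le> R\<close> down to at most \<open>\<sigma>\<close>.\<close>
    define T where "T = R / \<sigma>"
    have T: "0 < T" "(1 + T) * \<sigma> \<ge> R" using \<sigma> R by (auto simp: T_def field_simps)
    have sT: "s / (1 + T) \<le> \<sigma>"
    proof -
      have "s \<le> (1 + T) * \<sigma>" using s T by simp
      then show ?thesis using T by (simp add: field_simps)
    qed
    \<comment> \<open>This is the minimum of \<open>1 + t * T\<close> and \<open>R / norm x\<close>,
      written without division by \<open>norm x\<close> so that continuity at 0 is visible.\<close>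
    define \<mu> where "\<mu> = (\<lambda>t (x::'b). (1 + t * T) / max 1 ((1 + t * T) * norm x / R))"
    have \<mu>0: "\<mu> 0 x = 1" if "norm x \<le> R" for x using that R by (simp add: \<mu>_def max_def)
    have tT: "1 \<le> 1 + t * T" if "t \<in> {0..1}" for t using that T by simp
    have \<mu>1: "1 \<le> \<mu> t x" if "t \<in> {0..1}" "norm x \<le> R" for t x
    proof -
      have "(1 + t * T) * norm x / R \<le> 1 + t * T"
        using tT[OF that(1)] that(2) R by (simp add: divide_le_eq mult_left_mono)
      then have "max 1 ((1 + t * T) * norm x / R) \<le> 1 + t * T" using tT[OF that(1)] by simp
      then show ?thesis unfolding \<mu>_def by (subst le_divide_eq_1) auto
    qed
    have \<mu>R: "norm (\<mu> t x *\<^sub>R x) \<le> R" if "t \<in> {0..1}" for t x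
    proof -
      have "(1 + t * T) * norm x \<le> R * max 1 ((1 + t * T) * norm x / R)"
        using R by (simp add: max_def field_simps)
      then have "(1 + t * T) * norm x / max 1 ((1 + t * T) * norm x / R) \<le> R"
        by (subst divide_le_eq) (auto simp: max_def)
      then show ?thesis using tT[OF that] by (simp add: \<mu>_def)
    qed
    have \<mu>stop: "norm (\<mu> 1 x *\<^sub>R x) = R \<or> \<mu> 1 x = 1 + T" for x
    proof (cases "(1 + T) * norm x / R \<ge> 1")
      case True
      then have "\<mu> 1 x = (1 + T) / ((1 + T) * norm x / R)" "x \<noteq> 0" by (auto simp: \<mu>_def)
      then show ?thesis using T R by simp
    next
      case False
      then show ?thesis by (simp add: \<mu>_def)
    qed
    have \<mu>stopR: "norm (\<mu> 1 x *\<^sub>R x) = R" if "norm x \<ge> \<sigma>" for x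
    proof -
      have "R \<le> (1 + T) * norm x"
        by (rule order_trans[OF T(2)]) (use that T in auto)
      then have "(1 + T) * norm x / R \<ge> 1" using R by simp
      then have "\<mu> 1 x = (1 + T) / ((1 + T) * norm x / R)" "x \<noteq> 0" by (auto simp: \<mu>_def)
      then show ?thesis using T R by simp
    qed
    have cont\<mu>: "continuous_on ({0..1} \<times> UNIV) (\<lambda>(t, x). \<mu> t x)"
      unfolding \<mu>_def case_prod_unfold using R by (intro continuous_intros) auto
    define u where "u = fst \<circ> \<psi>"
    define v where "v = snd \<circ> \<psi>"
    have uv: "q = \<phi> (u q, v q)" "u q \<in> E" "v q \<in> F" "norm (u q) < s" "norm (v q) < s" "q \<in> S" "(u q, v q) \<in> ?B r"
      if q: "q \<in> ?N" for q
    proof -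
      obtain x y where xy: "q = \<phi> (x, y)" "(x, y) \<in> ?B s" using q by auto
      then have "\<psi> q = (x, y)" "(x, y) \<in> ?B r" using inv Bsr by auto
      then show "q = \<phi> (u q, v q)" "u q \<in> E" "v q \<in> F" "norm (u q) < s" "norm (v q) < s" "q \<in> S" "(u q, v q) \<in> ?B r"
        using xy im[of "(x, y)"] by (auto simp: u_def v_def coord_box_def)
    qed
    have contuv: "continuous_on (?X \<inter> ?N) u" "continuous_on (?X \<inter> ?N) v"
      unfolding u_def v_def
      by (rule continuous_on_subset[of "\<phi> ` ?B r"]; use Bsr in \<open>auto intro!: continuous_on_compose cont(2) continuous_intros\<close>)+
    have box: "(\<mu> t (u q) *\<^sub>R u q, c *\<^sub>R v q) \<in> ?B r" if "q \<in> ?N" "t \<in> {0..1}" "0 \<le> c" "c \<le> 1" for q t c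
    proof -
      have "norm (c *\<^sub>R v q) \<le> 1 * norm (v q)" using that unfolding norm_scaleR by (intro mult_right_mono) auto
      then show ?thesis using uv[OF that(1)] \<mu>R[OF that(2), of "u q"] R s sub
        by (auto simp: coord_box_def subspace_scale)
    qed
    have \<mu>inv: "0 \<le> 1 / \<mu> t (u q)" "1 / \<mu> t (u q) \<le> 1" if "q \<in> ?N" "t \<in> {0..1}" for q t
      using \<mu>1[OF that(2), of "u q"] uv(4)[OF that(1)] s by auto
    define h where "h = (\<lambda>t q. \<phi> (\<mu> t (u q) *\<^sub>R u q, (1 / \<mu> t (u q)) *\<^sub>R v q))"
    \<comment> \<open>Contracting the \<open>F\<close> component need not decrease \<open>f\<close>.
      That the motion respects both sublevel sets is read off from the quadratic upper bound, in
      \<open>gstop\<close> and \<open>gX\<close>.\<close>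
    define g where "g = (\<lambda>t q. \<phi> (\<mu> 1 (u q) *\<^sub>R u q, (1 - t) *\<^sub>R (1 / \<mu> 1 (u q)) *\<^sub>R v q))"
    have hle: "f (h t q) \<le> f q" if "q \<in> ?N" "t \<in> {0..1}" for q t
    proof -
      have "f (h t q) \<le> f (\<phi> (u q, v q))" unfolding h_def
        using uv[OF that(1)] \<mu>1[OF that(2), of "u q"] \<mu>R[OF that(2), of "u q"] s R by (intro mono) auto
      then show ?thesis using uv(1)[OF that(1)] by simp
    qed
    have hS: "h t q \<in> S" if "q \<in> ?N" "t \<in> {0..1}" for q t
      unfolding h_def using im[OF box[OF that \<mu>inv[OF that]]] by simp
    have c01: "1 \<in> {0..1::real}" by simp
    have gbox: "(\<mu> 1 (u q) *\<^sub>R u q, (1 - t) *\<^sub>R (1 / \<mu> 1 (u q)) *\<^sub>R v q) \<in> ?B r" if "q \<in> ?N" "t \<in> {0..1}" for q t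
    proof -
      have "(1 - t) * (1 / \<mu> 1 (u q)) \<le> 1 * 1" using \<mu>inv[OF that(1) c01] that(2) by (intro mult_mono) auto
      then show ?thesis using box[OF that(1) c01, of "(1 - t) * (1 / \<mu> 1 (u q))"] \<mu>inv[OF that(1) c01] that(2) by simp
    qed
    have gS: "g t q \<in> S" if "q \<in> ?N" "t \<in> {0..1}" for q t
      unfolding g_def using im[OF gbox[OF that]] by simp
    have gle: "f (g t q) \<le> f p - a * (norm (\<mu> 1 (u q) *\<^sub>R u q))\<^sup>2 + b * (norm ((1 / \<mu> 1 (u q)) *\<^sub>R v q))\<^sup>2"
      if "q \<in> ?N" "t \<in> {0..1}" for q t
    proof -
      have "norm ((1 - t) *\<^sub>R (1 / \<mu> 1 (u q)) *\<^sub>R v q) = (1 - t) * norm ((1 / \<mu> 1 (u q)) *\<^sub>R v q)"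
        using that(2) by simp
      also have "\<dots> \<le> 1 * norm ((1 / \<mu> 1 (u q)) *\<^sub>R v q)" using that(2) by (intro mult_right_mono) auto
      finally have "(norm ((1 - t) *\<^sub>R (1 / \<mu> 1 (u q)) *\<^sub>R v q))\<^sup>2 \<le> (norm ((1 / \<mu> 1 (u q)) *\<^sub>R v q))\<^sup>2"
        by (intro power_mono) auto
      then have "b * (norm ((1 - t) *\<^sub>R (1 / \<mu> 1 (u q)) *\<^sub>R v q))\<^sup>2 \<le> b * (norm ((1 / \<mu> 1 (u q)) *\<^sub>R v q))\<^sup>2"
        using r by simp
      then show ?thesis using upper[OF gbox[OF that]] unfolding g_def by linarith
    qed
    have gstop: "f (g t q) \<le> f p - \<epsilon>" if "q \<in> ?N" "t \<in> {0..1}" "norm (\<mu> 1 (u q) *\<^sub>R u q) = R" for q t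
    proof -
      have "norm ((1 / \<mu> 1 (u q)) *\<^sub>R v q) = (1 / \<mu> 1 (u q)) * norm (v q)" using \<mu>inv[OF that(1) c01] by simp
      also have "\<dots> \<le> 1 * s" using \<mu>inv[OF that(1) c01] uv(5)[OF that(1)] by (intro mult_mono) auto
      finally have "(norm ((1 / \<mu> 1 (u q)) *\<^sub>R v q))\<^sup>2 \<le> s\<^sup>2" by (intro power_mono) auto
      then have "b * (norm ((1 / \<mu> 1 (u q)) *\<^sub>R v q))\<^sup>2 \<le> b * s\<^sup>2" using r by simp
      then show ?thesis using gle[OF that(1,2)] that(3) bs e by simp
    qed
    \<comment> \<open>Either the stretching stopped at norm \<open>R\<close> and the point is
      already below \<open>f p - \<epsilon>\<close>, or it was carried out in full and the
      \<open>F\<close> component has norm at most \<open>\<sigma>\<close>.\<close>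
    have gX: "f (g t q) \<le> f p + \<epsilon>" if "q \<in> ?N" "t \<in> {0..1}" for q t
    proof (cases "norm (\<mu> 1 (u q) *\<^sub>R u q) = R")
      case True
      then show ?thesis using gstop[OF that] e by simp
    next
      case False
      then have "norm ((1 / \<mu> 1 (u q)) *\<^sub>R v q) = norm (v q) / (1 + T)"
        using \<mu>stop[of "u q"] T by auto
      also have "\<dots> \<le> s / (1 + T)" using uv(5)[OF that(1)] T by (intro divide_right_mono) auto
      also have "\<dots> \<le> \<sigma>" by (rule sT)
      finally have "(norm ((1 / \<mu> 1 (u q)) *\<^sub>R v q))\<^sup>2 \<le> \<sigma>\<^sup>2" by (intro power_mono) auto
      then have "b * (norm ((1 / \<mu> 1 (u q)) *\<^sub>R v q))\<^sup>2 \<le> b * \<sigma>\<^sup>2" using r by simp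
      moreover have "0 \<le> a * (norm (\<mu> 1 (u q) *\<^sub>R u q))\<^sup>2" using r by simp
      ultimately show ?thesis using gle[OF that] \<sigma>(2) by linarith
    qed
    have Astop: "norm (\<mu> 1 (u q) *\<^sub>R u q) = R" if "q \<in> ?A \<inter> ?N" for q
    proof (rule \<mu>stopR, rule power2_le_imp_le)
      have "f p - b * (norm (u q))\<^sup>2 + a * (norm (v q))\<^sup>2 \<le> f p - \<epsilon>"
        using lower[OF uv(7)] uv(1) that by fastforce
      moreover have "0 \<le> a * (norm (v q))\<^sup>2" using r by simp
      ultimately have "b * \<sigma>\<^sup>2 \<le> b * (norm (u q))\<^sup>2" using \<sigma>(2) by linarith
      then show "\<sigma>\<^sup>2 \<le> (norm (u q))\<^sup>2" using r by simp
    qed auto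
    have \<mu>pos: "\<mu> t (u q) \<noteq> 0" if "q \<in> ?N" "t \<in> {0..1}" for q t
      using \<mu>1[OF that(2), of "u q"] uv(4)[OF that(1)] s by auto
    have c\<mu>u: "continuous_on ({0..1} \<times> (?X \<inter> ?N)) (\<lambda>z. \<mu> (fst z) (u (snd z)))"
    proof -
      have "continuous_on ({0..1} \<times> (?X \<inter> ?N)) (\<lambda>z. (\<lambda>(t, x). \<mu> t x) (fst z, u (snd z)))"
        by (rule continuous_on_compose2[OF cont\<mu>])
          (auto intro!: continuous_intros continuous_on_compose2[OF contuv(1)])
      then show ?thesis by simp
    qed
    have c\<mu>u1: "continuous_on (?X \<inter> ?N) (\<lambda>q. \<mu> 1 (u q))"
    proof -
      have "continuous_on (?X \<inter> ?N) (\<lambda>q. (\<lambda>z. \<mu> (fst z) (u (snd z))) (1, q))"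
        by (rule continuous_on_compose2[OF c\<mu>u]) (auto intro!: continuous_intros)
      then show ?thesis by simp
    qed
    have "rel_map j (?X \<inter> ?N) (?A \<inter> ?N) ?X ?A id = rel_map j (?X \<inter> ?N) (?A \<inter> ?N) ?X ?A (h 1)"
    proof (rule rel_map_homotopic)
      show "continuous_on ({0..1} \<times> (?X \<inter> ?N)) (\<lambda>(t, x). h t x)"
        unfolding h_def case_prod_unfold
      proof (rule continuous_on_compose2[OF cont(1)])
        show "continuous_on ({0..1} \<times> (?X \<inter> ?N)) (\<lambda>p. (\<mu> (fst p) (u (snd p)) *\<^sub>R u (snd p), (1 / \<mu> (fst p) (u (snd p))) *\<^sub>R v (snd p)))"
          by (intro continuous_intros c\<mu>u continuous_on_compose2[OF contuv(1)] continuous_on_compose2[OF contuv(2)])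
            (use \<mu>pos in auto)
      qed (use box \<mu>inv in fastforce)
      show "h 0 x = id x" if "x \<in> ?X \<inter> ?N" for x
        using \<mu>0[of "u x"] uv[of x] that s unfolding h_def by auto
      show "h t x \<in> ?X" if "t \<in> {0..1}" "x \<in> ?X \<inter> ?N" for t x
        using hS[of x t] hle[of x t] that by auto
      show "h t x \<in> ?A" if "t \<in> {0..1}" "x \<in> ?A \<inter> ?N" for t x
        using hS[of x t] hle[of x t] that by auto
    qed (use e in auto)
    also have "\<dots> = rel_map j (?X \<inter> ?N) (?A \<inter> ?N) ?X ?A (g 1)"
    proof (rule rel_map_homotopic)
      show "continuous_on ({0..1} \<times> (?X \<inter> ?N)) (\<lambda>(t, x). g t x)"
        unfolding g_def case_prod_unfold
      proof (rule continuous_on_compose2[OF cont(1)])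
        show "continuous_on ({0..1} \<times> (?X \<inter> ?N)) (\<lambda>p. (\<mu> 1 (u (snd p)) *\<^sub>R u (snd p), (1 - fst p) *\<^sub>R (1 / \<mu> 1 (u (snd p))) *\<^sub>R v (snd p)))"
          by (intro continuous_intros continuous_on_compose2[OF c\<mu>u1] continuous_on_compose2[OF contuv(1)] continuous_on_compose2[OF contuv(2)])
            (use \<mu>pos in auto)
      qed (use gbox in fastforce)
      show "g 0 x = h 1 x" if "x \<in> ?X \<inter> ?N" for x
        unfolding h_def g_def by simp
      show "g t x \<in> ?X" if "t \<in> {0..1}" "x \<in> ?X \<inter> ?N" for t x
        using gS[of x t] gX[of x t] that by auto
      show "g t x \<in> ?A" if "t \<in> {0..1}" "x \<in> ?A \<inter> ?N" for t x
        using gS[of x t] gstop[of x t, OF _ _ Astop] that by auto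
    qed (use e in auto)
    also have "g 1 = (\<lambda>x. \<phi> (x, 0)) \<circ> (\<lambda>q. \<mu> 1 (u q) *\<^sub>R u q)" by (auto simp: g_def)
    finally have eq: "rel_map j (?X \<inter> ?N) (?A \<inter> ?N) ?X ?A id z =
      rel_map j (?X \<inter> ?N) (?A \<inter> ?N) ?X ?A ((\<lambda>x. \<phi> (x, 0)) \<circ> (\<lambda>q. \<mu> 1 (u q) *\<^sub>R u q)) z" by (rule fun_cong)
    have E0: "(x, 0) \<in> ?B r" if "x \<in> E \<inter> cball 0 R" for x
      using that R sub by (auto simp: coord_box_def subspace_0)
    have up0: "f (\<phi> (x, 0)) \<le> f p - a * (norm x)\<^sup>2" "\<phi> (x, 0) \<in> S" if "x \<in> E \<inter> cball 0 R" for x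
      using upper[OF E0[OF that]] im[OF E0[OF that]] by auto
    show "rel_map j (?X \<inter> ?N) (?A \<inter> ?N) ?X ?A id z = rel_one j ?X ?A"
      unfolding eq
    proof (rule rel_map_trivial_factor[OF trivial_homology_disk_boundary[OF sub(1) R(1) j]])
      show "continuous_on (?X \<inter> ?N) (\<lambda>q. \<mu> 1 (u q) *\<^sub>R u q)"
        by (intro continuous_intros c\<mu>u1 contuv)
      show "(\<lambda>q. \<mu> 1 (u q) *\<^sub>R u q) \<in> ?X \<inter> ?N \<rightarrow> E \<inter> cball 0 R"
        using uv(2) \<mu>R[OF c01] sub by (auto simp: subspace_scale)
      show "(\<lambda>q. \<mu> 1 (u q) *\<^sub>R u q) \<in> ?A \<inter> ?N \<rightarrow> E \<inter> sphere 0 R"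
        using uv(2) Astop sub by (auto simp: subspace_scale)
      show "continuous_on (E \<inter> cball 0 R) (\<lambda>x. \<phi> (x, 0))"
        by (rule continuous_on_compose2[OF cont(1)]) (use E0 in \<open>auto intro!: continuous_intros\<close>)
      show "(\<lambda>x. \<phi> (x, 0)) \<in> E \<inter> cball 0 R \<rightarrow> ?X"
      proof
        fix x assume x: "x \<in> E \<inter> cball 0 R"
        have "0 \<le> a * (norm x)\<^sup>2" using r by simp
        then show "\<phi> (x, 0) \<in> ?X" using up0[OF x] e by simp
      qed
      show "(\<lambda>x. \<phi> (x, 0)) \<in> E \<inter> sphere 0 R \<rightarrow> ?A"
      proof
        fix x assume x: "x \<in> E \<inter> sphere 0 R"
        then show "\<phi> (x, 0) \<in> ?A" using up0[of x] e by simp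
      qed
    qed
  qed (use op[OF s(3)] im Bsr r R in auto)
qed

section \<open>Homology of sublevel sets\<close>

text \<open>The identity of \<open>(X, A)\<close> is homotopic to a map through
  \<open>(A, A)\<close>, a pair without homology.\<close>

lemma trivial_rel_homology_compress:
  assumes h: "continuous_on ({0..1::real} \<times> X) (\<lambda>(t, x). h t x)"
    "\<And>t x. t \<in> {0..1} \<Longrightarrow> x \<in> X \<Longrightarrow> h t x \<in> X"
    "\<And>t x. t \<in> {0..1} \<Longrightarrow> x \<in> A \<Longrightarrow> h t x \<in> A"
    "\<And>x. x \<in> X \<Longrightarrow> h 0 x = x" "\<And>x. x \<in> X \<Longrightarrow> h 1 x \<in> A" and A: "A \<subseteq> X"
  shows "no_homology j X A"
proof (rule trivial_groupI)
  fix z assume z: "z \<in> carrier (rel_homology j X A)"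
  have "continuous_on X (\<lambda>x. (\<lambda>(t, x). h t x) (1, x))"
    by (rule continuous_on_compose2[OF h(1)]) (auto intro!: continuous_intros)
  then have hc: "continuous_on X (h 1)" by simp
  have "rel_map j X A X A id = rel_map j X A X A (id \<circ> h 1)"
    by (rule rel_map_homotopic[OF h(1)]) (use h A in auto)
  then have "z = rel_map j X A X A (id \<circ> h 1) z" using hom_induced_id[OF z] by simp
  also have "\<dots> = rel_one j X A"
    by (rule rel_map_trivial_factor[where Y=A and B=A])
      (use hc h A trivial_relative_homology_group_topspace[of j "top_of_set A"] in auto)
  finally show "z = rel_one j X A" .
qed simp

text \<open>A relation and not a function: later hypotheses exhibit some index different from
  \<open>j\<close>, and later conclusions speak of every index. The dimension of \<open>'b\<close>
  is that of the space near \<open>p\<close>.\<close>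

definition morse_index :: "'b::euclidean_space itself \<Rightarrow> ('a::euclidean_space \<Rightarrow> real) \<Rightarrow> 'a set \<Rightarrow> 'a \<Rightarrow> nat \<Rightarrow> bool" where
  "morse_index TYPE('b) f S p l \<longleftrightarrow>
    (\<exists>(E :: 'b set) F. morse_chart f S p E F \<and> dim E = l \<and> dim E + dim F = DIM('b))"

lemma morse_index_uminus:
  assumes "morse_index TYPE('b::euclidean_space) f S p l"
  shows "morse_index TYPE('b) (\<lambda>x. - f x) S p (DIM('b) - l)"
proof -
  obtain E F :: "'b set" where "morse_chart f S p E F" "dim E = l" "dim E + dim F = DIM('b)"
    using assms unfolding morse_index_def by blast
  then show ?thesis unfolding morse_index_def using morse_chart_uminus[of f S p E F]
    by (intro exI[of _ F] exI[of _ E]) auto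
qed

text \<open>Stands in for a gradient flow. The uniform drop \<delta> outside \<open>U\<close>
  crosses levels without critical points, and the bound \<open>e\<close> on the displacement keeps
  points near a critical point under control.\<close>

definition descends :: "('a::metric_space \<Rightarrow> real) \<Rightarrow> 'a set \<Rightarrow> 'a set \<Rightarrow> real \<Rightarrow> bool" where
  "descends f S U e \<longleftrightarrow> (\<exists>\<delta>>0. \<exists>\<eta>.
      continuous_on ({0..1::real} \<times> S) (\<lambda>(t, x). \<eta> t x) \<and>
      (\<forall>t\<in>{0..1}. \<forall>x\<in>S. \<eta> t x \<in> S \<and> f (\<eta> t x) \<le> f x \<and> dist (\<eta> t x) x < e) \<and>
      (\<forall>x\<in>S. \<eta> 0 x = x) \<and> (\<forall>x\<in>S - U. f (\<eta> 1 x) \<le> f x - \<delta>))"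

text \<open>\<open>K\<close> is meant to be the critical set, but it enters only through charts and
  descent. No derivative occurs, and the same statements can be instantiated with \<open>f\<close>
  and with \<open>-f\<close>.\<close>

locale morse_function =
  fixes type :: "'b::euclidean_space itself" and f :: "'a::euclidean_space \<Rightarrow> real" and S K :: "'a set"
  assumes compact_S: "compact S" and cont: "continuous_on S f"
    and K: "finite K" "K \<subseteq> S"
    and nondegenerate: "\<And>p. p \<in> K \<Longrightarrow> \<exists>l. morse_index TYPE('b) f S p l"
    and descent: "\<And>U e. open U \<Longrightarrow> K \<subseteq> U \<Longrightarrow> 0 < e \<Longrightarrow> descends f S U e"
begin

abbreviation M :: "real \<Rightarrow> 'a set" where "M c \<equiv> sublevel f S c"

text \<open>Let \<open>U\<close> be the complement of the strip of levels from \<open>a\<close> to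
  \<open>b\<close>. One deformation lowers each point of the strip by \<delta>, so it compresses any
  part of height at most \<delta>; finitely many such parts are joined by triples.\<close>

lemma trivial_homology_regular:
  assumes "a \<le> b" "f ` K \<inter> {a..b} = {}"
  shows "no_homology j (M b) (M a)"
proof -
  define U where "U = - (S \<inter> f -` {a..b})"
  have "closed (S \<inter> f -` {a..b})"
    using continuous_closed_preimage[OF cont compact_imp_closed[OF compact_S]] by blast
  then have "open U" unfolding U_def by (rule open_Compl)
  moreover have "K \<subseteq> U" using assms K by (auto simp: U_def)
  ultimately obtain \<delta> \<eta> where \<delta>: "\<delta> > 0"
    and \<eta>: "continuous_on ({0..1::real} \<times> S) (\<lambda>(t, x). \<eta> t x)"
      "\<forall>t\<in>{0..1}. \<forall>x\<in>S. \<eta> t x \<in> S \<and> f (\<eta> t x) \<le> f x \<and> dist (\<eta> t x) x < 1"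
      "\<forall>x\<in>S. \<eta> 0 x = x" "\<forall>x\<in>S - U. f (\<eta> 1 x) \<le> f x - \<delta>"
    using descent[of U 1] unfolding descends_def by auto
  have short: "no_homology j (M b') (M a')" if "a \<le> a'" "a' \<le> b'" "b' \<le> b" "b' \<le> a' + \<delta>" for a' b'
  proof (rule trivial_rel_homology_compress)
    show "continuous_on ({0..1} \<times> M b') (\<lambda>(t, x). \<eta> t x)"
      by (rule continuous_on_subset[OF \<eta>(1)]) auto
    show "\<eta> 1 x \<in> M a'" if x: "x \<in> M b'" for x
    proof (cases "f x \<ge> a'")
      case True
      then have "x \<in> S - U" using x \<open>a \<le> a'\<close> \<open>b' \<le> b\<close> by (auto simp: U_def)
      then have "f (\<eta> 1 x) \<le> f x - \<delta>" "\<eta> 1 x \<in> S" using \<eta>(2,4) by auto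
      then show ?thesis using x \<open>b' \<le> a' + \<delta>\<close> by auto
    next
      case False
      have "\<eta> 1 x \<in> S \<and> f (\<eta> 1 x) \<le> f x" using \<eta>(2) x by auto
      then show ?thesis using False by auto
    qed
    show "\<eta> t x \<in> M b'" if "t \<in> {0..1}" "x \<in> M b'" for t x
      using \<eta>(2) that by (metis (mono_tags, lifting) mem_Collect_eq order_trans)
    show "\<eta> t x \<in> M a'" if "t \<in> {0..1}" "x \<in> M a'" for t x
      using \<eta>(2) that by (metis (mono_tags, lifting) mem_Collect_eq order_trans)
  qed (use \<eta>(3) that in auto)
  have "no_homology j (M b') (M a)" if "a \<le> b'" "b' \<le> b" "b' \<le> a + real n * \<delta>" for b' n
    using that
  proof (induction n arbitrary: b')
    case 0
    then show ?case using short[of a b'] \<delta> assms by auto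
  next
    case (Suc n)
    define c where "c = max a (b' - \<delta>)"
    have c: "a \<le> c" "c \<le> b'" "b' \<le> c + \<delta>" "c \<le> a + real n * \<delta>"
      using Suc.prems \<delta> by (auto simp: c_def algebra_simps)
    then have "no_homology j (M c) (M a)" using Suc.prems by (intro Suc.IH) auto
    moreover have "no_homology j (M b') (M c)" using c Suc.prems by (intro short) auto
    ultimately show ?case
      by (intro trivial_rel_homology_triple[of "M a" "M c" "M b'"]) (use c in auto)
  qed
  moreover obtain n :: nat where "(b - a) / \<delta> \<le> n" using real_arch_simple by blast
  then have "b \<le> a + real n * \<delta>" using \<delta> by (simp add: field_simps)
  ultimately show ?thesis using assms(1) by blast
qed

text \<open>All critical points of level \<open>c\<close> are passed at once. Descent compresses the
  upper sublevel set into the lower one together with disjoint neighbourhoods of these points, and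
  each neighbourhood contributes the zero map.\<close>

lemma trivial_homology_level:
  assumes j: "j \<ge> 1" and idx: "\<And>p. p \<in> K \<Longrightarrow> \<exists>l. morse_index TYPE('b) f S p l \<and> int l \<noteq> j"
  shows "\<exists>\<epsilon>\<^sub>0>0. \<forall>\<epsilon>. 0 < \<epsilon> \<and> \<epsilon> < \<epsilon>\<^sub>0 \<longrightarrow> no_homology j (M (c + \<epsilon>)) (M (c - \<epsilon>))"
proof -
  define Kc where "Kc = {p \<in> K. f p = c}"
  have finKc: "finite Kc" using K by (auto simp: Kc_def)
  obtain d where d: "d > 0" "\<And>p q. p \<in> K \<Longrightarrow> q \<in> K \<Longrightarrow> p \<noteq> q \<Longrightarrow> d \<le> dist p q"
  proof -
    have "\<exists>d>0. \<forall>p\<in>K. p \<noteq> q \<longrightarrow> d \<le> dist q p" for q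
      using finite_set_avoid[OF K(1), of q] by auto
    then obtain D where D: "\<And>q. D q > 0" "\<And>p q. p \<in> K \<Longrightarrow> p \<noteq> q \<Longrightarrow> D q \<le> dist q p" by metis
    define d where "d = Min (insert 1 (D ` K))"
    have "d > 0" using K D by (auto simp: d_def)
    moreover have dD: "d \<le> D q" if "q \<in> K" for q using K that by (auto simp: d_def)
    moreover have "d \<le> dist p q" if "p \<in> K" "q \<in> K" "p \<noteq> q" for p q
      using dD[of p] D(2)[of q p] that by force
    ultimately show ?thesis using that by blast
  qed
  \<comment> \<open>One predicate, so that the neighbourhood and its threshold can be chosen
    together for each \<open>p\<close>. The radius \<open>d / 2\<close> makes the neighbourhoods
    disjoint.\<close>
  define Q where "Q = (\<lambda>p N e. openin (top_of_set S) N \<and> p \<in> N \<and> N \<subseteq> ball p (d / 2) \<and> (0::real) < e \<and>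
      (\<forall>\<epsilon> z. 0 < \<epsilon> \<longrightarrow> \<epsilon> < e \<longrightarrow> rel_map j (M (c + \<epsilon>) \<inter> N) (M (c - \<epsilon>) \<inter> N) (M (c + \<epsilon>)) (M (c - \<epsilon>)) id z =
          rel_one j (M (c + \<epsilon>)) (M (c - \<epsilon>))))"
  have "\<exists>N e. Q p N e" if p: "p \<in> Kc" for p
  proof -
    have pc: "p \<in> K" "f p = c" using p by (auto simp: Kc_def)
    obtain E F :: "'b set" where ch: "morse_chart f S p E F" "j \<noteq> int (dim E)"
      using idx[OF pc(1)] unfolding morse_index_def by metis
    show ?thesis
    proof (rule zero_map_near_critical_point[OF ch(1) j ch(2) open_ball[of p "d / 2"]], unfold pc(2))
      show "p \<in> ball p (d / 2)" using d(1) by simp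
    qed (unfold Q_def, blast)
  qed
  then obtain N e where Q: "\<And>p. p \<in> Kc \<Longrightarrow> Q p (N p) (e p)" by metis
  have N: "\<And>p. p \<in> Kc \<Longrightarrow> openin (top_of_set S) (N p)" "\<And>p. p \<in> Kc \<Longrightarrow> p \<in> N p"
      "\<And>p. p \<in> Kc \<Longrightarrow> N p \<subseteq> ball p (d / 2)"
    and e: "\<And>p. p \<in> Kc \<Longrightarrow> e p > 0"
    and zero: "\<And>p \<epsilon> z. p \<in> Kc \<Longrightarrow> 0 < \<epsilon> \<Longrightarrow> \<epsilon> < e p \<Longrightarrow>
        rel_map j (M (c + \<epsilon>) \<inter> N p) (M (c - \<epsilon>) \<inter> N p) (M (c + \<epsilon>)) (M (c - \<epsilon>)) id z =
          rel_one j (M (c + \<epsilon>)) (M (c - \<epsilon>))"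
    using Q unfolding Q_def by blast+
  have "\<exists>s>0. S \<inter> ball p s \<subseteq> N p" if "p \<in> Kc" for p
    using N(1,2)[OF that] unfolding openin_contains_ball by (metis Int_commute)
  then obtain s where s: "\<And>p. p \<in> Kc \<Longrightarrow> s p > 0" "\<And>p. p \<in> Kc \<Longrightarrow> S \<inter> ball p (s p) \<subseteq> N p" by metis
  \<comment> \<open>A point within \<open>\<rho> / 2\<close> of \<open>p\<close> that moves by less
    than \<open>\<rho> / 2\<close> ends within \<open>\<rho>\<close>, hence in
    \<open>N p\<close>.\<close>
  define \<rho> where "\<rho> = Min (insert 1 (s ` Kc))"
  have \<rho>: "\<rho> > 0" "\<And>p. p \<in> Kc \<Longrightarrow> \<rho> \<le> s p" using finKc s by (auto simp: \<rho>_def)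
  define g where "g = Min (insert 1 ((\<lambda>q. \<bar>f q - c\<bar> / 2) ` (K - Kc)))"
  have g: "g > 0" "\<And>q. q \<in> K - Kc \<Longrightarrow> 2 * g \<le> \<bar>f q - c\<bar>"
  proof -
    have fin: "finite (insert 1 ((\<lambda>q. \<bar>f q - c\<bar> / 2) ` (K - Kc)))" using K by auto
    show "g > 0" unfolding g_def by (subst Min_gr_iff[OF fin]) (auto simp: Kc_def)
    show "2 * g \<le> \<bar>f q - c\<bar>" if "q \<in> K - Kc" for q
    proof -
      have "g \<le> \<bar>f q - c\<bar> / 2" unfolding g_def using that fin by (intro Min_le) auto
      then show ?thesis by simp
    qed
  qed
  have "\<exists>r>0. \<forall>x\<in>S. dist x q < r \<longrightarrow> \<bar>f x - f q\<bar> < g" if "q \<in> K" for q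
    using cont K g(1) that unfolding continuous_on_iff dist_real_def by blast
  then obtain r where r: "\<And>q. q \<in> K \<Longrightarrow> r q > 0" "\<And>q x. q \<in> K \<Longrightarrow> x \<in> S \<Longrightarrow> dist x q < r q \<Longrightarrow> \<bar>f x - f q\<bar> < g"
    by metis
  \<comment> \<open>\<open>U\<close> must also contain the critical points of other levels, where
    nothing is lowered. This is harmless: on their balls \<open>f\<close> stays at distance at least
    \<open>g\<close> from \<open>c\<close>, so points of the upper sublevel set there are already
    far below \<open>c\<close>.\<close>
  define U where "U = (\<Union>p\<in>Kc. ball p (\<rho> / 2)) \<union> (\<Union>q\<in>K - Kc. ball q (r q))"
  have "K \<subseteq> U"
  proof
    fix x assume "x \<in> K"
    then have "x \<in> Kc \<and> x \<in> ball x (\<rho> / 2) \<or> x \<in> K - Kc \<and> x \<in> ball x (r x)" using \<rho>(1) r(1) by auto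
    then show "x \<in> U" unfolding U_def by blast
  qed
  moreover have "open U" by (auto simp: U_def)
  moreover have "\<rho> / 2 > 0" using \<rho>(1) by simp
  ultimately obtain \<delta> \<eta> where \<delta>: "\<delta> > 0" and H: "continuous_on ({0..1::real} \<times> S) (\<lambda>(t, x). \<eta> t x) \<and>
      (\<forall>t\<in>{0..1}. \<forall>x\<in>S. \<eta> t x \<in> S \<and> f (\<eta> t x) \<le> f x \<and> dist (\<eta> t x) x < \<rho> / 2) \<and>
      (\<forall>x\<in>S. \<eta> 0 x = x) \<and> (\<forall>x\<in>S - U. f (\<eta> 1 x) \<le> f x - \<delta>)"
    using descent[of U "\<rho> / 2"] unfolding descends_def by blast
  have \<eta>: "continuous_on ({0..1::real} \<times> S) (\<lambda>(t, x). \<eta> t x)"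
      "\<And>t x. t \<in> {0..1} \<Longrightarrow> x \<in> S \<Longrightarrow> \<eta> t x \<in> S \<and> f (\<eta> t x) \<le> f x \<and> dist (\<eta> t x) x < \<rho> / 2"
      "\<And>x. x \<in> S \<Longrightarrow> \<eta> 0 x = x" "\<And>x. x \<in> S - U \<Longrightarrow> f (\<eta> 1 x) \<le> f x - \<delta>"
    using H by blast+
  define \<epsilon>\<^sub>0 where "\<epsilon>\<^sub>0 = min (Min (insert 1 (e ` Kc))) (min (\<delta> / 4) (g / 2))"
  have \<epsilon>\<^sub>0: "\<epsilon>\<^sub>0 > 0" "\<And>p. p \<in> Kc \<Longrightarrow> \<epsilon>\<^sub>0 \<le> e p" "\<epsilon>\<^sub>0 \<le> \<delta> / 4" "\<epsilon>\<^sub>0 \<le> g / 2"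
    using finKc e \<delta> g by (auto simp: \<epsilon>\<^sub>0_def min_le_iff_disj)
  \<comment> \<open>The bound by a quarter of \<delta> brings level \<open>c + \<epsilon>\<close>
    below \<open>c - 2 * \<epsilon>\<close> in one deformation; the bound by half of
    \<open>g\<close> does the same for points near critical points of other levels. Level
    \<open>c - 2 * \<epsilon>\<close>, rather than \<open>c - \<epsilon>\<close>, leaves the room
    for excision.\<close>
  have "no_homology j (M (c + \<epsilon>)) (M (c - \<epsilon>))" if eps: "0 < \<epsilon>" "\<epsilon> < \<epsilon>\<^sub>0" for \<epsilon>
  proof -
    let ?X = "M (c + \<epsilon>)" and ?A = "M (c - \<epsilon>)"
    have contX: "continuous_on ?X f" by (rule continuous_on_subset[OF cont]) auto
    show ?thesis
    proof (rule trivial_rel_homology_deformation[where A'="M (c - 2 * \<epsilon>)" and V="{x \<in> ?X. f x < c - \<epsilon>}" and N="\<lambda>p. ?X \<inter> N p" and P=Kc])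
      show "continuous_on ({0..1} \<times> ?X) (\<lambda>(t, x). \<eta> t x)"
        by (rule continuous_on_subset[OF \<eta>(1)]) auto
      show \<eta>X: "\<eta> t x \<in> ?X" if "t \<in> {0..1}" "x \<in> ?X" for t x
        using \<eta>(2)[of t x] that by auto
      show "\<eta> t x \<in> ?A" if "t \<in> {0..1}" "x \<in> ?A" for t x
        using \<eta>(2)[of t x] that by auto
      show "\<eta> 1 x \<in> M (c - 2 * \<epsilon>) \<union> (\<Union>p\<in>Kc. ?X \<inter> N p)" if x: "x \<in> ?X" for x
      proof -
        have n: "\<eta> 1 x \<in> S" "f (\<eta> 1 x) \<le> f x" "dist (\<eta> 1 x) x < \<rho> / 2" using \<eta>(2)[of 1 x] x by auto
        consider "x \<notin> U" | p where "p \<in> Kc" "dist p x < \<rho> / 2" | q where "q \<in> K - Kc" "dist q x < r q"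
          by (auto simp: U_def)
        then show ?thesis
        proof cases
          case 1
          then have "f (\<eta> 1 x) \<le> f x - \<delta>" using \<eta>(4) x by auto
          then show ?thesis using x eps \<epsilon>\<^sub>0(3) n by auto
        next
          case 2
          have "dist p (\<eta> 1 x) \<le> dist p x + dist (\<eta> 1 x) x" by (metis dist_commute dist_triangle)
          then have "dist p (\<eta> 1 x) < s p" using 2(2) n(3) \<rho>(2)[OF 2(1)] by linarith
          then have "\<eta> 1 x \<in> N p" using s(2)[OF 2(1)] n(1) by auto
          then show ?thesis using 2(1) \<eta>X[of 1 x] x by auto
        next
          case 3
          then have "\<bar>f x - f q\<bar> < g" "2 * g \<le> \<bar>f q - c\<bar>"
            using r(2)[of q x] g(2)[of q] x by (auto simp: dist_commute)
          then have "g \<le> \<bar>f x - c\<bar>" by linarith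
          then have "f x \<le> c - 2 * \<epsilon>" using x eps \<epsilon>\<^sub>0(4) g(1) by auto
          then show ?thesis using n by auto
        qed
      qed
      show "openin (top_of_set ?X) {x \<in> ?X. f x < c - \<epsilon>}"
        using continuous_openin_preimage_gen[OF contX open_lessThan[of "c - \<epsilon>"]]
        by (simp add: vimage_def Int_def)
      have "M (c - 2 * \<epsilon>) = ?X \<inter> f -` {..c - 2 * \<epsilon>}" using eps by auto
      then show "closedin (top_of_set ?X) (M (c - 2 * \<epsilon>))"
        using continuous_closedin_preimage[OF contX closed_atMost[of "c - 2 * \<epsilon>"]] by simp
      show "openin (top_of_set ?X) (?X \<inter> N p)" if "p \<in> Kc" for p
        using openin_subtopology_Int[OF N(1)[OF that], of ?X]
        by (simp add: subtopology_subtopology Int_commute inf_absorb2 subset_iff)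
      show "(?X \<inter> N p) \<inter> (?X \<inter> N q) = {}" if "p \<in> Kc" "q \<in> Kc" "p \<noteq> q" for p q
      proof -
        have "d \<le> dist p q" using d(2)[of p q] that by (auto simp: Kc_def)
        then have "ball p (d / 2) \<inter> ball q (d / 2) = {}"
          by (intro disjoint_ballI) simp
        then show ?thesis using N(3)[OF that(1)] N(3)[OF that(2)] by auto
      qed
      show "rel_map j (?X \<inter> N p) (?A \<inter> (?X \<inter> N p)) ?X ?A id z = rel_one j ?X ?A" if "p \<in> Kc" for p z
      proof -
        have "?A \<inter> (?X \<inter> N p) = ?A \<inter> N p" using eps by auto
        then show ?thesis using zero[OF that eps(1)] eps(2) \<epsilon>\<^sub>0(2)[OF that] by simp
      qed
    qed (use eps finKc \<eta>(3) in auto)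
  qed
  then show ?thesis using \<epsilon>\<^sub>0(1) by blast
qed

text \<open>Induction on the number of critical values in between. The highest one,
  \<open>c\<close>, is enclosed between regular levels: above it there is a regular interval, around
  it a single critical level, and below it the induction hypothesis applies.\<close>

lemma trivial_homology_interval:
  assumes j: "j \<ge> 1" and idx: "\<And>p. p \<in> K \<Longrightarrow> \<exists>l. morse_index TYPE('b) f S p l \<and> int l \<noteq> j"
    and "a \<le> b" "a \<notin> f ` K" "b \<notin> f ` K"
  shows "no_homology j (M b) (M a)"
  using assms(3-)
proof (induction "card (f ` K \<inter> {a..b})" arbitrary: b rule: less_induct)
  case less
  show ?case
  proof (cases "f ` K \<inter> {a..b} = {}")
    case True
    then show ?thesis using trivial_homology_regular less.prems by blast
  next
    case False
    have fin: "finite (f ` K \<inter> {a..b})" using K by auto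
    define c where "c = Max (f ` K \<inter> {a..b})"
    have c: "c \<in> f ` K \<inter> {a..b}" "\<And>x. x \<in> f ` K \<inter> {a..b} \<Longrightarrow> x \<le> c"
      using Max_in[OF fin False] Max_ge[OF fin] by (auto simp: c_def)
    then have ab: "a < c" "c < b" using less.prems by force+
    obtain \<epsilon>\<^sub>0 where e0: "\<epsilon>\<^sub>0 > 0" "\<And>\<epsilon>. 0 < \<epsilon> \<Longrightarrow> \<epsilon> < \<epsilon>\<^sub>0 \<Longrightarrow> no_homology j (M (c + \<epsilon>)) (M (c - \<epsilon>))"
      using trivial_homology_level[OF j idx, of c] by blast
    have "finite (f ` K)" using K by auto
    then obtain d where d: "d > 0" "\<forall>x\<in>f ` K. x \<noteq> c \<longrightarrow> d \<le> dist c x"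
      using finite_set_avoid[of "f ` K" c] by blast
    define \<epsilon> where "\<epsilon> = min (min (\<epsilon>\<^sub>0 / 2) (d / 2)) (min ((c - a) / 2) ((b - c) / 2))"
    have e: "0 < \<epsilon>" "\<epsilon> < \<epsilon>\<^sub>0" "\<epsilon> < d" "\<epsilon> < c - a" "\<epsilon> < b - c"
      using e0(1) d(1) ab by (auto simp: \<epsilon>_def min_def field_simps)
    have reg: "c - \<epsilon> \<notin> f ` K"
    proof
      assume "c - \<epsilon> \<in> f ` K"
      then have "d \<le> dist c (c - \<epsilon>)" using d(2) e(1) by force
      then show False using e by (simp add: dist_real_def)
    qed
    have "card (f ` K \<inter> {a..c - \<epsilon>}) < card (f ` K \<inter> {a..b})"
    proof (rule psubset_card_mono[OF fin])
      have "c \<notin> f ` K \<inter> {a..c - \<epsilon>}" using e by simp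
      then show "f ` K \<inter> {a..c - \<epsilon>} \<subset> f ` K \<inter> {a..b}" using c(1) e ab by force
    qed
    then have 1: "no_homology j (M (c - \<epsilon>)) (M a)"
      using less.hyps less.prems reg e by auto
    have 2: "no_homology j (M (c + \<epsilon>)) (M (c - \<epsilon>))" using e0(2) e by auto
    have "f ` K \<inter> {c + \<epsilon>..b} = {}" using c(2) e(1) ab by fastforce
    then have 3: "no_homology j (M b) (M (c + \<epsilon>))"
      using e by (intro trivial_homology_regular) auto
    have 4: "no_homology j (M b) (M (c - \<epsilon>))"
      by (rule trivial_rel_homology_triple[OF _ _ 3 2]) (use e in auto)
    show ?thesis by (rule trivial_rel_homology_triple[OF _ _ 4 1]) (use e in auto)
  qed
qed

lemma bounds: obtains L U where "\<And>x. x \<in> S \<Longrightarrow> L < f x" "\<And>x. x \<in> S \<Longrightarrow> f x < U"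
proof -
  have "bounded (f ` S)" by (intro compact_imp_bounded compact_continuous_image cont compact_S)
  then obtain B where "\<forall>x\<in>S. \<bar>f x\<bar> \<le> B" unfolding bounded_iff by auto
  then show ?thesis by (intro that[of "-B - 1" "B + 1"]) (auto simp: abs_le_iff)
qed

text \<open>The case of an empty lower sublevel set. Taking \<open>min L b\<close> as the lower
  level covers also a \<open>b\<close> below all values of \<open>f\<close>.\<close>

lemma trivial_homology_sublevel:
  assumes j: "j \<ge> 1" and idx: "\<And>p. p \<in> K \<Longrightarrow> \<exists>l. morse_index TYPE('b) f S p l \<and> int l \<noteq> j"
    and b: "b \<notin> f ` K"
  shows "no_homology j (M b) {}"
proof -
  obtain L U where L: "\<And>x. x \<in> S \<Longrightarrow> L < f x" using bounds by metis
  have e: "M (min L b) = {}" using L by fastforce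
  have "L \<notin> f ` K" using L K by (metis imageE less_irrefl subsetD)
  then have "min L b \<notin> f ` K" using b by (simp add: min_def)
  then have "no_homology j (M b) (M (min L b))"
    using b by (intro trivial_homology_interval[OF j idx]) auto
  then show ?thesis unfolding e .
qed

lemma trivial_homology_superlevel:
  assumes j: "j \<ge> 1" and idx: "\<And>p. p \<in> K \<Longrightarrow> \<exists>l. morse_index TYPE('b) f S p l \<and> int l \<noteq> j"
    and a: "a \<notin> f ` K"
  shows "no_homology j S (M a)"
proof -
  obtain L U where U: "\<And>x. x \<in> S \<Longrightarrow> f x < U" using bounds by metis
  have e: "M (max U a) = S" using U by fastforce
  have "U \<notin> f ` K" using U K by (metis imageE less_irrefl subsetD)
  then have "max U a \<notin> f ` K" using a by (simp add: max_def)
  then have "no_homology j (M (max U a)) (M a)"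
    using a by (intro trivial_homology_interval[OF j idx]) auto
  then show ?thesis unfolding e .
qed

lemma regular_nearby:
  assumes "\<epsilon>\<^sub>0 > 0"
  obtains \<epsilon> where "0 < \<epsilon>" "\<epsilon> < \<epsilon>\<^sub>0" "c + \<epsilon> \<notin> f ` K" "c - \<epsilon> \<notin> f ` K"
proof -
  obtain d where d: "d > 0" "\<forall>x\<in>f ` K. x \<noteq> c \<longrightarrow> d \<le> dist c x"
    using finite_set_avoid[of "f ` K" c] K by auto
  have "min (d / 2) (\<epsilon>\<^sub>0 / 2) > 0" "min (d / 2) (\<epsilon>\<^sub>0 / 2) < \<epsilon>\<^sub>0" "min (d / 2) (\<epsilon>\<^sub>0 / 2) < d"
    using d(1) assms by auto
  then show ?thesis using d(2) by (intro that[of "min (d / 2) (\<epsilon>\<^sub>0 / 2)"]) (force simp: dist_real_def)+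
qed

text \<open>Denying the conclusion gives each critical point one index that avoids both
  \<open>k - 1\<close> and \<open>k + 1\<close>, so vanishing is available in both degrees;
  \<open>k \<ge> 2\<close> makes the lower one positive.\<close>

lemma adjacent_index:
  assumes k: "k \<ge> 2" and p: "p \<in> K" "morse_index TYPE('b) f S p k"
    and homS: "no_homology (int k) S {}"
  shows "\<exists>q\<in>K. \<forall>l. morse_index TYPE('b) f S q l \<longrightarrow> l = k - 1 \<or> l = k + 1"
proof (rule ccontr)
  assume "\<not> ?thesis"
  then have idx: "\<exists>l. morse_index TYPE('b) f S q l \<and> int l \<noteq> int k - 1" "\<exists>l. morse_index TYPE('b) f S q l \<and> int l \<noteq> int k + 1"
    if "q \<in> K" for q using that k by fastforce+
  obtain E F :: "'b set" where EF: "morse_chart f S p E F" "dim E = k"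
    using p(2) unfolding morse_index_def by blast
  have "dim E \<ge> 1" using EF k by simp
  from nontrivial_homology_at_critical_point[OF EF(1) this open_UNIV UNIV_I]
  obtain \<epsilon>\<^sub>0 where e0: "\<epsilon>\<^sub>0 > 0" "\<And>\<epsilon> X. 0 < \<epsilon> \<Longrightarrow> \<epsilon> < \<epsilon>\<^sub>0 \<Longrightarrow> M (f p - \<epsilon>) \<subseteq> X \<Longrightarrow> X \<subseteq> S \<Longrightarrow> {x \<in> S \<inter> UNIV. f x \<le> f p} \<subseteq> X \<Longrightarrow>
      X \<subseteq> M (f p + \<epsilon>) \<or> F = {0} \<Longrightarrow> \<not> no_homology (int (dim E)) X (M (f p - \<epsilon>))" by blast
  obtain \<epsilon> where e: "0 < \<epsilon>" "\<epsilon> < \<epsilon>\<^sub>0" "f p + \<epsilon> \<notin> f ` K" "f p - \<epsilon> \<notin> f ` K"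
    using regular_nearby[OF e0(1)] .
  let ?X = "M (f p + \<epsilon>)" and ?A = "M (f p - \<epsilon>)"
  have 1: "no_homology (int k - 1) ?A {}"
    by (rule trivial_homology_sublevel) (use k idx e in auto)
  have 2: "no_homology (int k + 1) S ?X"
    by (rule trivial_homology_superlevel) (use k idx e in auto)
  have 3: "no_homology (int k) ?X {}"
    by (rule trivial_homology_subspace[OF _ 2 homS]) auto
  have "no_homology (int k) ?X ?A"
    by (rule trivial_rel_homology_of_space[OF _ 3 1]) (use e in auto)
  moreover have "\<not> no_homology (int (dim E)) ?X ?A"
    by (rule e0(2)) (use e in auto)
  ultimately show False using EF(2) by simp
qed

text \<open>Here \<open>F = {0}\<close>, so the crossing set is the point \<open>p\<close>, and the
  ambient space may be all of \<open>S\<close> except \<open>q\<close> instead of a sublevel set.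
  Contractibility of that space kills degree \<open>DIM('b)\<close>, and absence of index
  \<open>DIM('b) - 1\<close> kills the homology of the lower sublevel set one degree below.\<close>

lemma index_below_top:
  assumes m: "DIM('b) \<ge> 2" and p: "p \<in> K" "morse_index TYPE('b) f S p (DIM('b))"
    and q: "q \<in> S" "q \<noteq> p" "f p \<le> f q" and contr: "contractible (S - {q})"
  shows "\<exists>q\<in>K. \<forall>l. morse_index TYPE('b) f S q l \<longrightarrow> l = DIM('b) - 1"
proof (rule ccontr)
  assume "\<not> ?thesis"
  then have idx: "\<exists>l. morse_index TYPE('b) f S q l \<and> int l \<noteq> int (DIM('b)) - 1"
    if "q \<in> K" for q using that m by fastforce
  obtain E F :: "'b set" where EF: "morse_chart f S p E F" "dim E = DIM('b)" "dim F = 0"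
    using p(2) unfolding morse_index_def by auto
  then have F: "F = {0}" unfolding morse_chart_def using subspace_0 by fastforce
  have "dim E \<ge> 1" "open (- {q})" "p \<in> - {q}" using EF m q(2) by auto
  from nontrivial_homology_at_critical_point[OF EF(1) this]
  obtain \<epsilon>\<^sub>0 where e0: "\<epsilon>\<^sub>0 > 0" "\<And>\<epsilon> X. 0 < \<epsilon> \<Longrightarrow> \<epsilon> < \<epsilon>\<^sub>0 \<Longrightarrow> M (f p - \<epsilon>) \<subseteq> X \<Longrightarrow> X \<subseteq> S \<Longrightarrow> {x \<in> S \<inter> - {q}. f x \<le> f p} \<subseteq> X \<Longrightarrow>
      X \<subseteq> M (f p + \<epsilon>) \<or> F = {0} \<Longrightarrow> \<not> no_homology (int (dim E)) X (M (f p - \<epsilon>))" by blast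
  obtain \<epsilon> where e: "0 < \<epsilon>" "\<epsilon> < \<epsilon>\<^sub>0" "f p + \<epsilon> \<notin> f ` K" "f p - \<epsilon> \<notin> f ` K"
    using regular_nearby[OF e0(1)] .
  let ?X = "S - {q}" and ?A = "M (f p - \<epsilon>)"
  have AX: "?A \<subseteq> ?X" using q e by auto
  have 1: "no_homology (int (DIM('b)) - 1) ?A {}"
    by (rule trivial_homology_sublevel) (use m idx e in auto)
  have 3: "no_homology (int (DIM('b))) ?X {}"
    by (rule trivial_homology_contractible[OF contr]) simp
  have "no_homology (int (DIM('b))) ?X ?A"
    by (rule trivial_rel_homology_of_space[OF AX 3 1])
  moreover have "\<not> no_homology (int (dim E)) ?X ?A"
    by (rule e0(2)) (use e AX F in auto)
  ultimately show False using EF(2) by simp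
qed

end

section \<open>Self-adjoint operators\<close>

text \<open>A maximum \<open>x\<close> of the quadratic form on the unit sphere of \<open>V\<close>
  is an eigenvector: if the residual \<open>h\<close> were nonzero, moving from \<open>x\<close> in
  its direction would raise the Rayleigh quotient to first order.\<close>

lemma selfadjoint_has_eigenvector:
  fixes A :: "'a::euclidean_space \<Rightarrow> 'a"
  assumes A: "linear A" and sa: "\<And>x y. A x \<bullet> y = x \<bullet> A y"
    and V: "subspace V" "A ` V \<subseteq> V" "V \<noteq> {0}"
  obtains x \<kappa> where "x \<in> V" "norm x = 1" "A x = \<kappa> *\<^sub>R x"
proof -
  have contA: "continuous_on X A" for X
    using A by (simp add: linear_continuous_on linear_conv_bounded_linear)
  obtain v where v: "v \<in> V" "v \<noteq> 0" using V subspace_0 by blast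
  then have "(1 / norm v) *\<^sub>R v \<in> V \<inter> sphere 0 1" using V by (simp add: subspace_scale)
  then have ne: "V \<inter> sphere 0 1 \<noteq> {}" by blast
  have "compact (V \<inter> sphere 0 1)" by (intro closed_Int_compact closed_subspace V compact_sphere)
  moreover have "continuous_on (V \<inter> sphere 0 1) (\<lambda>y. y \<bullet> A y)" by (intro continuous_intros contA)
  ultimately obtain x where x: "x \<in> V \<inter> sphere 0 1" and max: "\<And>y. y \<in> V \<inter> sphere 0 1 \<Longrightarrow> y \<bullet> A y \<le> x \<bullet> A x"
    using continuous_attains_sup[OF _ ne, of "\<lambda>y. y \<bullet> A y"] by blast
  define \<kappa> where "\<kappa> = x \<bullet> A x"
  have le: "y \<bullet> A y \<le> \<kappa> * (norm y)\<^sup>2" if "y \<in> V" for y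
  proof (cases "y = 0")
    case False
    let ?z = "(1 / norm y) *\<^sub>R y"
    have "?z \<bullet> A ?z \<le> \<kappa>" unfolding \<kappa>_def using that False V by (intro max) (auto simp: subspace_scale)
    then show ?thesis using False A by (simp add: linear_scale divide_le_eq power2_eq_square mult.assoc)
  qed (use A linear_0 in auto)
  define h where "h = A x - \<kappa> *\<^sub>R x"
  have hV: "h \<in> V" unfolding h_def using x V by (auto intro!: subspace_diff subspace_scale)
  have nx: "x \<bullet> x = 1" using x by (simp add: dot_square_norm)
  have "(norm h)\<^sup>2 = 0"
  proof (rule ccontr)
    assume "(norm h)\<^sup>2 \<noteq> 0"
    then have pos: "0 < (norm h)\<^sup>2" by simp
    \<comment> \<open>\<open>C\<close> dominates the second-order coefficient. With
      \<open>t = (norm h)\<^sup>2 / C\<close> the second-order term is at most half of the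
      first-order gain \<open>2 * t * (norm h)\<^sup>2\<close>.\<close>
    define C where "C = \<bar>\<kappa> * (norm h)\<^sup>2 - h \<bullet> A h\<bar> + 1"
    define t where "t = (norm h)\<^sup>2 / C"
    have C: "C > 0" by (simp add: C_def)
    have t: "t > 0" using pos C by (simp add: t_def)
    have e: "h \<bullet> A x - \<kappa> * (h \<bullet> x) = (norm h)\<^sup>2"
      unfolding power2_norm_eq_inner by (simp add: h_def inner_diff_left inner_diff_right inner_commute algebra_simps)
    have "(x + t *\<^sub>R h) \<bullet> A (x + t *\<^sub>R h) \<le> \<kappa> * (norm (x + t *\<^sub>R h))\<^sup>2"
      using x hV V by (intro le subspace_add subspace_scale) auto
    moreover have "(x + t *\<^sub>R h) \<bullet> A (x + t *\<^sub>R h) = \<kappa> + 2 * t * (h \<bullet> A x) + t\<^sup>2 * (h \<bullet> A h)"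
    proof -
      have "x \<bullet> A h = h \<bullet> A x" using sa[of x h] by (simp add: inner_commute)
      then show ?thesis using A by (simp add: linear_add linear_scale inner_add_left inner_add_right \<kappa>_def power2_eq_square algebra_simps)
    qed
    moreover have "(norm (x + t *\<^sub>R h))\<^sup>2 = 1 + 2 * t * (h \<bullet> x) + t\<^sup>2 * (norm h)\<^sup>2"
      unfolding power2_norm_eq_inner using nx
      by (simp add: inner_add_left inner_add_right inner_commute power2_eq_square algebra_simps)
    ultimately have "2 * t * (h \<bullet> A x - \<kappa> * (h \<bullet> x)) \<le> t\<^sup>2 * (\<kappa> * (norm h)\<^sup>2 - h \<bullet> A h)"
      by (simp add: algebra_simps)
    also have "\<dots> \<le> t\<^sup>2 * C" by (intro mult_left_mono) (auto simp: C_def)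
    also have "\<dots> = t * (norm h)\<^sup>2" using C by (simp add: t_def power2_eq_square)
    finally show False unfolding e using t pos by simp
  qed
  then show thesis using that[of x \<kappa>] x by (simp add: h_def)
qed

text \<open>Split off one unit eigenvector; by self-adjointness its orthogonal complement in
  \<open>V\<close> is again invariant.\<close>

lemma selfadjoint_eigenbasis:
  fixes A :: "'a::euclidean_space \<Rightarrow> 'a"
  assumes A: "linear A" and sa: "\<And>x y. A x \<bullet> y = x \<bullet> A y"
    and V: "subspace V" "A ` V \<subseteq> V"
  shows "\<exists>B\<subseteq>V. pairwise orthogonal B \<and> span B = V \<and> (\<forall>b\<in>B. norm b = 1 \<and> (\<exists>\<mu>. A b = \<mu> *\<^sub>R b))"
  using V
proof (induction "dim V" arbitrary: V rule: less_induct)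
  case less
  show ?case
  proof (cases "V = {0}")
    case True
    then show ?thesis by (intro exI[of _ "{}"]) auto
  next
    case False
    obtain x \<kappa> where x: "x \<in> V" "norm x = 1" "A x = \<kappa> *\<^sub>R x"
      using selfadjoint_has_eigenvector[OF A sa less.prems False] .
    define W where "W = V \<inter> {y. x \<bullet> y = 0}"
    have W: "subspace W" unfolding W_def using less.prems by (intro subspace_inter subspace_hyperplane)
    have "A ` W \<subseteq> W"
    proof (rule image_subsetI)
      fix y assume "y \<in> W"
      then show "A y \<in> W"
        using less.prems sa[of x y] x(3) by (auto simp: W_def)
    qed
    have "x \<notin> W" "W \<subseteq> V" using x(2) by (auto simp: W_def)
    then have "W \<subset> V" using x(1) by blast
    have sp: "span W = W" "span V = V" using W less.prems(1) by (simp_all add: span_eq_iff)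
    have "dim W < dim V"
      by (rule dim_psubset) (unfold sp, rule \<open>W \<subset> V\<close>)
    from less.hyps[OF this W \<open>A ` W \<subseteq> W\<close>] obtain B where B: "B \<subseteq> W" "pairwise orthogonal B" "span B = W" "\<forall>b\<in>B. norm b = 1 \<and> (\<exists>\<mu>. A b = \<mu> *\<^sub>R b)"
      by blast
    have "pairwise orthogonal (insert x B)"
      using B by (auto simp: pairwise_insert orthogonal_def W_def inner_commute)
    moreover have "span (insert x B) = V"
    proof
      show "span (insert x B) \<subseteq> V" using x B less.prems by (intro span_minimal) (auto simp: W_def)
      show "V \<subseteq> span (insert x B)"
      proof
        fix v assume "v \<in> V"
        moreover have "x \<bullet> x = 1" using x by (simp add: dot_square_norm)
        ultimately have "v - (x \<bullet> v) *\<^sub>R x \<in> span B"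
          unfolding B(3) W_def using x less.prems
          by (auto intro!: subspace_diff subspace_scale simp: inner_diff_right)
        then show "v \<in> span (insert x B)" by (auto simp: span_insert)
      qed
    qed
    ultimately show ?thesis
      using B x by (intro exI[of _ "insert x B"]) (auto simp: W_def)
  qed
qed

text \<open>For symmetric \<open>H\<close>, think of \<open>E\<close> and \<open>F\<close> as the
  sums of the negative and of the positive eigenspaces, with projections \<open>P\<close> and
  \<open>Q\<close>. \<open>\<alpha>\<close> bounds the form away from 0 on each of them, and
  \<open>\<beta>\<close> bounds its size.\<close>

definition spectral_split :: "real ^ 'm ^ 'm \<Rightarrow> (real ^ 'm) set \<Rightarrow> (real ^ 'm) set \<Rightarrow>
    (real ^ 'm \<Rightarrow> real ^ 'm) \<Rightarrow> (real ^ 'm \<Rightarrow> real ^ 'm) \<Rightarrow> real \<Rightarrow> real \<Rightarrow> bool" where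
  "spectral_split H E F P Q \<alpha> \<beta> \<longleftrightarrow>
    subspace E \<and> subspace F \<and> dim E + dim F = CARD('m) \<and>
    bounded_linear P \<and> bounded_linear Q \<and> (\<forall>z. P z \<in> E \<and> Q z \<in> F \<and> P z + Q z = z) \<and>
    (\<forall>x\<in>E. \<forall>y\<in>F. P (x + y) = x \<and> Q (x + y) = y \<and> x \<bullet> y = 0) \<and>
    0 < \<alpha> \<and> (\<forall>x\<in>E. H *v x \<in> E \<and> x \<bullet> (H *v x) \<le> - \<alpha> * (norm x)\<^sup>2) \<and>
    (\<forall>y\<in>F. H *v y \<in> F \<and> \<alpha> * (norm y)\<^sup>2 \<le> y \<bullet> (H *v y)) \<and>
    0 < \<beta> \<and> (\<forall>x. \<bar>x \<bullet> (H *v x)\<bar> \<le> \<beta> * (norm x)\<^sup>2)"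

text \<open>Everything is read off from expansions in an orthonormal eigenbasis. Invertibility
  excludes the eigenvalue 0, so the basis splits into \<open>Bm\<close> and
  \<open>Bp\<close>.\<close>

lemma spectral_splitting:
  fixes H :: "real ^ 'm ^ 'm"
  assumes sym: "transpose H = H" and inv: "invertible H"
  shows "\<exists>E F P Q \<alpha> \<beta>. spectral_split H E F P Q \<alpha> \<beta> \<and> dim E = num_neg_eigenvalues H"
proof -
  let ?A = "\<lambda>x. H *v x"
  have A: "linear ?A" by (rule matrix_vector_mul_linear)
  have sa: "?A x \<bullet> y = x \<bullet> ?A y" for x y
    by (simp add: dot_lmul_matrix[symmetric] sym flip: matrix_vector_mul_assoc transpose_matrix_vector)
  obtain B where B: "pairwise orthogonal B" "span B = (UNIV :: (real ^ 'm) set)" "\<And>b. b \<in> B \<Longrightarrow> norm b = 1"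
      "\<And>b. b \<in> B \<Longrightarrow> \<exists>\<mu>. ?A b = \<mu> *\<^sub>R b"
    using selfadjoint_eigenbasis[OF A sa subspace_UNIV] by (metis subset_UNIV)
  obtain ev where ev: "\<And>b. b \<in> B \<Longrightarrow> ?A b = ev b *\<^sub>R b" using B(4) by metis
  have B0: "0 \<notin> B" using B(3) by force
  have ind: "independent B" using pairwise_orthogonal_independent[OF B(1) B0] .
  have finB: "finite B" using ind by (rule finiteI_independent)
  have orth: "b \<bullet> c = (if b = c then 1 else 0)" if "b \<in> B" "c \<in> B" for b c
    using B(1,3) that by (auto simp: pairwise_def orthogonal_def dot_square_norm)
  have ev0: "ev b \<noteq> 0" if "b \<in> B" for b
  proof
    assume "ev b = 0"
    then have "H *v b = 0" using ev[OF that] by simp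
    moreover obtain H' where "H' ** H = mat 1" using inv unfolding invertible_def by blast
    then have "H' *v (H *v b) = b" by (simp add: matrix_vector_mul_assoc)
    ultimately show False using B0 that by (metis matrix_vector_mult_0_right)
  qed
  have expand: "z = (\<Sum>b\<in>B. (z \<bullet> b) *\<^sub>R b)" for z
  proof -
    have "z \<in> span B" using B(2) by simp
    then obtain c where c: "z = (\<Sum>b\<in>B. c b *\<^sub>R b)" using span_finite[OF finB] by auto
    have "z \<bullet> b = c b" if "b \<in> B" for b
      using that finB by (simp add: c inner_sum_left orth if_distrib cong: if_cong sum.cong)
    then show ?thesis using c by (metis (no_types, lifting) sum.cong)
  qed
  define Bm where "Bm = {b \<in> B. ev b < 0}"
  define Bp where "Bp = {b \<in> B. ev b > 0}"
  have "ev b < 0 \<or> 0 < ev b" if "b \<in> B" for b using ev0[OF that] by linarith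
  then have "Bm \<union> Bp = B" unfolding Bm_def Bp_def by blast
  moreover have "Bm \<inter> Bp = {}" unfolding Bm_def Bp_def by fastforce
  moreover have "finite Bm" "finite Bp" unfolding Bm_def Bp_def using finB by simp_all
  ultimately have Bsplit: "Bm \<union> Bp = B" "Bm \<inter> Bp = {}" "finite Bm" "finite Bp" by blast+
  define E where "E = span Bm"
  define F where "F = span Bp"
  define P where "P = (\<lambda>z. \<Sum>b\<in>Bm. (z \<bullet> b) *\<^sub>R b)"
  define Q where "Q = (\<lambda>z. \<Sum>b\<in>Bp. (z \<bullet> b) *\<^sub>R b)"
  have PE: "P z \<in> E" "Q z \<in> F" for z
    unfolding P_def Q_def E_def F_def by (rule span_sum, rule span_scale, erule span_base)+
  have PQ: "P z + Q z = z" for z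
  proof -
    have "P z + Q z = (\<Sum>b\<in>Bm \<union> Bp. (z \<bullet> b) *\<^sub>R b)"
      unfolding P_def Q_def by (rule sum.union_disjoint[symmetric]) (use Bsplit in auto)
    then show ?thesis using expand[of z] Bsplit(1) by simp
  qed
  have bl: "bounded_linear P" "bounded_linear Q"
    unfolding P_def Q_def by (intro bounded_linear_sum bounded_linear_scaleR_const bounded_linear_inner_left)+
  have EF: "x \<bullet> y = 0" if "x \<in> E" "y \<in> F" for x y
  proof -
    have "orthogonal x y"
      unfolding orthogonal_commute[of x y]
      by (rule orthogonal_to_span[OF that(1)[unfolded E_def]], unfold orthogonal_commute[of y], rule orthogonal_to_span[OF that(2)[unfolded F_def]])
        (use orth Bsplit in \<open>auto simp: orthogonal_def Bm_def Bp_def\<close>)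
    then show ?thesis by (simp add: orthogonal_def)
  qed
  have Qx: "Q x = 0" "P x = x" if "x \<in> E" for x
  proof -
    have "x \<bullet> b = 0" if "b \<in> Bp" for b using EF[OF \<open>x \<in> E\<close>, of b] that by (simp add: F_def span_base)
    then show "Q x = 0" by (simp add: Q_def)
    then show "P x = x" using PQ[of x] by simp
  qed
  have Py: "P y = 0" "Q y = y" if "y \<in> F" for y
  proof -
    have "y \<bullet> b = 0" if "b \<in> Bm" for b using EF[of b y] that \<open>y \<in> F\<close> by (simp add: E_def span_base inner_commute)
    then show "P y = 0" by (simp add: P_def)
    then show "Q y = y" using PQ[of y] by simp
  qed
  have HE: "H *v x \<in> E" if "x \<in> E" for x
  proof -
    have "H *v x = H *v (P x)" using Qx that by simp
    also have "\<dots> = (\<Sum>b\<in>Bm. (x \<bullet> b) *\<^sub>R (H *v b))"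
      unfolding P_def by (simp add: linear_sum[OF A] linear_scale[OF A])
    also have "\<dots> = (\<Sum>b\<in>Bm. (x \<bullet> b) *\<^sub>R (ev b *\<^sub>R b))"
      by (rule sum.cong) (use ev in \<open>auto simp: Bm_def\<close>)
    finally have "H *v x = (\<Sum>b\<in>Bm. (x \<bullet> b) *\<^sub>R (ev b *\<^sub>R b))" .
    then show ?thesis unfolding E_def by (simp only:) (rule span_sum, rule span_scale, rule span_scale, erule span_base)
  qed
  have HF: "H *v x \<in> F" if "x \<in> F" for x
  proof -
    have "H *v x = H *v (Q x)" using Py that by simp
    also have "\<dots> = (\<Sum>b\<in>Bp. (x \<bullet> b) *\<^sub>R (H *v b))"
      unfolding Q_def by (simp add: linear_sum[OF A] linear_scale[OF A])
    also have "\<dots> = (\<Sum>b\<in>Bp. (x \<bullet> b) *\<^sub>R (ev b *\<^sub>R b))"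
      by (rule sum.cong) (use ev in \<open>auto simp: Bp_def\<close>)
    finally have "H *v x = (\<Sum>b\<in>Bp. (x \<bullet> b) *\<^sub>R (ev b *\<^sub>R b))" .
    then show ?thesis unfolding F_def by (simp only:) (rule span_sum, rule span_scale, rule span_scale, erule span_base)
  qed
  have quad: "x \<bullet> (H *v x) = (\<Sum>b\<in>B. ev b * (x \<bullet> b)\<^sup>2)" for x
  proof -
    have "H *v x = H *v (\<Sum>b\<in>B. (x \<bullet> b) *\<^sub>R b)" using expand[of x] by simp
    also have "\<dots> = (\<Sum>b\<in>B. (x \<bullet> b) *\<^sub>R (H *v b))"
      by (simp add: linear_sum[OF A] linear_scale[OF A])
    also have "\<dots> = (\<Sum>b\<in>B. (x \<bullet> b) *\<^sub>R (ev b *\<^sub>R b))"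
      by (rule sum.cong) (use ev in auto)
    finally show ?thesis by (simp add: inner_sum_right power2_eq_square ac_simps)
  qed
  have nrm: "(norm x)\<^sup>2 = (\<Sum>b\<in>B. (x \<bullet> b)\<^sup>2)" for x
  proof -
    have "x \<bullet> x = x \<bullet> (\<Sum>b\<in>B. (x \<bullet> b) *\<^sub>R b)" using expand[of x] by simp
    then show ?thesis by (simp add: inner_sum_right power2_eq_square dot_square_norm)
  qed
  \<comment> \<open>The least absolute value of an eigenvalue; \<open>insert 1\<close> makes the set
    visibly nonempty, here and for \<open>\<beta>\<close>.\<close>
  define \<alpha> where "\<alpha> = Min (insert 1 ((\<lambda>b. \<bar>ev b\<bar>) ` B))"
  have al: "\<alpha> > 0" "\<And>b. b \<in> B \<Longrightarrow> \<alpha> \<le> \<bar>ev b\<bar>" using finB ev0 by (auto simp: \<alpha>_def)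
  define \<beta> where "\<beta> = Max (insert 1 ((\<lambda>b. \<bar>ev b\<bar>) ` B))"
  have be: "\<beta> \<ge> 1" "\<And>b. b \<in> B \<Longrightarrow> \<bar>ev b\<bar> \<le> \<beta>" using finB by (auto simp: \<beta>_def)
  have Eneg: "x \<bullet> (H *v x) \<le> - \<alpha> * (norm x)\<^sup>2" if "x \<in> E" for x
    unfolding quad nrm sum_distrib_left
  proof (rule sum_mono)
    fix b assume b: "b \<in> B"
    show "ev b * (x \<bullet> b)\<^sup>2 \<le> - \<alpha> * (x \<bullet> b)\<^sup>2"
    proof (cases "b \<in> Bp")
      case True
      then have "x \<bullet> b = 0" using EF[OF that, of b] by (simp add: F_def span_base)
      then show ?thesis by simp
    next
      case False
      then have "ev b \<le> - \<alpha>" using b al(2)[OF b] ev0[OF b] by (auto simp: Bp_def)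
      then show ?thesis by (intro mult_right_mono) auto
    qed
  qed
  have Fpos: "\<alpha> * (norm x)\<^sup>2 \<le> x \<bullet> (H *v x)" if "x \<in> F" for x
    unfolding quad nrm sum_distrib_left
  proof (rule sum_mono)
    fix b assume b: "b \<in> B"
    show "\<alpha> * (x \<bullet> b)\<^sup>2 \<le> ev b * (x \<bullet> b)\<^sup>2"
    proof (cases "b \<in> Bm")
      case True
      then have "x \<bullet> b = 0" using EF[of b x] that by (simp add: E_def span_base inner_commute)
      then show ?thesis by simp
    next
      case False
      then have "\<alpha> \<le> ev b" using b al(2)[OF b] ev0[OF b] by (auto simp: Bm_def)
      then show ?thesis by (intro mult_right_mono) auto
    qed
  qed
  have bound: "\<bar>x \<bullet> (H *v x)\<bar> \<le> \<beta> * (norm x)\<^sup>2" for x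
  proof -
    have "\<bar>x \<bullet> (H *v x)\<bar> \<le> (\<Sum>b\<in>B. \<bar>ev b * (x \<bullet> b)\<^sup>2\<bar>)" unfolding quad by (rule sum_abs)
    also have "\<dots> \<le> (\<Sum>b\<in>B. \<beta> * (x \<bullet> b)\<^sup>2)"
      using be(2) by (intro sum_mono) (auto simp: abs_mult intro!: mult_right_mono)
    finally show ?thesis unfolding nrm by (simp add: sum_distrib_left)
  qed
  have dims: "dim E = card Bm" "dim F = card Bp"
    unfolding E_def F_def using independent_mono[OF ind, of Bm] independent_mono[OF ind, of Bp] Bsplit(1)
    by (auto simp: dim_eq_card_independent)
  have "card B = CARD('m)"
    using dim_span_eq_card_independent[OF ind] B(2) by (simp add: dim_UNIV)
  then have "dim E + dim F = CARD('m)"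
    unfolding dims using card_Un_disjoint[OF Bsplit(3,4,2)] Bsplit(1) by simp
  moreover have "num_neg_eigenvalues H = card Bm"
  proof -
    \<comment> \<open>By self-adjointness an eigenvector is orthogonal to the basis vectors of other
      eigenvalues. So each eigenspace is spanned by the basis vectors that it contains, and the sum
      of the dimensions counts \<open>Bm\<close>.\<close>
    have eig: "{v. H *v v = \<mu> *\<^sub>R v} = span {b \<in> B. ev b = \<mu>}" for \<mu>
    proof
      show "span {b \<in> B. ev b = \<mu>} \<subseteq> {v. H *v v = \<mu> *\<^sub>R v}"
      proof (rule span_minimal)
        show "subspace {v. H *v v = \<mu> *\<^sub>R v}"
          unfolding subspace_def using A by (auto simp: linear_0 linear_add linear_scale algebra_simps)
      qed (use ev in auto)
      show "{v. H *v v = \<mu> *\<^sub>R v} \<subseteq> span {b \<in> B. ev b = \<mu>}"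
      proof
        fix v assume "v \<in> {v. H *v v = \<mu> *\<^sub>R v}"
        then have v: "H *v v = \<mu> *\<^sub>R v" by simp
        have "v \<bullet> b = 0" if "b \<in> B" "ev b \<noteq> \<mu>" for b
        proof -
          have "\<mu> * (v \<bullet> b) = ev b * (v \<bullet> b)" using sa[of v b] v ev[OF that(1)] by simp
          then show ?thesis using that(2) by simp
        qed
        then have "v = (\<Sum>b | b \<in> B \<and> ev b = \<mu>. (v \<bullet> b) *\<^sub>R b)"
          by (subst expand[of v]) (rule sum.mono_neutral_right, use finB in auto)
        then show "v \<in> span {b \<in> B. ev b = \<mu>}"
          by (metis (no_types, lifting) span_base span_scale span_sum)
      qed
    qed
    have dimeig: "dim {v. H *v v = \<mu> *\<^sub>R v} = card {b \<in> B. ev b = \<mu>}" for \<mu>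
      unfolding eig by (intro dim_span_eq_card_independent independent_mono[OF ind]) auto
    have "{\<mu>. \<mu> < 0 \<and> (\<exists>v. v \<noteq> 0 \<and> H *v v = \<mu> *\<^sub>R v)} = ev ` Bm"
    proof (rule Set.set_eqI)
      fix \<mu>
      have "(\<exists>v. v \<noteq> 0 \<and> H *v v = \<mu> *\<^sub>R v) \<longleftrightarrow> \<not> {v. H *v v = \<mu> *\<^sub>R v} \<subseteq> {0}" by blast
      also have "\<dots> \<longleftrightarrow> dim {v. H *v v = \<mu> *\<^sub>R v} \<noteq> 0" by (simp only: dim_eq_0)
      also have "\<dots> \<longleftrightarrow> (\<exists>b\<in>B. ev b = \<mu>)" unfolding dimeig using finB by auto
      finally show "\<mu> \<in> {\<mu>. \<mu> < 0 \<and> (\<exists>v. v \<noteq> 0 \<and> H *v v = \<mu> *\<^sub>R v)} \<longleftrightarrow> \<mu> \<in> ev ` Bm"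
        by (auto simp: Bm_def)
    qed
    then have "num_neg_eigenvalues H = (\<Sum>\<mu>\<in>ev ` Bm. card {b \<in> B. ev b = \<mu>})"
      unfolding num_neg_eigenvalues_def dimeig by simp
    also have "\<dots> = (\<Sum>\<mu>\<in>ev ` Bm. \<Sum>b\<in>{b \<in> Bm. ev b = \<mu>}. 1)"
      by (intro sum.cong) (auto simp: Bm_def intro!: arg_cong[where f=card])
    also have "\<dots> = card Bm" by (subst sum.image_gen[OF Bsplit(3), symmetric, where g=ev]) simp
    finally show ?thesis .
  qed
  moreover have "P (x + y) = x \<and> Q (x + y) = y \<and> x \<bullet> y = 0" if "x \<in> E" "y \<in> F" for x y
    using Qx[OF that(1)] Py[OF that(2)] EF[OF that]
      linear_add[OF bounded_linear.linear[OF bl(1)]] linear_add[OF bounded_linear.linear[OF bl(2)]] by simp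
  moreover have "subspace E" "subspace F" by (simp_all add: E_def F_def)
  moreover have "0 < \<beta>" using be(1) by simp
  ultimately have "spectral_split H E F P Q \<alpha> \<beta> \<and> dim E = num_neg_eigenvalues H"
    unfolding spectral_split_def using dims al(1) PE PQ bl HE HF Eneg Fpos bound by simp
  then show ?thesis by blast
qed

section \<open>Nondegenerate Hessians\<close>

lemma has_real_derivative_along_curve:
  assumes "(g has_derivative G) (at (p s))" "(p has_vector_derivative p') (at s)"
  shows "((\<lambda>s. g (p s)) has_real_derivative G p') (at s)"
proof -
  have "((\<lambda>s. g (p s)) has_derivative (\<lambda>h. G (h *\<^sub>R p'))) (at s)"
    using has_derivative_compose[OF assms(2)[unfolded has_vector_derivative_def] assms(1)] .
  moreover have "G (h *\<^sub>R p') = G p' * h" for h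
    using has_derivative_linear[OF assms(1)] by (simp add: linear_scale)
  ultimately show ?thesis by (simp add: has_field_derivative_def)
qed

lemma has_derivative_small_error:
  assumes "(f has_derivative D) (at u)" "e > 0"
  obtains d where "d > 0" "\<And>z. norm z < d \<Longrightarrow> norm (f (u + z) - f u - D z) \<le> e * norm z"
proof -
  obtain d where d: "d > 0" "\<And>y. norm (y - u) < d \<Longrightarrow> norm (f y - f u - D (y - u)) \<le> e * norm (y - u)"
    using assms unfolding has_derivative_at_alt by blast
  have "norm (f (u + z) - f u - D z) \<le> e * norm z" if "norm z < d" for z
    using d(2)[of "u + z"] that by simp
  then show ?thesis using that d(1) by blast
qed

text \<open>The mean value theorem for \<open>g (u + t v + s w) - g (u + s w)\<close> as a function
  of \<open>s\<close> gives a difference of derivatives in direction \<open>w\<close> at two points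
  that are \<open>t v\<close> apart. Differentiability of this derivative at the single point
  \<open>u\<close> then suffices.\<close>

lemma second_difference_approx:
  fixes g :: "'a::euclidean_space \<Rightarrow> real"
  assumes U: "open U" "u \<in> U" and d1: "\<And>y. y \<in> U \<Longrightarrow> (g has_derivative G y) (at y)"
    and d2: "((\<lambda>y. G y w) has_derivative D) (at u)" and e: "e > 0"
  obtains d where "d > 0" "\<And>t. 0 < t \<Longrightarrow> t < d \<Longrightarrow>
    \<bar>g (u + t *\<^sub>R v + t *\<^sub>R w) - g (u + t *\<^sub>R v) - g (u + t *\<^sub>R w) + g u - t\<^sup>2 * D v\<bar> \<le> e * t\<^sup>2"
proof -
  \<comment> \<open>Chosen so that the distances of the two points from \<open>u\<close> add up to
    at most \<open>t * C\<close>; the summand 1 makes \<open>C\<close> positive.\<close>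
  define C where "C = norm v + 2 * norm w + 1"
  have C: "C > 0" by (simp add: C_def add_nonneg_pos)
  obtain d1' where d1': "d1' > 0" "ball u d1' \<subseteq> U" using U open_contains_ball by blast
  obtain d2' where d2': "d2' > 0" "\<And>z. norm z < d2' \<Longrightarrow> norm (G (u + z) w - G u w - D z) \<le> e / C * norm z"
    using has_derivative_small_error[OF d2, of "e / C"] e C by auto
  define d where "d = min d1' d2' / C"
  have dpos: "d > 0" using d1' d2' C by (simp add: d_def)
  have "\<bar>g (u + t *\<^sub>R v + t *\<^sub>R w) - g (u + t *\<^sub>R v) - g (u + t *\<^sub>R w) + g u - t\<^sup>2 * D v\<bar> \<le> e * t\<^sup>2"
    if t: "0 < t" "t < d" for t
  proof -
    have small: "norm (c *\<^sub>R v + s *\<^sub>R w) < min d1' d2'" if "0 \<le> s" "s \<le> t" "0 \<le> c" "c \<le> t" for s c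
    proof -
      have "norm (c *\<^sub>R v + s *\<^sub>R w) \<le> c * norm v + s * norm w"
        using that by (metis abs_of_nonneg norm_scaleR norm_triangle_ineq)
      also have "\<dots> \<le> t * norm v + t * norm w" using that by (intro add_mono mult_right_mono) auto
      also have "\<dots> \<le> t * C" using t by (simp add: C_def algebra_simps)
      also have "\<dots> < d * C" using t C by simp
      finally show ?thesis using C by (simp add: d_def)
    qed
    define k where "k = (\<lambda>s. g (u + t *\<^sub>R v + s *\<^sub>R w) - g (u + s *\<^sub>R w))"
    have kd: "(k has_real_derivative (G (u + t *\<^sub>R v + s *\<^sub>R w) w - G (u + s *\<^sub>R w) w)) (at s)" if "0 \<le> s" "s \<le> t" for s
    proof -
      have "u + t *\<^sub>R v + s *\<^sub>R w \<in> U" "u + s *\<^sub>R w \<in> U"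
        using small[OF that, of t] small[OF that, of 0] t d1'(2) by (auto simp: subset_iff dist_norm add.assoc norm_minus_commute)
      then show ?thesis unfolding k_def
        by (intro DERIV_diff has_real_derivative_along_curve[where p="\<lambda>s. u + t *\<^sub>R v + s *\<^sub>R w"]
            has_real_derivative_along_curve[where p="\<lambda>s. u + s *\<^sub>R w"] d1)
          (auto intro!: derivative_eq_intros)
    qed
    obtain \<xi> where xi: "0 < \<xi>" "\<xi> < t"
      "k t - k 0 = (t - 0) * (G (u + t *\<^sub>R v + \<xi> *\<^sub>R w) w - G (u + \<xi> *\<^sub>R w) w)"
      using MVT2[OF t(1), of k, OF kd] by blast
    have lin: "linear D" using d2 by (rule has_derivative_linear)
    have a: "\<bar>G (u + (t *\<^sub>R v + \<xi> *\<^sub>R w)) w - G u w - D (t *\<^sub>R v + \<xi> *\<^sub>R w)\<bar> \<le> e / C * norm (t *\<^sub>R v + \<xi> *\<^sub>R w)"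
      using d2'(2)[of "t *\<^sub>R v + \<xi> *\<^sub>R w"] small[of \<xi> t] xi t by simp
    have b: "\<bar>G (u + \<xi> *\<^sub>R w) w - G u w - D (\<xi> *\<^sub>R w)\<bar> \<le> e / C * norm (\<xi> *\<^sub>R w)"
      using d2'(2)[of "\<xi> *\<^sub>R w"] small[of \<xi> 0] xi t by simp
    have "norm (t *\<^sub>R v + \<xi> *\<^sub>R w) + norm (\<xi> *\<^sub>R w) \<le> t * C"
    proof -
      have "norm (t *\<^sub>R v + \<xi> *\<^sub>R w) \<le> t * norm v + \<xi> * norm w"
        using xi t by (metis abs_of_nonneg less_imp_le norm_scaleR norm_triangle_ineq)
      moreover have "\<xi> * norm w \<le> t * norm w" using xi by (intro mult_right_mono) auto
      moreover have "norm (\<xi> *\<^sub>R w) = \<xi> * norm w" using xi by simp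
      moreover have "t * C = t * norm v + 2 * (t * norm w) + t" by (simp add: C_def algebra_simps)
      ultimately show ?thesis using t by linarith
    qed
    then have "e / C * (norm (t *\<^sub>R v + \<xi> *\<^sub>R w) + norm (\<xi> *\<^sub>R w)) \<le> e / C * (t * C)"
      using e C by (intro mult_left_mono) auto
    then have c: "e / C * norm (t *\<^sub>R v + \<xi> *\<^sub>R w) + e / C * norm (\<xi> *\<^sub>R w) \<le> e * t"
      using C by (simp add: distrib_left)
    have dd: "D (t *\<^sub>R v + \<xi> *\<^sub>R w) - D (\<xi> *\<^sub>R w) = t * D v"
      using lin by (simp add: linear_add linear_scale)
    have "\<bar>(G (u + t *\<^sub>R v + \<xi> *\<^sub>R w) w - G (u + \<xi> *\<^sub>R w) w) - t * D v\<bar> \<le> e * t"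
      using a b c dd unfolding add.assoc by linarith
    then have "\<bar>t * ((G (u + t *\<^sub>R v + \<xi> *\<^sub>R w) w - G (u + \<xi> *\<^sub>R w) w) - t * D v)\<bar> \<le> t * (e * t)"
      unfolding abs_mult using t by (simp add: mult_left_mono)
    moreover have "g (u + t *\<^sub>R v + t *\<^sub>R w) - g (u + t *\<^sub>R v) - g (u + t *\<^sub>R w) + g u = k t - k 0"
      by (simp add: k_def)
    ultimately show ?thesis unfolding xi(3) by (simp add: power2_eq_square algebra_simps)
  qed
  then show ?thesis using that dpos by blast
qed

text \<open>The second difference is symmetric in \<open>v\<close> and \<open>w\<close> and
  approximates both sides up to an arbitrarily small multiple of \<open>t\<^sup>2\<close>.\<close>

lemma second_derivative_symmetric:
  fixes g :: "'a::euclidean_space \<Rightarrow> real"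
  assumes U: "open U" "u \<in> U" and d1: "\<And>y. y \<in> U \<Longrightarrow> (g has_derivative G y) (at y)"
    and d2: "\<And>w. ((\<lambda>y. G y w) has_derivative D w) (at u)"
  shows "D w v = D v w"
proof -
  have "\<bar>D w v - D v w\<bar> \<le> 0 + e" if e: "e > 0" for e
  proof -
    obtain a where a: "a > 0" "\<And>t. 0 < t \<Longrightarrow> t < a \<Longrightarrow>
      \<bar>g (u + t *\<^sub>R v + t *\<^sub>R w) - g (u + t *\<^sub>R v) - g (u + t *\<^sub>R w) + g u - t\<^sup>2 * D w v\<bar> \<le> e / 2 * t\<^sup>2"
      using second_difference_approx[OF U d1 d2[of w], of "e / 2" v] e by auto
    obtain b where b: "b > 0" "\<And>t. 0 < t \<Longrightarrow> t < b \<Longrightarrow>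
      \<bar>g (u + t *\<^sub>R w + t *\<^sub>R v) - g (u + t *\<^sub>R w) - g (u + t *\<^sub>R v) + g u - t\<^sup>2 * D v w\<bar> \<le> e / 2 * t\<^sup>2"
      using second_difference_approx[OF U d1 d2[of v], of "e / 2" w] e by auto
    define t where "t = min a b / 2"
    have t: "0 < t" "t < a" "t < b" using a(1) b(1) by (auto simp: t_def)
    have sw: "u + t *\<^sub>R w + t *\<^sub>R v = u + t *\<^sub>R v + t *\<^sub>R w" by (simp add: add_ac)
    have "\<bar>t\<^sup>2 * D w v - t\<^sup>2 * D v w\<bar> \<le> e * t\<^sup>2"
      using a(2)[OF t(1,2)] b(2)[OF t(1,3)] unfolding sw by linarith
    moreover have "\<bar>t\<^sup>2 * D w v - t\<^sup>2 * D v w\<bar> = t\<^sup>2 * \<bar>D w v - D v w\<bar>"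
      by (simp only: right_diff_distrib[symmetric] abs_mult abs_power2)
    ultimately have "t\<^sup>2 * \<bar>D w v - D v w\<bar> \<le> t\<^sup>2 * e" by (simp add: mult.commute)
    then show ?thesis using t by simp
  qed
  then show ?thesis using field_le_epsilon[of "\<bar>D w v - D v w\<bar>" 0] by auto
qed

text \<open>\<open>C_k_on\<close> provides second derivatives one direction at a time. Expanding
  \<open>w\<close> in the basis, with error \<open>e / n\<close> for each of the \<open>n\<close>
  basis vectors, gives an estimate uniform in \<open>w\<close>.\<close>

lemma derivative_linear_approx:
  fixes G :: "'a::euclidean_space \<Rightarrow> 'a \<Rightarrow> real"
  assumes U: "open U" "u \<in> U" and lin: "\<And>y. y \<in> U \<Longrightarrow> linear (G y)"
    and d2: "\<And>w. ((\<lambda>y. G y w) has_derivative D w) (at u)" and e: "e > 0"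
  shows "\<exists>d>0. ball u d \<subseteq> U \<and>
    (\<forall>z w. norm z < d \<longrightarrow> \<bar>G (u + z) w - G u w - (\<Sum>j\<in>Basis. (w \<bullet> j) * D j z)\<bar> \<le> e * norm z * norm w)"
proof -
  define n where "n = real (DIM('a))"
  have n: "n > 0" by (simp add: n_def)
  obtain d0 where d0: "d0 > 0" "ball u d0 \<subseteq> U" using U open_contains_ball by blast
  have "\<exists>d>0. \<forall>z. norm z < d \<longrightarrow> \<bar>G (u + z) j - G u j - D j z\<bar> \<le> e / n * norm z" for j
    using has_derivative_small_error[OF d2[of j], of "e / n"] e n by (metis divide_pos_pos real_norm_def)
  then obtain \<delta> where \<delta>: "\<And>j. \<delta> j > 0" "\<And>j z. norm z < \<delta> j \<Longrightarrow> \<bar>G (u + z) j - G u j - D j z\<bar> \<le> e / n * norm z"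
    by metis
  define d where "d = min d0 (Min (\<delta> ` Basis))"
  have d: "d > 0" "d \<le> d0" "\<And>j. j \<in> Basis \<Longrightarrow> d \<le> \<delta> j"
    using d0 \<delta>(1) by (auto simp: d_def min_le_iff_disj)
  have "\<bar>G (u + z) w - G u w - (\<Sum>j\<in>Basis. (w \<bullet> j) * D j z)\<bar> \<le> e * norm z * norm w" if z: "norm z < d" for z w
  proof -
    have "u + z \<in> U" using z d0 d by (auto simp: subset_iff dist_norm)
    have ex: "G y w = (\<Sum>j\<in>Basis. (w \<bullet> j) * G y j)" if "y \<in> U" for y
      using linear_sum[OF lin[OF that], of "\<lambda>j. (w \<bullet> j) *\<^sub>R j" Basis] linear_scale[OF lin[OF that]]
      by (simp add: euclidean_representation)
    have "G (u + z) w - G u w - (\<Sum>j\<in>Basis. (w \<bullet> j) * D j z) = (\<Sum>j\<in>Basis. (w \<bullet> j) * (G (u + z) j - G u j - D j z))"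
      unfolding ex[OF U(2)] ex[OF \<open>u + z \<in> U\<close>] by (simp add: sum_subtractf right_diff_distrib)
    also have "\<bar>\<dots>\<bar> \<le> (\<Sum>j\<in>(Basis::'a set). norm w * (e / n * norm z))"
    proof (rule order_trans[OF sum_abs], rule sum_mono)
      fix j :: 'a assume j: "j \<in> Basis"
      show "\<bar>(w \<bullet> j) * (G (u + z) j - G u j - D j z)\<bar> \<le> norm w * (e / n * norm z)"
        unfolding abs_mult using j z d(3)[OF j] \<delta>(2)[of z j] Basis_le_norm[OF j, of w]
        by (intro mult_mono) auto
    qed
    also have "\<dots> = e * norm z * norm w" using n by (simp add: n_def)
    finally show ?thesis .
  qed
  moreover have "ball u d \<subseteq> U" using d(2) d0(2) by (auto simp: subset_iff)
  ultimately show ?thesis using d(1) by blast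
qed

text \<open>All is derived from one estimate, \<open>est\<close>: the derivative at
  \<open>u + z\<close> in direction \<open>w\<close> is \<open>z \<bullet> (H *v w)\<close> up to a
  small multiple of \<open>norm z * norm w\<close>. Along segments it yields the quadratic bounds.
  In the reflected direction \<open>x - y\<close> it makes the derivative at
  \<open>u + (x + y)\<close> negative, which gives descent along hyperbolas and shows that
  \<open>u\<close> is an isolated zero of the derivative.\<close>

lemma morse_index_from_coordinates:
  fixes \<phi> :: "real ^ 'm \<Rightarrow> 'a::euclidean_space" and H :: "real ^ 'm ^ 'm"
  assumes U: "open U" "u \<in> U" and hom: "homeomorphism U (\<phi> ` U) \<phi> \<psi>" and op: "openin (top_of_set S) (\<phi> ` U)"
    and d1: "\<And>y. y \<in> U \<Longrightarrow> ((f \<circ> \<phi>) has_derivative G y) (at y)"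
    and d2: "\<And>w. ((\<lambda>y. G y w) has_derivative D w) (at u)"
    and crit: "G u = (\<lambda>_. 0)"
    and H: "\<And>i j. H $ i $ j = D (axis j 1) (axis i 1)" "invertible H"
  shows "morse_index TYPE(real ^ 'm) f S (\<phi> u) (num_neg_eigenvalues H)"
    and "\<exists>d>0. \<forall>z. z \<noteq> 0 \<and> norm z < d \<longrightarrow> u + z \<in> U \<and> G (u + z) \<noteq> (\<lambda>_. 0)"
proof -
  have "transpose H = H"
    using second_derivative_symmetric[OF U d1 d2] H(1) by (simp add: transpose_def vec_eq_iff)
  then obtain E F :: "(real ^ 'm) set" and P Q \<alpha> \<beta>
    where sp: "spectral_split H E F P Q \<alpha> \<beta>" "dim E = num_neg_eigenvalues H"
    using spectral_splitting[OF _ H(2)] by blast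
  have EF: "subspace E" "subspace F" "dim E = num_neg_eigenvalues H" "dim E + dim F = CARD('m)"
    and PQ: "bounded_linear P" "bounded_linear Q" "\<And>z. P z \<in> E" "\<And>z. Q z \<in> F" "\<And>z. P z + Q z = z"
    "\<And>x y. x \<in> E \<Longrightarrow> y \<in> F \<Longrightarrow> P (x + y) = x \<and> Q (x + y) = y"
    and orth: "\<And>x y. x \<in> E \<Longrightarrow> y \<in> F \<Longrightarrow> x \<bullet> y = 0"
    and HEF: "\<And>x. x \<in> E \<Longrightarrow> H *v x \<in> E" "\<And>y. y \<in> F \<Longrightarrow> H *v y \<in> F"
    and al: "0 < \<alpha>" "\<And>x. x \<in> E \<Longrightarrow> x \<bullet> (H *v x) \<le> - \<alpha> * (norm x)\<^sup>2" "\<And>y. y \<in> F \<Longrightarrow> \<alpha> * (norm y)\<^sup>2 \<le> y \<bullet> (H *v y)"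
    and be: "0 < \<beta>" "\<And>x. \<bar>x \<bullet> (H *v x)\<bar> \<le> \<beta> * (norm x)\<^sup>2"
    using sp unfolding spectral_split_def by simp_all
  \<comment> \<open>A quarter leaves definite signs on both occasions:
    \<open>\<alpha> / 2 - \<alpha> / 4\<close> in the bounds for the values and
    \<open>\<alpha> - \<alpha> / 4\<close> in the descent.\<close>
  have "\<alpha> / 4 > 0" using al(1) by simp
  from derivative_linear_approx[OF U has_derivative_linear[OF d1] d2 this]
  obtain d where d: "d > 0" "ball u d \<subseteq> U"
    "\<And>z w. norm z < d \<Longrightarrow> \<bar>G (u + z) w - G u w - (\<Sum>j\<in>Basis. (w \<bullet> j) * D j z)\<bar> \<le> \<alpha> / 4 * norm z * norm w"
    by blast
  have bil: "(\<Sum>j\<in>Basis. (w \<bullet> j) * D j z) = z \<bullet> (H *v w)" for w z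
  proof -
    have Dz: "D j z = (\<Sum>i\<in>UNIV. z $ i * D j (axis i 1))" for j
    proof -
      have lin: "linear (D j)" using d2 by (rule has_derivative_linear)
      have "z = (\<Sum>i\<in>UNIV. z $ i *\<^sub>R axis i 1)"
        using basis_expansion[of z] by (simp add: scalar_mult_eq_scaleR)
      then have "D j z = D j (\<Sum>i\<in>UNIV. z $ i *\<^sub>R axis i 1)" by simp
      then show ?thesis using lin by (simp add: linear_sum linear_scale)
    qed
    have "(\<Sum>j\<in>Basis. (w \<bullet> j) * D j z) = (\<Sum>j\<in>UNIV. w $ j * D (axis j 1) z)"
      by (simp add: Basis_vec_def sum.UNION_disjoint axis_eq_axis inner_axis sum.reindex inj_on_def image_def[symmetric] UNION_singleton_eq_range)
    also have "\<dots> = (\<Sum>j\<in>UNIV. \<Sum>i\<in>UNIV. w $ j * (z $ i * H $ i $ j))"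
      by (simp add: Dz H(1) sum_distrib_left)
    also have "\<dots> = z \<bullet> (H *v w)"
      by (subst sum.swap) (simp add: inner_vec_def matrix_vector_mult_def sum_distrib_left ac_simps)
    finally show ?thesis .
  qed
  have est: "\<bar>G (u + z) w - z \<bullet> (H *v w)\<bar> \<le> \<alpha> / 4 * norm z * norm w" if "norm z < d" for z w
    using d(3)[OF that, of w] unfolding bil crit by simp
  have inU: "u + z \<in> U" if "norm z < d" for z using d(2) that by (auto simp: subset_iff dist_norm)
  have val: "\<bar>(f \<circ> \<phi>) (u + z) - (f \<circ> \<phi>) u - z \<bullet> (H *v z) / 2\<bar> \<le> \<alpha> / 4 * (norm z)\<^sup>2" if z: "norm z < d" for z
  proof -
    define k where "k = (\<lambda>s. (f \<circ> \<phi>) (u + s *\<^sub>R z) - s\<^sup>2 / 2 * (z \<bullet> (H *v z)))"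
    have sz: "norm (s *\<^sub>R z) < d" if "0 \<le> s" "s \<le> 1" for s
    proof -
      have "s * norm z \<le> 1 * norm z" using that by (intro mult_right_mono) auto
      then show ?thesis using z that by simp
    qed
    have kd: "(k has_real_derivative (G (u + s *\<^sub>R z) z - s * (z \<bullet> (H *v z)))) (at s)" if "0 \<le> s" "s \<le> 1" for s
      unfolding k_def
      by (intro DERIV_diff has_real_derivative_along_curve[where p="\<lambda>s. u + s *\<^sub>R z"] d1 inU sz that)
        (auto intro!: derivative_eq_intros)
    obtain \<xi> where xi: "0 < \<xi>" "\<xi> < 1" "k 1 - k 0 = (1 - 0) * (G (u + \<xi> *\<^sub>R z) z - \<xi> * (z \<bullet> (H *v z)))"
      using MVT2[OF zero_less_one, of k, OF kd] by blast
    have "\<bar>G (u + \<xi> *\<^sub>R z) z - \<xi> * (z \<bullet> (H *v z))\<bar> \<le> \<alpha> / 4 * norm (\<xi> *\<^sub>R z) * norm z"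
      using est[OF sz[of \<xi>], of z] xi by simp
    also have "\<dots> = \<xi> * (\<alpha> / 4 * (norm z)\<^sup>2)" using xi by (simp add: power2_eq_square)
    also have "\<dots> \<le> 1 * (\<alpha> / 4 * (norm z)\<^sup>2)" using xi al by (intro mult_right_mono) auto
    finally have "\<bar>G (u + \<xi> *\<^sub>R z) z - \<xi> * (z \<bullet> (H *v z))\<bar> \<le> \<alpha> / 4 * (norm z)\<^sup>2" by simp
    moreover have "(f \<circ> \<phi>) (u + z) - (f \<circ> \<phi>) u - z \<bullet> (H *v z) / 2 = G (u + \<xi> *\<^sub>R z) z - \<xi> * (z \<bullet> (H *v z))"
      using xi(3) by (simp add: k_def)
    ultimately show ?thesis by simp
  qed
  have nrm: "(norm (x + y))\<^sup>2 = (norm x)\<^sup>2 + (norm y)\<^sup>2" "(norm (x - y))\<^sup>2 = (norm x)\<^sup>2 + (norm y)\<^sup>2" if "x \<in> E" "y \<in> F" for x y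
    using orth[OF that] unfolding power2_norm_eq_inner
    by (auto simp: inner_add_left inner_add_right inner_diff_left inner_diff_right inner_commute)
  have quad: "(x + y) \<bullet> (H *v (x + y)) = x \<bullet> (H *v x) + y \<bullet> (H *v y)"
    "(x + y) \<bullet> (H *v (x - y)) = x \<bullet> (H *v x) - y \<bullet> (H *v y)" if "x \<in> E" "y \<in> F" for x y
    using orth[OF that(1) HEF(2)[OF that(2)]] orth[OF HEF(1)[OF that(1)] that(2)]
    by (auto simp: matrix_vector_right_distrib matrix_vector_mult_diff_distrib inner_add_left inner_diff_right inner_add_right inner_commute)
  \<comment> \<open>Reflecting the \<open>F\<close> component preserves the norm by orthogonality
    and turns the quadratic form into a negative definite one.\<close>
  have desc: "G (u + (x + y)) (x - y) \<le> - (3 / 4) * \<alpha> * (norm (x + y))\<^sup>2" if "x \<in> E" "y \<in> F" "norm (x + y) < d" for x y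
  proof -
    have "norm (x - y) = norm (x + y)" using nrm[OF that(1,2)] by (metis norm_ge_zero power2_eq_imp_eq)
    then have "\<bar>G (u + (x + y)) (x - y) - (x \<bullet> (H *v x) - y \<bullet> (H *v y))\<bar> \<le> \<alpha> / 4 * (norm (x + y))\<^sup>2"
      using est[OF that(3), of "x - y"] quad(2)[OF that(1,2)] by (simp add: power2_eq_square mult.assoc)
    then show ?thesis using al(2)[OF that(1)] al(3)[OF that(2)] nrm(1)[OF that(1,2)] by (auto simp: algebra_simps)
  qed
  define r where "r = d / 2"
  have r: "r > 0" using d by (simp add: r_def)
  have sum_lt: "norm (x + y) < d" if "norm x < r" "norm y < r" for x y :: "real ^ 'm"
    using that norm_triangle_ineq[of x y] by (simp add: r_def)
  let ?B = "coord_box E F r"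
  define \<Phi> where "\<Phi> = (\<lambda>(x, y). \<phi> (u + (x + y)))"
  define \<Psi> where "\<Psi> = (\<lambda>q. (P (\<psi> q - u), Q (\<psi> q - u)))"
  \<comment> \<open>The open set of points with two short projections. As \<open>E\<close> and
    \<open>F\<close> are complementary, it is the image of the box under \<open>(x, y)\<close> to
    \<open>u + (x + y)\<close>.\<close>
  define O' where "O' = {v. norm (P (v - u)) < r \<and> norm (Q (v - u)) < r}"
  have contPQ: "continuous_on X (\<lambda>v. P (h v))" "continuous_on X (\<lambda>v. Q (h v))" if "continuous_on X h" for X :: "'z::topological_space set" and h
    using bounded_linear.continuous_on[OF PQ(1) that] bounded_linear.continuous_on[OF PQ(2) that] by auto
  have "open O'" unfolding O'_def
    by (intro open_Collect_conj open_Collect_less continuous_intros contPQ)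
  have imB: "(\<lambda>(x, y). u + (x + y)) ` ?B = O'"
  proof (intro equalityI subsetI)
    fix v assume "v \<in> (\<lambda>(x, y). u + (x + y)) ` ?B"
    then show "v \<in> O'" using PQ(6) by (auto simp: O'_def coord_box_def)
  next
    fix v assume "v \<in> O'"
    then have "(P (v - u), Q (v - u)) \<in> ?B" using PQ(3,4) by (auto simp: O'_def coord_box_def)
    moreover have "v = u + (P (v - u) + Q (v - u))" using PQ(5)[of "v - u"] by simp
    ultimately show "v \<in> (\<lambda>(x, y). u + (x + y)) ` ?B" by (metis (no_types, lifting) image_eqI case_prod_conv)
  qed
  have "O' \<subseteq> U"
    unfolding imB[symmetric] using inU sum_lt by (auto simp: coord_box_def)
  have im: "\<Phi> ` ?B = \<phi> ` O'"
    unfolding imB[symmetric] \<Phi>_def by (simp add: image_comp o_def case_prod_unfold)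
  have "openin (top_of_set U) O'" using \<open>open O'\<close> \<open>O' \<subseteq> U\<close> by (metis Int_absorb1 openin_open_Int)
  then have "openin (top_of_set (\<phi> ` U)) (\<phi> ` O')" using homeomorphism_imp_open_map[OF hom] by blast
  then have opB: "openin (top_of_set S) (\<Phi> ` ?B)" unfolding im using op openin_trans by blast
  have BU: "u + (x + y) \<in> U" if "(x, y) \<in> ?B" for x y
    using that inU sum_lt by (auto simp: coord_box_def)
  have homB: "homeomorphism ?B (\<Phi> ` ?B) \<Phi> \<Psi>"
  proof (rule homeomorphismI)
    show "continuous_on ?B \<Phi>"
      unfolding \<Phi>_def case_prod_unfold
      by (rule continuous_on_compose2[OF homeomorphism_cont1[OF hom]]) (use BU in \<open>auto intro!: continuous_intros\<close>)
    show "continuous_on (\<Phi> ` ?B) \<Psi>"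
      unfolding \<Psi>_def
      by (intro continuous_intros contPQ continuous_on_subset[OF homeomorphism_cont2[OF hom]])
        (use im \<open>O' \<subseteq> U\<close> in auto)
    show inv: "\<Psi> (\<Phi> z) = z" if "z \<in> ?B" for z
      using that BU PQ(6) homeomorphism_apply1[OF hom]
      by (cases z) (auto simp: \<Phi>_def \<Psi>_def coord_box_def)
    then show "\<Psi> ` \<Phi> ` ?B \<subseteq> ?B" by auto
    show "\<Phi> (\<Psi> q) = q" if "q \<in> \<Phi> ` ?B" for q using that inv by auto
  qed auto
  have "morse_chart f S (\<phi> u) E F"
    unfolding morse_chart_def
  proof (intro conjI exI allI impI)
    \<comment> \<open>Half of the quadratic form, whose parts on \<open>E\<close> and
      \<open>F\<close> lie between \<open>\<alpha>\<close> and \<open>\<beta>\<close> in size,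
      changed by the error \<open>\<alpha> / 4\<close>.\<close>
    show "0 < r" "0 < \<alpha> / 4" "0 < \<beta> / 2 + \<alpha> / 4" using r al be by auto
    show "\<Phi> (0, 0) = \<phi> u" by (simp add: \<Phi>_def)
    show "homeomorphism ?B (\<Phi> ` ?B) \<Phi> \<Psi>" by (rule homB)
  next
    fix x y assume xy: "(x, y) \<in> ?B"
    then have xE: "x \<in> E" "y \<in> F" "norm (x + y) < d" using sum_lt by (auto simp: coord_box_def)
    have v1: "\<bar>(f \<circ> \<phi>) (u + (x + y)) - (f \<circ> \<phi>) u - (x \<bullet> (H *v x) + y \<bullet> (H *v y)) / 2\<bar>
        \<le> \<alpha> / 4 * (norm x)\<^sup>2 + \<alpha> / 4 * (norm y)\<^sup>2"
      using val[OF xE(3)] unfolding nrm(1)[OF xE(1,2)] quad(1)[OF xE(1,2)] distrib_left .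
    note v = abs_le_D1[OF v1] abs_le_D2[OF v1] al(2)[OF xE(1)] al(3)[OF xE(2)]
      abs_le_D1[OF be(2)[of x]] abs_le_D2[OF be(2)[of x]] abs_le_D1[OF be(2)[of y]] abs_le_D2[OF be(2)[of y]]
    have c: "\<alpha> / 4 * X = (\<alpha> * X) / 4" "\<beta> / 2 * X = (\<beta> * X) / 2" "- \<alpha> * X = - (\<alpha> * X)" for X
      by simp_all
    have e: "f (\<Phi> (x, y)) = (f \<circ> \<phi>) (u + (x + y))" "f (\<phi> u) = (f \<circ> \<phi>) u" by (auto simp: \<Phi>_def)
    have lo: "c - (b1 / 2 + a1 / 4) + a2 / 4 \<le> V" if "- (V - c - (A + B) / 2) \<le> a1 / 4 + a2 / 4" "a2 \<le> B" "- A \<le> b1"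
      for V c A B a1 a2 b1 :: real using that by (simp add: field_simps)
    have up: "V \<le> c - a1 / 4 + (b2 / 2 + a2 / 4)" if "V - c - (A + B) / 2 \<le> a1 / 4 + a2 / 4" "A \<le> - a1" "B \<le> b2"
      for V c A B a1 a2 b2 :: real using that by (simp add: field_simps)
    show "f (\<phi> u) - (\<beta> / 2 + \<alpha> / 4) * (norm x)\<^sup>2 + \<alpha> / 4 * (norm y)\<^sup>2 \<le> f (\<Phi> (x, y))"
      unfolding e distrib_right c by (rule lo[OF v(2)[unfolded c] v(4,6)])
    show "f (\<Phi> (x, y)) \<le> f (\<phi> u) - \<alpha> / 4 * (norm x)\<^sup>2 + (\<beta> / 2 + \<alpha> / 4) * (norm y)\<^sup>2"
      unfolding e distrib_right c by (rule up[OF v(1)[unfolded c] v(3)[unfolded c] v(7)])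
  next
    fix x y \<mu> assume A: "(x, y) \<in> ?B \<and> 1 \<le> \<mu> \<and> norm (\<mu> *\<^sub>R x) < r"
    then have xE: "x \<in> E" "y \<in> F" by (auto simp: coord_box_def)
    \<comment> \<open>The velocity of the hyperbola is \<open>1 / s\<close> times the reflected
      position vector, so \<open>desc\<close> applies at every \<open>s\<close>.\<close>
    define p where "p = (\<lambda>s. u + (s *\<^sub>R x + (1 / s) *\<^sub>R y))"
    have "f (\<phi> (p \<mu>)) \<le> f (\<phi> (p 1))"
    proof (rule DERIV_nonpos_imp_nonincreasing[of 1 \<mu> "\<lambda>s. f (\<phi> (p s))"])
      fix s assume s: "1 \<le> s" "s \<le> \<mu>"
      have "norm (s *\<^sub>R x) \<le> norm (\<mu> *\<^sub>R x)" using s by (simp add: mult_right_mono)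
      moreover have "norm ((1 / s) *\<^sub>R y) \<le> norm y" using s by (simp add: mult_left_le_one_le divide_le_eq mult_le_cancel_left1)
      ultimately have lt: "norm (s *\<^sub>R x + (1 / s) *\<^sub>R y) < d" using A by (intro sum_lt) (auto simp: coord_box_def)
      have pd: "(p has_vector_derivative (1 / s) *\<^sub>R (s *\<^sub>R x - (1 / s) *\<^sub>R y)) (at s)"
        unfolding p_def using s
        by (auto intro!: derivative_eq_intros simp: scaleR_diff_right divide_simps)
      have "((\<lambda>s. (f \<circ> \<phi>) (p s)) has_real_derivative G (p s) ((1 / s) *\<^sub>R (s *\<^sub>R x - (1 / s) *\<^sub>R y))) (at s)"
        by (rule has_real_derivative_along_curve[OF d1 pd]) (simp add: p_def inU[OF lt])
      moreover have "G (p s) ((1 / s) *\<^sub>R (s *\<^sub>R x - (1 / s) *\<^sub>R y)) = (1 / s) * G (p s) (s *\<^sub>R x - (1 / s) *\<^sub>R y)"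
        using has_derivative_linear[OF d1[OF inU[OF lt]]] by (simp add: p_def linear_scale)
      moreover have "G (p s) (s *\<^sub>R x - (1 / s) *\<^sub>R y) \<le> 0"
      proof -
        have "0 \<le> (3 / 4) * \<alpha> * (norm (s *\<^sub>R x + (1 / s) *\<^sub>R y))\<^sup>2" using al by simp
        then show ?thesis
          unfolding p_def using desc[of "s *\<^sub>R x" "(1 / s) *\<^sub>R y"] xE EF lt by (simp add: subspace_scale)
      qed
      ultimately show "\<exists>l. ((\<lambda>s. f (\<phi> (p s))) has_real_derivative l) (at s) \<and> l \<le> 0"
        using s by (auto simp: o_def intro!: exI[of _ "G (p s) (s *\<^sub>R x - (1 / s) *\<^sub>R y) / s"] divide_nonpos_pos)
    qed (use A in auto)
    then show "f (\<Phi> (\<mu> *\<^sub>R x, (1 / \<mu>) *\<^sub>R y)) \<le> f (\<Phi> (x, y))" by (simp add: p_def \<Phi>_def)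
  qed (use EF opB in auto)
  then show "morse_index TYPE(real ^ 'm) f S (\<phi> u) (num_neg_eigenvalues H)"
    unfolding morse_index_def using EF(3,4) by (intro exI[of _ E] exI[of _ F]) simp
  show "\<exists>d>0. \<forall>z. z \<noteq> 0 \<and> norm z < d \<longrightarrow> u + z \<in> U \<and> G (u + z) \<noteq> (\<lambda>_. 0)"
  proof (intro exI[of _ d] conjI allI impI d(1))
    fix z :: "real ^ 'm" assume z: "z \<noteq> 0 \<and> norm z < d"
    then show "u + z \<in> U" using inU by blast
    have "0 < (3 / 4) * \<alpha> * (norm z)\<^sup>2" using al z by simp
    then have "G (u + z) (P z - Q z) < 0" using desc[OF PQ(3,4), of z z] z unfolding PQ(5) by linarith
    then show "G (u + z) \<noteq> (\<lambda>_. 0)" by auto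
  qed
qed

section \<open>Smooth functions and stereographic coordinates\<close>

text \<open>Openness of \<open>U\<close> matters: derivatives at points of \<open>U\<close> then see
  only the values on \<open>U\<close>.\<close>

lemma C_k_on_cong:
  assumes "open U" "\<And>x. x \<in> U \<Longrightarrow> f x = g x"
  shows "C_k_on k f U = C_k_on k g U"
  using assms(2)
proof (induction k arbitrary: f g)
  case 0
  then show ?case by (auto intro: continuous_on_cong[THEN iffD1])
next
  case (Suc k)
  have hd: "(f has_derivative D) (at x) \<longleftrightarrow> (g has_derivative D) (at x)" if "x \<in> U" for x D
    using has_derivative_transform_within_open[OF _ assms(1) that, of f D UNIV g]
      has_derivative_transform_within_open[OF _ assms(1) that, of g D UNIV f] Suc.prems by auto
  have "frechet_derivative f (at x) = frechet_derivative g (at x)" if "x \<in> U" for x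
    unfolding frechet_derivative_def using hd[OF that] by simp
  then have "C_k_on k (\<lambda>x. frechet_derivative f (at x) v) U = C_k_on k (\<lambda>x. frechet_derivative g (at x) v) U" for v
    by (intro Suc.IH) simp
  moreover have "f differentiable at x \<longleftrightarrow> g differentiable at x" if "x \<in> U" for x
    using hd[OF that] by (simp add: differentiable_def)
  ultimately show ?case by simp
qed

text \<open>Allows an explicit derivative in place of \<open>frechet_derivative\<close>; the closure
  properties below are inductions by means of it.\<close>

lemma C_k_on_SucI:
  assumes "open U" "\<And>x. x \<in> U \<Longrightarrow> (f has_derivative D x) (at x)" "\<And>v. C_k_on k (\<lambda>x. D x v) U"
  shows "C_k_on (Suc k) f U"
proof -
  have "frechet_derivative f (at x) = D x" if "x \<in> U" for x
    using frechet_derivative_at[OF assms(2)[OF that]] by simp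
  then have "C_k_on k (\<lambda>x. frechet_derivative f (at x) v) U = C_k_on k (\<lambda>x. D x v) U" for v
    by (intro C_k_on_cong assms(1)) simp
  then show ?thesis using assms by (auto simp: differentiable_def)
qed

lemma C_k_on_has_derivative:
  assumes "C_k_on (Suc k) f U" "x \<in> U"
  shows "(f has_derivative frechet_derivative f (at x)) (at x)"
  using assms frechet_derivative_works by auto

lemma C_k_on_Suc_imp: "C_k_on (Suc k) f U \<Longrightarrow> C_k_on k f U"
proof (induction k arbitrary: f)
  case 0
  then show ?case
    by (auto intro!: continuous_at_imp_continuous_on differentiable_imp_continuous_within)
next
  case (Suc k)
  then show ?case using C_k_on.simps(2) by blast
qed

lemma C_k_on_const: "open U \<Longrightarrow> C_k_on k (\<lambda>x. c) U"
proof (induction k arbitrary: c)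
  case (Suc k)
  show ?case by (rule C_k_on_SucI[OF Suc.prems, of _ "\<lambda>x v. 0"]) (auto intro!: Suc derivative_eq_intros)
qed simp

lemma C_k_on_add:
  assumes "open U" "C_k_on k f U" "C_k_on k g U"
  shows "C_k_on k (\<lambda>x. f x + g x) U"
  using assms(2,3)
proof (induction k arbitrary: f g)
  case 0
  then show ?case by (auto intro: continuous_intros)
next
  case (Suc k)
  show ?case
  proof (rule C_k_on_SucI[OF assms(1)])
    show "((\<lambda>x. f x + g x) has_derivative (\<lambda>v. frechet_derivative f (at x) v + frechet_derivative g (at x) v)) (at x)"
      if "x \<in> U" for x
      using Suc.prems that by (intro has_derivative_add C_k_on_has_derivative)
    show "C_k_on k (\<lambda>x. frechet_derivative f (at x) v + frechet_derivative g (at x) v) U" for v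
      using Suc.prems by (intro Suc.IH) auto
  qed
qed

lemma C_k_on_bounded_linear_compose:
  assumes "bounded_linear L" "open U" "C_k_on k f U"
  shows "C_k_on k (\<lambda>x. L (f x)) U"
  using assms(3)
proof (induction k arbitrary: f)
  case 0
  then show ?case using bounded_linear.continuous_on[OF assms(1)] by auto
next
  case (Suc k)
  show ?case
  proof (rule C_k_on_SucI[OF assms(2)])
    show "((\<lambda>x. L (f x)) has_derivative (\<lambda>v. L (frechet_derivative f (at x) v))) (at x)"
      if "x \<in> U" for x
      using Suc.prems that by (intro bounded_linear.has_derivative[OF assms(1)] C_k_on_has_derivative)
    show "C_k_on k (\<lambda>x. L (frechet_derivative f (at x) v)) U" for v
      using Suc.prems by (intro Suc.IH) auto
  qed
qed

lemma C_k_on_id: "open U \<Longrightarrow> C_k_on k (\<lambda>x. x) U"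
proof (cases k)
  case (Suc j)
  assume "open U"
  then show ?thesis unfolding Suc
    by (intro C_k_on_SucI[of U _ "\<lambda>x v. v"] C_k_on_const) (auto intro!: derivative_eq_intros)
qed simp

lemma C_k_on_bounded_linear: "bounded_linear L \<Longrightarrow> open U \<Longrightarrow> C_k_on k L U"
  using C_k_on_bounded_linear_compose[OF _ _ C_k_on_id, of L U k] by simp

text \<open>The product rule pairs one factor with a derivative of the other, so the induction also
  needs the undifferentiated factors in the lower class.\<close>

lemma C_k_on_bilinear:
  assumes h: "bounded_bilinear h" and "open U" "C_k_on k f U" "C_k_on k g U"
  shows "C_k_on k (\<lambda>x. h (f x) (g x)) U"
  using assms(3,4)
proof (induction k arbitrary: f g)
  case 0
  then show ?case using bounded_bilinear.continuous_on[OF h] by auto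
next
  case (Suc k)
  show ?case
  proof (rule C_k_on_SucI[OF assms(2)])
    show "((\<lambda>x. h (f x) (g x)) has_derivative
        (\<lambda>v. h (f x) (frechet_derivative g (at x) v) + h (frechet_derivative f (at x) v) (g x))) (at x)"
      if "x \<in> U" for x
      using Suc.prems that by (intro bounded_bilinear.FDERIV[OF h] C_k_on_has_derivative)
    show "C_k_on k (\<lambda>x. h (f x) (frechet_derivative g (at x) v) + h (frechet_derivative f (at x) v) (g x)) U" for v
      using Suc.prems C_k_on_Suc_imp[OF Suc.prems(1)] C_k_on_Suc_imp[OF Suc.prems(2)]
      by (intro C_k_on_add[OF assms(2)] Suc.IH) auto
  qed
qed

lemma C_k_on_inverse:
  fixes f :: "'a::euclidean_space \<Rightarrow> real"
  assumes "open U" "C_k_on k f U" "\<And>x. x \<in> U \<Longrightarrow> f x \<noteq> 0"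
  shows "C_k_on k (\<lambda>x. inverse (f x)) U"
  using assms(2)
proof (induction k)
  case 0
  then show ?case using assms(3) by (auto intro: continuous_on_inverse)
next
  case (Suc k)
  show ?case
  proof (rule C_k_on_SucI[OF assms(1)])
    show "((\<lambda>x. inverse (f x)) has_derivative
        (\<lambda>v. - (inverse (f x) * frechet_derivative f (at x) v * inverse (f x)))) (at x)" if "x \<in> U" for x
      using Suc.prems that assms(3) by (intro Deriv.has_derivative_inverse C_k_on_has_derivative) auto
    have I: "C_k_on k (\<lambda>x. inverse (f x)) U" using Suc C_k_on_Suc_imp by blast
    show "C_k_on k (\<lambda>x. - (inverse (f x) * frechet_derivative f (at x) v * inverse (f x))) U" for v
      using Suc.prems
      by (intro C_k_on_bounded_linear_compose[OF bounded_linear_minus[OF bounded_linear_ident]]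
          C_k_on_bilinear[OF bounded_bilinear_mult] assms(1) I) auto
  qed
qed

lemma C_k_on_sum:
  assumes "open U" "\<And>i. i \<in> I \<Longrightarrow> C_k_on k (f i) U"
  shows "C_k_on k (\<lambda>x. \<Sum>i\<in>I. f i x) U"
  using assms(2)
  by (induction I rule: infinite_finite_induct) (auto intro: C_k_on_const C_k_on_add assms(1))

lemma C_k_on_tensor_poly:
  assumes "open U" "C_k_on k \<phi> U"
  shows "C_k_on k (tensor_poly d T \<circ> \<phi>) U"
proof -
  have prod: "C_k_on k (\<lambda>x. \<Prod>i\<leftarrow>is. \<phi> x $ i) U" for "is"
  proof (induction "is")
    case Nil
    then show ?case using assms by (simp add: C_k_on_const)
  next
    case (Cons i "is")
    then show ?case
      using assms by (auto intro!: C_k_on_bilinear[OF bounded_bilinear_mult]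
        C_k_on_bounded_linear_compose[OF bounded_linear_vec_nth])
  qed
  have "tensor_poly d T \<circ> \<phi> = (\<lambda>x. \<Sum>is | length is = d. T is * (\<Prod>i\<leftarrow>is. \<phi> x $ i))"
    by (auto simp: tensor_poly_def)
  then show ?thesis
    using assms by (auto intro!: C_k_on_sum C_k_on_bounded_linear_compose[OF bounded_linear_mult_right] prod)
qed

section \<open>Stereographic coordinates around a point of the sphere\<close>

lemma sphere_hyperplane_isometry:
  assumes dim: "CARD('n) = CARD('m) + 1" and p: "norm (p :: real ^ 'n) = 1"
  shows "\<exists>L :: real ^ 'm \<Rightarrow> real ^ 'n. linear L \<and> (\<forall>v. norm (L v) = norm v) \<and> range L = {y. p \<bullet> y = 0}"
proof -
  have "p \<noteq> 0" using p by auto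
  then have "dim {y. p \<bullet> y = 0} = dim (UNIV :: (real ^ 'm) set)"
    using dim by (simp add: dim_hyperplane dim_UNIV)
  from isometry_subspaces[OF subspace_UNIV subspace_hyperplane[of p] this[symmetric]]
  show ?thesis by (metis UNIV_I)
qed

text \<open>\<open>\<phi>\<close> is the inverse of stereographic projection from \<open>- p\<close>
  to the hyperplane orthogonal to \<open>p\<close>, which \<open>L\<close> identifies with the
  coordinate space. It is an immersion by the chain rule, because the explicit inverse
  \<open>\<psi>\<close> extends to a differentiable map near the image.\<close>

lemma exists_sphere_coords:
  assumes dim: "CARD('n) = CARD('m) + 1" and p: "norm (p :: real ^ 'n) = 1"
  obtains \<phi> :: "real ^ 'm \<Rightarrow> real ^ 'n" where "sphere_coords UNIV \<phi>" "\<phi> 0 = p"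
proof -
  obtain L :: "real ^ 'm \<Rightarrow> real ^ 'n" where L: "linear L" "\<And>v. norm (L v) = norm v" "range L = {y. p \<bullet> y = 0}"
    using sphere_hyperplane_isometry[OF dim p] by blast
  have pp: "p \<bullet> p = 1" using p by (simp add: dot_square_norm)
  have pL: "p \<bullet> L v = 0" "L v \<bullet> p = 0" for v using L(3) by (auto simp: inner_commute)
  have LL: "L v \<bullet> L w = v \<bullet> w" for v w
  proof -
    have "(norm (L (v + w)))\<^sup>2 = (norm (v + w))\<^sup>2" "(norm (L v))\<^sup>2 = (norm v)\<^sup>2" "(norm (L w))\<^sup>2 = (norm w)\<^sup>2" using L(2) by simp_all
    then show ?thesis unfolding power2_norm_eq_inner linear_add[OF L(1)]
      by (simp add: inner_add_left inner_add_right inner_commute)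
  qed
  define den where "den = (\<lambda>v :: real ^ 'm. 1 + v \<bullet> v)"
  have den: "den v > 0" "den v \<noteq> 0" for v
  proof -
    show "den v > 0" using inner_ge_zero[of v] by (simp add: den_def add_pos_nonneg)
    then show "den v \<noteq> 0" by simp
  qed
  define \<phi> where "\<phi> = (\<lambda>v. inverse (den v) *\<^sub>R (2 *\<^sub>R L v + (1 - v \<bullet> v) *\<^sub>R p))"
  \<comment> \<open>The adjoint of the isometry \<open>L\<close> inverts it and kills
    \<open>p\<close>, so it reads off the hyperplane component.\<close>
  define \<psi> where "\<psi> = (\<lambda>y :: real ^ 'n. inverse (1 + p \<bullet> y) *\<^sub>R adjoint L y)"
  have adjL: "adjoint L (L v) = v" for v
    by (rule vector_eq_rdot[THEN iffD1]) (simp add: adjoint_works[OF L(1)] LL inner_commute adjoint_clauses[OF L(1)])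
  have adjp: "adjoint L p = 0"
    by (rule vector_eq_rdot[THEN iffD1]) (simp add: adjoint_clauses[OF L(1)] pL)
  have linadj: "linear (adjoint L)" by (rule adjoint_linear[OF L(1)])
  then have bladj: "bounded_linear (adjoint L)" by (simp add: linear_conv_bounded_linear)
  have p\<phi>: "p \<bullet> \<phi> v = inverse (den v) * (1 - v \<bullet> v)" for v
    by (simp add: \<phi>_def inner_add_right pL pp)
  have p1: "1 + p \<bullet> \<phi> v = 2 * inverse (den v)" for v
    unfolding p\<phi> using den[of v] by (simp add: field_simps) (simp add: den_def)
  have \<psi>\<phi>: "\<psi> (\<phi> v) = v" for v
    unfolding \<psi>_def p1 using den[of v]
    by (simp add: \<phi>_def linear_add[OF linadj] linear_scale[OF linadj] adjL adjp)
  have norm\<phi>: "\<phi> v \<bullet> \<phi> v = 1" for v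
  proof -
    have "\<phi> v \<bullet> \<phi> v = (inverse (den v))\<^sup>2 * (4 * (v \<bullet> v) + (1 - v \<bullet> v)\<^sup>2)"
      by (simp add: \<phi>_def inner_add_left inner_add_right pL pp LL power2_eq_square algebra_simps)
    also have "4 * (v \<bullet> v) + (1 - v \<bullet> v)\<^sup>2 = (den v)\<^sup>2" by (simp add: den_def power2_eq_square algebra_simps)
    finally show ?thesis using den(2)[of v] by (simp flip: power_mult_distrib)
  qed
  have rng: "range \<phi> = sphere 0 1 - {- p}"
  proof (intro equalityI subsetI)
    fix y assume "y \<in> range \<phi>"
    then obtain v where v: "y = \<phi> v" by blast
    have "y \<noteq> - p"
    proof
      assume "y = - p"
      then have "1 + p \<bullet> \<phi> v = 0" using v pp by (metis add.right_inverse inner_minus_right)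
      then show False using p1[of v] den[of v] by simp
    qed
    then show "y \<in> sphere 0 1 - {- p}" using norm\<phi>[of v] v by (simp add: norm_eq_sqrt_inner)
  next
    fix y assume y: "y \<in> sphere 0 1 - {- p}"
    then have yy: "y \<bullet> y = 1" by (simp add: dot_square_norm)
    \<comment> \<open>Write \<open>y = L w + s p\<close>. The projection of \<open>y\<close> is then
      \<open>w / (1 + s)\<close>, and \<open>s = -1\<close> would force
      \<open>y = - p\<close>.\<close>
    define s where "s = p \<bullet> y"
    have "y - s *\<^sub>R p \<in> range L" unfolding L(3) by (simp add: inner_diff_right s_def pp)
    then obtain w where w: "L w = y - s *\<^sub>R p" by (metis rangeE)
    have ww: "w \<bullet> w = 1 - s\<^sup>2"
      unfolding LL[symmetric] w using yy pp
      by (simp add: inner_diff_left inner_diff_right s_def inner_commute power2_eq_square algebra_simps)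
    have s1: "1 + s \<noteq> 0"
    proof
      assume "1 + s = 0"
      then have "s = -1" by simp
      then have "w \<bullet> w = 0" using ww by simp
      then have "y = s *\<^sub>R p" using w L(1) by (simp add: linear_0)
      then show False using y \<open>s = -1\<close> by simp
    qed
    define v where "v = inverse (1 + s) *\<^sub>R w"
    have vv: "v \<bullet> v = (1 - s) / (1 + s)"
      unfolding v_def using s1 by (simp add: ww divide_simps) (simp add: power2_eq_square algebra_simps)
    have dv: "den v = 2 / (1 + s)" unfolding den_def vv using s1 by (simp add: field_simps)
    have "\<phi> v = ((1 + s) / 2) *\<^sub>R (2 *\<^sub>R inverse (1 + s) *\<^sub>R (y - s *\<^sub>R p) + (1 - (1 - s) / (1 + s)) *\<^sub>R p)"
      unfolding \<phi>_def dv vv by (simp add: v_def linear_scale[OF L(1)] w)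
    also have "1 - (1 - s) / (1 + s) = 2 * s / (1 + s)" using s1 by (simp add: field_simps)
    also have "((1 + s) / 2) *\<^sub>R (2 *\<^sub>R inverse (1 + s) *\<^sub>R (y - s *\<^sub>R p) + (2 * s / (1 + s)) *\<^sub>R p) = y"
      using s1 by (simp add: scaleR_add_right scaleR_diff_right)
    finally show "y \<in> range \<phi>" by (metis rangeI)
  qed
  have smooth: "C_k_on k \<phi> UNIV" for k
  proof -
    have q: "C_k_on k (\<lambda>v :: real ^ 'm. v \<bullet> v) UNIV"
      by (intro C_k_on_bilinear[OF bounded_bilinear_inner] C_k_on_id open_UNIV)
    have d: "C_k_on k den UNIV" unfolding den_def by (intro C_k_on_add C_k_on_const q open_UNIV)
    have i: "C_k_on k (\<lambda>v. inverse (den v)) UNIV" by (rule C_k_on_inverse[OF open_UNIV d den(2)])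
    have l: "C_k_on k (\<lambda>v. 2 *\<^sub>R L v) UNIV"
      using L(1) by (intro C_k_on_bounded_linear_compose[OF bounded_linear_scaleR_right] C_k_on_bounded_linear open_UNIV)
        (simp add: linear_linear)
    have "C_k_on k (\<lambda>v :: real ^ 'm. 1 + - (v \<bullet> v)) UNIV"
      by (intro C_k_on_add C_k_on_const C_k_on_bounded_linear_compose[OF bounded_linear_minus[OF bounded_linear_ident]] q open_UNIV)
    then have "C_k_on k (\<lambda>v :: real ^ 'm. (1 - v \<bullet> v) *\<^sub>R p) UNIV"
      by (intro C_k_on_bounded_linear_compose[OF bounded_linear_scaleR_left] open_UNIV) simp
    then show ?thesis
      unfolding \<phi>_def by (intro C_k_on_bilinear[OF bounded_bilinear_scaleR open_UNIV i] C_k_on_add[OF open_UNIV l])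
  qed
  have hd: "(\<phi> has_derivative frechet_derivative \<phi> (at v)) (at v)" for v
    using smooth[of 1] C_k_on_has_derivative[of 0 \<phi> UNIV v] by simp
  have cont\<phi>: "continuous_on UNIV \<phi>" using smooth[of 0] by simp
  have ne: "1 + p \<bullet> y \<noteq> 0" if "y \<in> range \<phi>" for y using that p1 den by auto
  have cont\<psi>: "continuous_on (range \<phi>) \<psi>"
    unfolding \<psi>_def by (intro continuous_intros bounded_linear.continuous_on[OF bladj]) (use ne in auto)
  have "homeomorphism UNIV (range \<phi>) \<phi> \<psi>"
    by (rule homeomorphismI) (use cont\<phi> cont\<psi> \<psi>\<phi> in auto)
  moreover have "openin (top_of_set (sphere 0 1)) (range \<phi>)"
    unfolding rng by (intro openin_delete openin_subtopology_self)
  moreover have "inj (frechet_derivative \<phi> (at v))" for v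
  proof -
    let ?D = "frechet_derivative \<phi> (at v)"
    have lin: "linear ?D" using hd has_derivative_linear by blast
    have "\<psi> differentiable (at (\<phi> v))"
      unfolding \<psi>_def using ne[of "\<phi> v"] bounded_linear_imp_differentiable[OF bladj]
      by (intro differentiable_scaleR differentiable_inverse differentiable_add differentiable_const
          differentiable_inner differentiable_ident) auto
    then obtain D' where D': "(\<psi> has_derivative D') (at (\<phi> v))" unfolding differentiable_def by blast
    have "((\<psi> \<circ> \<phi>) has_derivative (D' \<circ> ?D)) (at v)" by (rule diff_chain_at[OF hd D'])
    moreover have "\<psi> \<circ> \<phi> = (\<lambda>x. x)" using \<psi>\<phi> by auto
    ultimately have "D' \<circ> ?D = (\<lambda>x. x)" using has_derivative_unique has_derivative_ident by metis
    then show ?thesis by (metis comp_apply injI)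
  qed
  ultimately have "sphere_coords UNIV \<phi>"
    unfolding sphere_coords_def smooth_on_def using smooth by auto
  moreover have "\<phi> 0 = p" using linear_0[OF L(1)] by (simp add: \<phi>_def den_def)
  ultimately show ?thesis using that by blast
qed

section \<open>Descent on the sphere\<close>

text \<open>The curve \<open>\<gamma>\<close> below leaves \<open>x\<close> in the direction \<open>-G x\<close> and stays on the sphere by the rational
  parametrization of the circle. The factor \<open>\<theta>\<close> stops the motion where \<open>G\<close> is small, so that uniform
  continuity of the first derivative suffices.\<close>

lemma sphere_descent:
  fixes f :: "'a::euclidean_space \<Rightarrow> real" and grad :: "'a \<Rightarrow> 'a"
  assumes grad: "\<And>x. (f has_derivative (\<lambda>v. grad x \<bullet> v)) (at x)" and cont: "continuous_on UNIV grad"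
    and U: "open U" "{x \<in> sphere 0 1. grad x - (grad x \<bullet> x) *\<^sub>R x = 0} \<subseteq> U" and e: "e > 0"
  shows "descends f (sphere 0 1) U e"
proof -
  let ?S = "sphere 0 1 :: 'a set"
  define G where "G = (\<lambda>x. grad x - (grad x \<bullet> x) *\<^sub>R x)"
  define q where "q = (\<lambda>x. G x \<bullet> G x)"
  have q0: "q x \<ge> 0" for x by (simp add: q_def)
  have den: "1 + s\<^sup>2 * q x > 0" "1 + s\<^sup>2 * q x \<noteq> 0" for s x
  proof -
    have "0 \<le> s\<^sup>2 * q x" using q0 by simp
    then show "1 + s\<^sup>2 * q x > 0" by linarith
    then show "1 + s\<^sup>2 * q x \<noteq> 0" by linarith
  qed
  have contg: "continuous_on X (\<lambda>z. grad (h z))" if "continuous_on X h" for X :: "'z::topological_space set" and h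
    by (rule continuous_on_compose2[OF cont that]) auto
  have contG: "continuous_on X (\<lambda>z. G (h z))" if "continuous_on X h" for X :: "'z::topological_space set" and h
    unfolding G_def by (intro continuous_intros contg that)
  have contq: "continuous_on X (\<lambda>z. q (h z))" if "continuous_on X h" for X :: "'z::topological_space set" and h
    unfolding q_def by (intro continuous_intros contG that)
  have xx: "x \<bullet> x = 1" if "x \<in> ?S" for x :: 'a using that by (simp add: dot_square_norm)
  have xG: "x \<bullet> G x = 0" if "x \<in> ?S" for x
    using xx[OF that] by (simp add: G_def inner_diff_right inner_commute)
  have gG: "grad x \<bullet> G x = q x" if "x \<in> ?S" for x
  proof -
    have "grad x = G x + (grad x \<bullet> x) *\<^sub>R x" by (simp add: G_def)
    then have "grad x \<bullet> G x = (G x + (grad x \<bullet> x) *\<^sub>R x) \<bullet> G x" by simp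
    then show ?thesis using xG[OF that] by (simp add: q_def inner_add_left)
  qed
  \<comment> \<open>With \<open>q x\<close> the squared norm of \<open>G x\<close>, this is rotation
    in the plane of \<open>x\<close> and \<open>G x\<close> with \<open>s * norm (G x)\<close> as
    the tangent of half the angle. No division by \<open>norm (G x)\<close> occurs, so it is
    continuous where \<open>G\<close> vanishes.\<close>
  define \<gamma> where "\<gamma> = (\<lambda>s x. ((1 - s\<^sup>2 * q x) / (1 + s\<^sup>2 * q x)) *\<^sub>R x - (2 * s / (1 + s\<^sup>2 * q x)) *\<^sub>R G x)"
  define \<gamma>' where "\<gamma>' = (\<lambda>s x. (- 4 * s * q x / (1 + s\<^sup>2 * q x)\<^sup>2) *\<^sub>R x - (2 * (1 - s\<^sup>2 * q x) / (1 + s\<^sup>2 * q x)\<^sup>2) *\<^sub>R G x)"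
  have \<gamma>0: "\<gamma> 0 x = x" for x by (simp add: \<gamma>_def)
  have \<gamma>S: "\<gamma> s x \<in> ?S" if "x \<in> ?S" for s x
  proof -
    have "\<gamma> s x \<bullet> \<gamma> s x = ((1 - s\<^sup>2 * q x) / (1 + s\<^sup>2 * q x))\<^sup>2 + (2 * s / (1 + s\<^sup>2 * q x))\<^sup>2 * q x"
      using xx[OF that] xG[OF that]
      by (simp add: \<gamma>_def inner_diff_left inner_diff_right q_def inner_commute power2_eq_square)
    also have "\<dots> = ((1 - s\<^sup>2 * q x)\<^sup>2 + (2 * s)\<^sup>2 * q x) / (1 + s\<^sup>2 * q x)\<^sup>2"
      by (simp add: power_divide add_divide_distrib)
    also have "(1 - s\<^sup>2 * q x)\<^sup>2 + (2 * s)\<^sup>2 * q x = (1 + s\<^sup>2 * q x)\<^sup>2"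
      by (simp add: power2_eq_square algebra_simps)
    finally show ?thesis using den(2)[of s x] by (simp add: norm_eq_sqrt_inner)
  qed
  have \<gamma>d: "((\<lambda>s. \<gamma> s x) has_vector_derivative \<gamma>' s x) (at s)" for s x
  proof -
    have a: "((\<lambda>s. (1 - s\<^sup>2 * q x) / (1 + s\<^sup>2 * q x)) has_real_derivative - 4 * s * q x / (1 + s\<^sup>2 * q x)\<^sup>2) (at s)"
      using den(2)[of s x] by (auto intro!: derivative_eq_intros simp: power2_eq_square field_simps)
    have b: "((\<lambda>s. 2 * s / (1 + s\<^sup>2 * q x)) has_real_derivative 2 * (1 - s\<^sup>2 * q x) / (1 + s\<^sup>2 * q x)\<^sup>2) (at s)"
      using den(2)[of s x] by (auto intro!: derivative_eq_intros simp: power2_eq_square field_simps)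
    show ?thesis unfolding \<gamma>_def \<gamma>'_def
      by (intro has_vector_derivative_diff has_vector_derivative_scaleR[where g="\<lambda>_. x" and g'=0, simplified]
          has_vector_derivative_scaleR[where g="\<lambda>_. G x" and g'=0, simplified] a b)
  qed
  define k where "k = (\<lambda>(s, x). grad (\<gamma> s x) \<bullet> \<gamma>' s x)"
  have fd: "((\<lambda>s. f (\<gamma> s x)) has_real_derivative k (s, x)) (at s)" for s x
  proof -
    have "((\<lambda>s. f (\<gamma> s x)) has_derivative (\<lambda>h. grad (\<gamma> s x) \<bullet> (h *\<^sub>R \<gamma>' s x))) (at s)"
      using has_derivative_compose[OF \<gamma>d[unfolded has_vector_derivative_def] grad] .
    moreover have "(\<lambda>h. grad (\<gamma> s x) \<bullet> (h *\<^sub>R \<gamma>' s x)) = (*) (k (s, x))" by (auto simp: k_def)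
    ultimately show ?thesis by (simp add: has_field_derivative_def)
  qed
  have k0: "k (0, x) = - 2 * q x" if "x \<in> ?S" for x
    using gG[OF that] by (simp add: k_def \<gamma>0 \<gamma>'_def)
  have cont\<gamma>: "continuous_on X (\<lambda>z. \<gamma> (g z) (h z))" if "continuous_on X g" "continuous_on X h" for X :: "'z::topological_space set" and g h
    unfolding \<gamma>_def using den by (intro continuous_intros contG contq that) auto
  have cont\<gamma>': "continuous_on X (\<lambda>z. \<gamma>' (g z) (h z))" if "continuous_on X g" "continuous_on X h" for X :: "'z::topological_space set" and g h
    unfolding \<gamma>'_def using den by (intro continuous_intros contG contq that) auto
  have contk: "continuous_on ({0..1} \<times> ?S) k"
    unfolding k_def case_prod_unfold by (intro continuous_intros contg cont\<gamma> cont\<gamma>')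
  have comp: "compact ({0..1::real} \<times> ?S)" by (intro compact_Times) auto
  \<comment> \<open>The factor 2 separates two regions: motion takes place only where
    \<open>q\<close> exceeds \<open>\<kappa>\<close>, and outside \<open>U\<close> it does so by a
    margin of at least \<open>\<kappa>\<close>.\<close>
  obtain \<kappa> where \<kappa>: "\<kappa> > 0" "\<And>x. x \<in> ?S - U \<Longrightarrow> q x \<ge> 2 * \<kappa>"
  proof (cases "?S - U = {}")
    case True
    show ?thesis
    proof (rule that[of 1])
      show "2 * 1 \<le> q x" if "x \<in> ?S - U" for x using True that by blast
    qed simp
  next
    case False
    have "compact (?S - U)" using U(1) by (intro compact_diff) auto
    moreover have "continuous_on (?S - U) q" using contq[OF continuous_on_id] .
    ultimately obtain x where x: "x \<in> ?S - U" "\<And>y. y \<in> ?S - U \<Longrightarrow> q x \<le> q y"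
      using continuous_attains_inf[OF _ False] by blast
    have "G x \<noteq> 0" using x(1) U(2) by (auto simp: G_def)
    then have "q x > 0" by (simp add: q_def)
    then show ?thesis using that[of "q x / 2"] x(2) by auto
  qed
  obtain d1 where d1: "d1 > 0" "\<And>s x. s \<in> {0..1} \<Longrightarrow> x \<in> ?S \<Longrightarrow> s < d1 \<Longrightarrow> dist (k (s, x)) (k (0, x)) < \<kappa>"
  proof -
    have "uniformly_continuous_on ({0..1} \<times> ?S) k" using contk comp by (rule compact_uniformly_continuous)
    then obtain d where d: "d > 0" "\<And>z z'. z \<in> {0..1} \<times> ?S \<Longrightarrow> z' \<in> {0..1} \<times> ?S \<Longrightarrow> dist z z' < d \<Longrightarrow> dist (k z) (k z') < \<kappa>"
      unfolding uniformly_continuous_on_def using \<kappa>(1) by (metis dist_commute)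
    have "dist (k (s, x)) (k (0, x)) < \<kappa>" if "s \<in> {0..1}" "x \<in> ?S" "s < d" for s x
      using that by (intro d(2)) (auto simp: dist_Pair_Pair)
    then show ?thesis using that d(1) by blast
  qed
  obtain d2 where d2: "d2 > 0" "\<And>s x. s \<in> {0..1} \<Longrightarrow> x \<in> ?S \<Longrightarrow> s < d2 \<Longrightarrow> dist (\<gamma> s x) x < e"
  proof -
    have "continuous_on ({0..1} \<times> ?S) (\<lambda>z. \<gamma> (fst z) (snd z))" by (intro cont\<gamma> continuous_intros)
    then have "uniformly_continuous_on ({0..1} \<times> ?S) (\<lambda>z. \<gamma> (fst z) (snd z))" using comp by (rule compact_uniformly_continuous)
    then obtain d where d: "d > 0" "\<And>z z'. z \<in> {0..1} \<times> ?S \<Longrightarrow> z' \<in> {0..1} \<times> ?S \<Longrightarrow> dist z z' < d \<Longrightarrow>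
        dist (\<gamma> (fst z) (snd z)) (\<gamma> (fst z') (snd z')) < e"
      unfolding uniformly_continuous_on_def using e by (metis dist_commute)
    have "dist (\<gamma> s x) x < e" if "s \<in> {0..1}" "x \<in> ?S" "s < d" for s x
      using d(2)[of "(s, x)" "(0, x)"] that by (auto simp: dist_Pair_Pair \<gamma>0)
    then show ?thesis using that d(1) by blast
  qed
  \<comment> \<open>By uniform continuity the slope of \<open>f\<close> along the curve stays within
    \<open>\<kappa>\<close> of its initial value \<open>- 2 * q x\<close>, which is at most
    \<open>- 2 * \<kappa>\<close>.\<close>
  have drop: "f (\<gamma> s x) \<le> f x - \<kappa> * s" if x: "x \<in> ?S" "q x \<ge> \<kappa>" and s: "0 \<le> s" "s \<le> 1" "s < d1" for s x
  proof (cases "s = 0")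
    case False
    then have "0 < s" using s by simp
    from MVT2[OF this, of "\<lambda>s. f (\<gamma> s x)" "\<lambda>s. k (s, x)"] fd
    obtain \<xi> where xi: "0 < \<xi>" "\<xi> < s" "f (\<gamma> s x) - f (\<gamma> 0 x) = (s - 0) * k (\<xi>, x)" by blast
    have "dist (k (\<xi>, x)) (k (0, x)) < \<kappa>" using xi s x by (intro d1(2)) auto
    then have "k (\<xi>, x) \<le> - \<kappa>" using k0[OF x(1)] x(2) by (auto simp: dist_real_def)
    then have "s * k (\<xi>, x) \<le> s * (- \<kappa>)" using s by (intro mult_left_mono) auto
    then show ?thesis using xi(3) by (simp add: \<gamma>0 mult.commute)
  qed (simp add: \<gamma>0)
  obtain \<Theta> where \<Theta>: "\<Theta> > 0" "\<And>x. x \<in> ?S \<Longrightarrow> q x \<le> \<Theta>"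
  proof -
    have "bounded (q ` ?S)" using contq[of ?S "\<lambda>x. x"]
      by (intro compact_imp_bounded compact_continuous_image) (auto intro: continuous_on_id)
    then obtain B where "\<forall>x\<in>?S. \<bar>q x\<bar> \<le> B" unfolding bounded_iff by auto
    then show ?thesis by (intro that[of "max B 1"]) (auto simp: abs_le_iff le_max_iff_disj)
  qed
  define \<theta> where "\<theta> = (\<lambda>x. max 0 (q x - \<kappa>))"
  define \<sigma> where "\<sigma> = min 1 (min d1 d2) / 2"
  have \<sigma>: "0 < \<sigma>" "\<sigma> \<le> 1" "\<sigma> < d1" "\<sigma> < d2" using d1(1) d2(1) by (auto simp: \<sigma>_def min_def field_simps)
  define c where "c = \<sigma> / \<Theta>"
  have c: "c > 0" using \<sigma> \<Theta> by (simp add: c_def)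
  have small: "0 \<le> t * c * \<theta> x" "t * c * \<theta> x \<le> \<sigma>" if "t \<in> {0..1}" "x \<in> ?S" for t x
  proof -
    have th: "0 \<le> \<theta> x" "\<theta> x \<le> \<Theta>" using \<Theta>(1) \<Theta>(2)[OF that(2)] \<kappa>(1) by (auto simp: \<theta>_def)
    then show "0 \<le> t * c * \<theta> x" using that c by simp
    have "t * c * \<theta> x \<le> 1 * c * \<Theta>" using that c th \<Theta>(1) by (intro mult_mono) auto
    then show "t * c * \<theta> x \<le> \<sigma>" using \<Theta>(1) by (simp add: c_def)
  qed
  define \<eta> where "\<eta> = (\<lambda>t x. \<gamma> (t * c * \<theta> x) x)"
  have decr: "f (\<eta> t x) \<le> f x - \<kappa> * (t * c * \<theta> x)" if "t \<in> {0..1}" "x \<in> ?S" for t x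
  proof (cases "q x \<ge> \<kappa>")
    case True
    then show ?thesis unfolding \<eta>_def using small[OF that] \<sigma> that by (intro drop) auto
  next
    case False
    then show ?thesis by (simp add: \<eta>_def \<theta>_def \<gamma>0)
  qed
  have "continuous_on ({0..1::real} \<times> ?S) (\<lambda>(t, x). \<eta> t x)"
    unfolding \<eta>_def \<theta>_def case_prod_unfold by (intro cont\<gamma> continuous_intros contq)
  moreover have "\<eta> t x \<in> ?S \<and> f (\<eta> t x) \<le> f x \<and> dist (\<eta> t x) x < e" if "t \<in> {0..1}" "x \<in> ?S" for t x
  proof (intro conjI)
    show "\<eta> t x \<in> ?S" unfolding \<eta>_def by (rule \<gamma>S[OF that(2)])
    have "0 \<le> \<kappa> * (t * c * \<theta> x)" using small(1)[OF that] \<kappa>(1) by simp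
    then show "f (\<eta> t x) \<le> f x" using decr[OF that] by linarith
    show "dist (\<eta> t x) x < e" unfolding \<eta>_def using small[OF that] \<sigma> that(2) by (intro d2(2)) auto
  qed
  moreover have "\<eta> 0 x = x" for x by (simp add: \<eta>_def \<gamma>0)
  \<comment> \<open>Outside \<open>U\<close> the cutoff is at least \<open>\<kappa>\<close>, which
    makes the drop uniform.\<close>
  moreover have "f (\<eta> 1 x) \<le> f x - \<kappa> * (c * \<kappa>)" if x: "x \<in> ?S - U" for x
  proof -
    have "\<kappa> * (c * \<kappa>) \<le> \<kappa> * (1 * c * \<theta> x)" using \<kappa>(1) \<kappa>(2)[OF x] c by (simp add: \<theta>_def)
    then show ?thesis using decr[of 1 x] x by auto
  qed
  moreover have "0 < \<kappa> * (c * \<kappa>)" using \<kappa> c by simp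
  ultimately show ?thesis unfolding descends_def by blast
qed

section \<open>Critical points of tensors\<close>

lemma C1_imp_gradient:
  fixes f :: "'a::euclidean_space \<Rightarrow> real"
  assumes "C_k_on 1 f UNIV"
  shows "\<exists>grad. (\<forall>x. (f has_derivative (\<lambda>v. grad x \<bullet> v)) (at x)) \<and> continuous_on UNIV grad"
proof (intro exI conjI allI)
  let ?D = "\<lambda>x. frechet_derivative f (at x)"
  let ?grad = "\<lambda>x. \<Sum>i\<in>Basis. ?D x i *\<^sub>R i"
  fix x
  have d: "(f has_derivative ?D x) (at x)" using C_k_on_has_derivative[of 0 f UNIV x] assms by simp
  then have lin: "linear (?D x)" by (rule has_derivative_linear)
  have "?D x v = ?grad x \<bullet> v" for v
  proof -
    have "?D x v = ?D x (\<Sum>i\<in>Basis. (v \<bullet> i) *\<^sub>R i)" by (simp add: euclidean_representation)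
    also have "\<dots> = ?grad x \<bullet> v"
      by (simp add: linear_sum[OF lin] linear_scale[OF lin] inner_sum_left inner_sum_right inner_commute mult.commute)
    finally show ?thesis .
  qed
  then show "(f has_derivative (\<lambda>v. ?grad x \<bullet> v)) (at x)"
    by (intro has_derivative_eq_rhs[OF d] ext)
next
  have "continuous_on UNIV (\<lambda>x. frechet_derivative f (at x) v)" for v using assms by simp
  then show "continuous_on UNIV (\<lambda>x. \<Sum>i\<in>Basis. frechet_derivative f (at x) i *\<^sub>R i)"
    by (intro continuous_intros)
qed

lemma sphere_coords_facts:
  assumes "sphere_coords U (\<phi> :: real ^ 'm \<Rightarrow> real ^ 'n)"
  shows "open U" "\<And>k. C_k_on k \<phi> U" "openin (top_of_set (sphere 0 1)) (\<phi> ` U)"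
    "\<exists>\<psi>. homeomorphism U (\<phi> ` U) \<phi> \<psi>" "\<And>u. u \<in> U \<Longrightarrow> inj (frechet_derivative \<phi> (at u))"
    "\<And>u. u \<in> U \<Longrightarrow> \<phi> u \<in> sphere 0 1" "\<And>u. u \<in> U \<Longrightarrow> (\<phi> has_derivative frechet_derivative \<phi> (at u)) (at u)"
proof -
  show s: "open U" "\<And>k. C_k_on k \<phi> U" "openin (top_of_set (sphere 0 1)) (\<phi> ` U)"
    "\<exists>\<psi>. homeomorphism U (\<phi> ` U) \<phi> \<psi>" "\<And>u. u \<in> U \<Longrightarrow> inj (frechet_derivative \<phi> (at u))"
    using assms by (auto simp: sphere_coords_def smooth_on_def)
  show "\<And>u. u \<in> U \<Longrightarrow> \<phi> u \<in> sphere 0 1" using openin_imp_subset[OF s(3)] by blast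
  show "\<And>u. u \<in> U \<Longrightarrow> (\<phi> has_derivative frechet_derivative \<phi> (at u)) (at u)"
    using C_k_on_has_derivative[OF s(2)[of "Suc 0"]] by blast
qed

text \<open>Differentiating \<open>\<phi> v \<bullet> \<phi> v = 1\<close> puts the range into the
  tangent hyperplane; injectivity makes the dimensions equal.\<close>

lemma range_sphere_coords_derivative:
  assumes dim: "CARD('n) = CARD('m) + 1" and \<phi>: "sphere_coords U (\<phi> :: real ^ 'm \<Rightarrow> real ^ 'n)" and u: "u \<in> U"
  shows "range (frechet_derivative \<phi> (at u)) = {y. \<phi> u \<bullet> y = 0}"
proof -
  note F = sphere_coords_facts[OF \<phi>]
  let ?D = "frechet_derivative \<phi> (at u)"
  have d: "(\<phi> has_derivative ?D) (at u)" by (rule F(7)[OF u])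
  have lin: "linear ?D" using d by (rule has_derivative_linear)
  have "((\<lambda>v. \<phi> v \<bullet> \<phi> v) has_derivative (\<lambda>h. \<phi> u \<bullet> ?D h + ?D h \<bullet> \<phi> u)) (at u)"
    by (intro has_derivative_inner d)
  moreover have "((\<lambda>v. \<phi> v \<bullet> \<phi> v) has_derivative (\<lambda>h. 0)) (at u)"
    by (rule has_derivative_transform_within_open[of "\<lambda>_. 1" _ _ _ U])
      (use F(1) F(6) u in \<open>auto simp: dot_square_norm\<close>)
  ultimately have "(\<lambda>h. \<phi> u \<bullet> ?D h + ?D h \<bullet> \<phi> u) = (\<lambda>h. 0)" by (rule has_derivative_unique)
  then have "\<phi> u \<bullet> ?D h + ?D h \<bullet> \<phi> u = 0" for h by (rule fun_cong)
  then have orth: "\<phi> u \<bullet> ?D h = 0" for h by (simp add: inner_commute)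
  show ?thesis
  proof (rule subspace_dim_equal)
    show "subspace (range ?D)" using lin by (simp add: linear_subspace_image)
    show "subspace {y. \<phi> u \<bullet> y = 0}" by (rule subspace_hyperplane)
    show "range ?D \<subseteq> {y. \<phi> u \<bullet> y = 0}" using orth by auto
    have "\<phi> u \<noteq> 0" using F(6)[OF u] by auto
    moreover have "dim (range ?D) = dim (UNIV :: (real ^ 'm) set)"
      using lin F(5)[OF u] by (intro dim_image_eq) auto
    ultimately show "dim {y. \<phi> u \<bullet> y = 0} \<le> dim (range ?D)"
      using dim by (simp add: dim_hyperplane dim_UNIV)
  qed
qed

text \<open>The derivative of \<open>F \<circ> \<phi>\<close> pairs the tangential gradient with
  tangent vectors, and that gradient is itself tangent. So being critical does not depend on the
  chart.\<close>

lemma critical_iff_tangential_gradient_0: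
  assumes dim: "CARD('n) = CARD('m) + 1" and \<phi>: "sphere_coords U (\<phi> :: real ^ 'm \<Rightarrow> real ^ 'n)" and u: "u \<in> U"
    and grad: "\<And>x. (F has_derivative (\<lambda>v. grad x \<bullet> v)) (at x)"
  shows "((F \<circ> \<phi>) has_derivative (\<lambda>_. 0)) (at u) \<longleftrightarrow> grad (\<phi> u) - (grad (\<phi> u) \<bullet> \<phi> u) *\<^sub>R \<phi> u = 0"
proof -
  note C = sphere_coords_facts[OF \<phi>]
  let ?D = "frechet_derivative \<phi> (at u)" and ?G = "grad (\<phi> u) - (grad (\<phi> u) \<bullet> \<phi> u) *\<^sub>R \<phi> u"
  have rng: "range ?D = {y. \<phi> u \<bullet> y = 0}" by (rule range_sphere_coords_derivative[OF dim \<phi> u])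
  have "((F \<circ> \<phi>) has_derivative (\<lambda>v. grad (\<phi> u) \<bullet> ?D v)) (at u)"
    using diff_chain_at[OF C(7)[OF u] grad] by (simp add: o_def)
  moreover have "grad (\<phi> u) \<bullet> ?D v = ?G \<bullet> ?D v" for v
    using rng by (auto simp: inner_diff_left)
  ultimately have d: "((F \<circ> \<phi>) has_derivative (\<lambda>v. ?G \<bullet> ?D v)) (at u)" by simp
  show ?thesis
  proof
    assume "((F \<circ> \<phi>) has_derivative (\<lambda>_. 0)) (at u)"
    then have "(\<lambda>v. ?G \<bullet> ?D v) = (\<lambda>_. 0)" using d has_derivative_unique by blast
    then have 0: "?G \<bullet> ?D v = 0" for v by metis
    have "\<phi> u \<bullet> \<phi> u = 1" using C(6)[OF u] by (simp add: dot_square_norm)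
    then have "?G \<in> range ?D" unfolding rng by (simp add: inner_diff_right inner_commute)
    then have "?G \<bullet> ?G = 0" using 0 by (metis imageE)
    then show "?G = 0" by simp
  next
    assume "?G = 0"
    then show "((F \<circ> \<phi>) has_derivative (\<lambda>_. 0)) (at u)" using d by simp
  qed
qed

text \<open>The second claim carries isolatedness from the chart to the sphere and leads to
  finiteness of the critical set.\<close>

lemma nondegenerate_chart_imp_morse_index:
  fixes F :: "real ^ 'n \<Rightarrow> real" and \<phi> :: "real ^ 'm \<Rightarrow> real ^ 'n"
  assumes dim: "CARD('n) = CARD('m) + 1" and \<phi>: "sphere_coords U \<phi>" and u: "u \<in> U"
    and F: "C_k_on 2 (F \<circ> \<phi>) U" and grad: "\<And>x. (F has_derivative (\<lambda>v. grad x \<bullet> v)) (at x)"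
    and crit: "((F \<circ> \<phi>) has_derivative (\<lambda>_. 0)) (at u)" and inv: "invertible (hessian (F \<circ> \<phi>) u)"
  shows "morse_index TYPE(real ^ 'm) F (sphere 0 1) (\<phi> u) (num_neg_eigenvalues (hessian (F \<circ> \<phi>) u))"
    and "\<not> \<phi> u islimpt {x \<in> sphere 0 1. grad x - (grad x \<bullet> x) *\<^sub>R x = 0}"
proof -
  note C = sphere_coords_facts[OF \<phi>]
  define G where "G = (\<lambda>y. frechet_derivative (F \<circ> \<phi>) (at y))"
  define D where "D = (\<lambda>w. frechet_derivative (\<lambda>y. G y w) (at u))"
  obtain \<psi> where hom: "homeomorphism U (\<phi> ` U) \<phi> \<psi>" using C(4) by blast
  have F2: "C_k_on (Suc (Suc 0)) (F \<circ> \<phi>) U" using F by (simp add: numeral_2_eq_2)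
  have d1: "((F \<circ> \<phi>) has_derivative G y) (at y)" if "y \<in> U" for y
    unfolding G_def by (rule C_k_on_has_derivative[OF F2 that])
  have "C_k_on (Suc 0) (\<lambda>y. G y w) U" for w using F2 unfolding G_def by simp
  then have d2: "((\<lambda>y. G y w) has_derivative D w) (at u)" for w
    unfolding D_def using C_k_on_has_derivative u by blast
  have Gu: "G u = (\<lambda>_. 0)" using has_derivative_unique[OF d1[OF u] crit] .
  have H: "hessian (F \<circ> \<phi>) u $ i $ j = D (axis j 1) (axis i 1)" for i j
    by (simp add: hessian_def D_def G_def)
  show "morse_index TYPE(real ^ 'm) F (sphere 0 1) (\<phi> u) (num_neg_eigenvalues (hessian (F \<circ> \<phi>) u))"
    by (rule morse_index_from_coordinates(1)[OF C(1) u hom C(3) d1 d2 Gu H inv])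
  obtain d where d: "d > 0" "\<And>z. z \<noteq> 0 \<Longrightarrow> norm z < d \<Longrightarrow> u + z \<in> U \<and> G (u + z) \<noteq> (\<lambda>_. 0)"
    using morse_index_from_coordinates(2)[OF C(1) u hom C(3) d1 d2 Gu H inv] by blast
  have "openin (top_of_set U) (U \<inter> ball u d)" by (simp add: openin_open_Int)
  then have "openin (top_of_set (\<phi> ` U)) (\<phi> ` (U \<inter> ball u d))"
    using homeomorphism_imp_open_map[OF hom] by blast
  then have "openin (top_of_set (sphere 0 1)) (\<phi> ` (U \<inter> ball u d))" using C(3) openin_trans by blast
  then obtain W where W: "open W" "\<phi> ` (U \<inter> ball u d) = sphere 0 1 \<inter> W" by (auto simp: openin_open)
  show "\<not> \<phi> u islimpt {x \<in> sphere 0 1. grad x - (grad x \<bullet> x) *\<^sub>R x = 0}"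
  proof
    assume lp: "\<phi> u islimpt {x \<in> sphere 0 1. grad x - (grad x \<bullet> x) *\<^sub>R x = 0}"
    have "\<phi> u \<in> W" using W(2) u d(1) by auto
    then obtain y where y: "y \<in> sphere 0 1" "grad y - (grad y \<bullet> y) *\<^sub>R y = 0" "y \<in> W" "y \<noteq> \<phi> u"
      using lp W(1) unfolding islimpt_def by blast
    then obtain v where v: "v \<in> U" "v \<in> ball u d" "y = \<phi> v" using W(2) by blast
    then have "v - u \<noteq> 0" "norm (v - u) < d" using y(4) by (auto simp: dist_norm norm_minus_commute)
    then have "G v \<noteq> (\<lambda>_. 0)" using d(2)[of "v - u"] by simp
    moreover have "((F \<circ> \<phi>) has_derivative (\<lambda>_. 0)) (at v)"
      using critical_iff_tangential_gradient_0[OF dim \<phi> v(1) grad] y(2) v(3) by blast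
    then have "G v = (\<lambda>_. 0)" using has_derivative_unique[OF d1[OF v(1)]] by blast
    ultimately show False by blast
  qed
qed

section \<open>Morse theory for functions on the sphere with nondegenerate critical points\<close>

lemma morse_index_le: "morse_index TYPE('b::euclidean_space) f S p l \<Longrightarrow> l \<le> DIM('b)"
  unfolding morse_index_def using dim_subset_UNIV by blast

text \<open>A nonzero vector of \<open>E\<close> would lead to values below the minimum.\<close>

lemma morse_index_at_minimum:
  assumes "morse_index TYPE('b::euclidean_space) f S p l" "\<And>x. x \<in> S \<Longrightarrow> f p \<le> f x"
  shows "l = 0"
proof (rule ccontr)
  assume "l \<noteq> 0"
  obtain E F :: "'b set" where EF: "morse_chart f S p E F" "dim E = l"
    using assms(1) unfolding morse_index_def by blast
  obtain r a b \<phi> \<psi> where C: "morse_coords f S p E F UNIV r a b \<phi> \<psi>"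
    using morse_chart_coords[OF EF(1) open_UNIV UNIV_I] by blast
  have r: "0 < r" "0 < a" and sub: "subspace E" "subspace F"
    using C unfolding morse_coords_def by auto
  obtain x where x: "x \<in> E" "norm x = r / 2"
    using sphere_in_subspace_nonempty[OF sub(1), of "r / 2"] EF(2) \<open>l \<noteq> 0\<close> r by auto
  then have "(x, 0) \<in> coord_box E F r" using r sub by (auto simp: coord_box_def subspace_0)
  then have "\<phi> (x, 0) \<in> S" "f (\<phi> (x, 0)) \<le> f p - a * (norm x)\<^sup>2"
    using C unfolding morse_coords_def by force+
  moreover have "0 < norm x" unfolding x(2) using r by simp
  then have "0 < a * (norm x)\<^sup>2" using r by simp
  ultimately show False using assms(2) by fastforce
qed

locale morse_on_sphere =
  fixes f :: "real ^ 'n \<Rightarrow> real" and grad :: "real ^ 'n \<Rightarrow> real ^ 'n" and m_type :: "'m::finite itself"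
  assumes dim: "CARD('n) = CARD('m) + 1"
    and grad: "\<And>x. (f has_derivative (\<lambda>v. grad x \<bullet> v)) (at x)"
    and cont_grad: "continuous_on UNIV grad"
    and C2: "\<And>U (\<phi> :: real ^ 'm \<Rightarrow> real ^ 'n). sphere_coords U \<phi> \<Longrightarrow> C_k_on 2 (f \<circ> \<phi>) U"
    and nondeg: "\<And>x. sphere_critical_point TYPE('m) f x \<Longrightarrow> nondegenerate_critical_point TYPE('m) f x"
begin

text \<open>The critical set by its chart-free description, from which closedness is
  visible.\<close>

definition K :: "(real ^ 'n) set" where
  "K = {x \<in> sphere 0 1. grad x - (grad x \<bullet> x) *\<^sub>R x = 0}"

definition has_index :: "real ^ 'n \<Rightarrow> nat \<Rightarrow> bool" where
  "has_index x l \<longleftrightarrow> critical_point_of_index TYPE('m) f (int l) x"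

lemma critical_in_K:
  assumes "sphere_coords U (\<phi> :: real ^ 'm \<Rightarrow> real ^ 'n)" "u \<in> U"
  shows "((f \<circ> \<phi>) has_derivative (\<lambda>_. 0)) (at u) \<longleftrightarrow> \<phi> u \<in> K"
  using critical_iff_tangential_gradient_0[OF dim assms grad] sphere_coords_facts(6)[OF assms]
  by (simp add: K_def)

lemma has_index_imp:
  assumes "has_index x l"
  shows "x \<in> K" "morse_index TYPE(real ^ 'm) f (sphere 0 1) x l" "\<not> x islimpt K"
proof -
  obtain U and \<phi> :: "real ^ 'm \<Rightarrow> real ^ 'n" and u where A: "u \<in> U" "sphere_coords U \<phi>" "\<phi> u = x"
      "((f \<circ> \<phi>) has_derivative (\<lambda>_. 0)) (at u)" "invertible (hessian (f \<circ> \<phi>) u)"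
      "num_neg_eigenvalues (hessian (f \<circ> \<phi>) u) = l"
    using assms unfolding has_index_def critical_point_of_index_def by auto
  show "x \<in> K" using critical_in_K[OF A(2,1)] A(3,4) by simp
  show "morse_index TYPE(real ^ 'm) f (sphere 0 1) x l" "\<not> x islimpt K"
    using nondegenerate_chart_imp_morse_index[OF dim A(2,1) C2[OF A(2)] grad A(4,5)] A(3,6)
    by (simp_all add: K_def)
qed

lemma K_has_index:
  assumes "x \<in> K"
  obtains l where "has_index x l"
proof -
  have "norm x = 1" using assms by (simp add: K_def)
  then obtain \<phi> :: "real ^ 'm \<Rightarrow> real ^ 'n" where \<phi>: "sphere_coords UNIV \<phi>" "\<phi> 0 = x"
    using exists_sphere_coords[OF dim] by blast
  then have "((f \<circ> \<phi>) has_derivative (\<lambda>_. 0)) (at 0)"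
    using critical_in_K[OF \<phi>(1) UNIV_I] assms by simp
  then have "sphere_critical_point TYPE('m) f x"
    unfolding sphere_critical_point_def using \<phi> by blast
  then have "nondegenerate_critical_point TYPE('m) f x" by (rule nondeg)
  then show ?thesis
    using that unfolding has_index_def critical_point_of_index_def nondegenerate_critical_point_def by blast
qed

text \<open>\<open>K\<close> is compact, and an infinite compact set would contain a limit point of
  itself.\<close>

lemma finite_K: "finite K"
proof (rule ccontr)
  assume inf: "infinite K"
  have "closedin (top_of_set (sphere 0 1)) K"
    unfolding K_def
    by (intro continuous_closedin_preimage_constant continuous_intros continuous_on_subset[OF cont_grad]) auto
  then have "compact K" using closedin_compact[OF compact_sphere] by blast
  then obtain x where x: "x \<in> K" "x islimpt K"
    using inf unfolding compact_eq_Bolzano_Weierstrass by blast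
  obtain l where "has_index x l" using K_has_index[OF x(1)] .
  then show False using has_index_imp(3) x(2) by blast
qed

sublocale morse_function "TYPE(real ^ 'm)" f "sphere 0 1" K
proof
  show "continuous_on (sphere 0 1) f"
    using has_derivative_continuous[OF grad] by (intro continuous_at_imp_continuous_on) blast
  show "\<exists>l. morse_index TYPE(real ^ 'm) f (sphere 0 1) p l" if "p \<in> K" for p
    using K_has_index[OF that] has_index_imp(2) by metis
  show "K \<subseteq> sphere 0 1" by (auto simp: K_def)
  show "descends f (sphere 0 1) U e"
    if "open U" "K \<subseteq> U" "0 < e" for U e
    by (rule sphere_descent[OF grad cont_grad that(1) that(2)[unfolded K_def] that(3)])
qed (use finite_K in auto)

text \<open>The critical set is unchanged. Statements about index 0 become statements about the top
  index for \<open>-f\<close>.\<close>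

sublocale neg: morse_function "TYPE(real ^ 'm)" "\<lambda>x. - f x" "sphere 0 1" K
proof
  show "continuous_on (sphere 0 1) (\<lambda>x. - f x)" by (intro continuous_intros cont)
  show "\<exists>l. morse_index TYPE(real ^ 'm) (\<lambda>x. - f x) (sphere 0 1) p l" if "p \<in> K" for p
    using nondegenerate[OF that] morse_index_uminus by blast
  show "descends (\<lambda>x. - f x) (sphere 0 1) U e"
    if "open U" "K \<subseteq> U" "0 < e" for U e
  proof (rule sphere_descent[OF _ _ that(1) _ that(3)])
    show "((\<lambda>x. - f x) has_derivative (\<lambda>v. - grad x \<bullet> v)) (at x)" for x
      using has_derivative_minus[OF grad] by simp
    show "continuous_on UNIV (\<lambda>x. - grad x)" by (intro continuous_intros cont_grad)
    have "- grad x - (- grad x \<bullet> x) *\<^sub>R x = - (grad x - (grad x \<bullet> x) *\<^sub>R x)" for x by simp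
    then show "{x \<in> sphere 0 1. - grad x - (- grad x \<bullet> x) *\<^sub>R x = 0} \<subseteq> U"
      using that(2) unfolding K_def by (simp only: neg_equal_0_iff_equal)
  qed
qed (use K compact_S in auto)

lemma extremum_in_K:
  assumes p: "p \<in> sphere 0 1" "(\<forall>x\<in>sphere 0 1. f p \<le> f x) \<or> (\<forall>x\<in>sphere 0 1. f x \<le> f p)"
  shows "p \<in> K"
proof -
  obtain \<phi> :: "real ^ 'm \<Rightarrow> real ^ 'n" where \<phi>: "sphere_coords UNIV \<phi>" "\<phi> 0 = p"
    using exists_sphere_coords[OF dim] p(1) by auto
  have d: "((f \<circ> \<phi>) has_derivative (\<lambda>v. grad (\<phi> 0) \<bullet> frechet_derivative \<phi> (at 0) v)) (at 0)"
    using diff_chain_at[OF sphere_coords_facts(7)[OF \<phi>(1) UNIV_I] grad] by (simp add: o_def)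
  have "(\<lambda>v. grad (\<phi> 0) \<bullet> frechet_derivative \<phi> (at 0) v) = (\<lambda>v. 0)"
    by (rule differential_zero_maxmin[OF UNIV_I open_UNIV d])
      (use p(2) \<phi>(2) sphere_coords_facts(6)[OF \<phi>(1) UNIV_I] in auto)
  then show "p \<in> K" using d critical_in_K[OF \<phi>(1) UNIV_I, of 0] \<phi>(2) by simp
qed

text \<open>With this, a number of minima different from 1 means at least two;
  \<open>index_top_exists\<close> does the same for maxima.\<close>

lemma index_0_exists: "\<exists>p. has_index p 0"
proof -
  have "sphere (0 :: real ^ 'n) 1 \<noteq> {}" by simp
  then obtain p where p: "p \<in> sphere 0 1" "\<And>x. x \<in> sphere 0 1 \<Longrightarrow> f p \<le> f x"
    using continuous_attains_inf[OF compact_S _ cont] by blast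
  then have "p \<in> K" using extremum_in_K by blast
  then obtain l where "has_index p l" by (rule K_has_index)
  then show ?thesis
    using p(2) morse_index_at_minimum[OF has_index_imp(2)[of p l]] by metis
qed

lemma index_top_exists: "\<exists>p. has_index p CARD('m)"
proof -
  have "sphere (0 :: real ^ 'n) 1 \<noteq> {}" by simp
  then obtain p where p: "p \<in> sphere 0 1" "\<And>x. x \<in> sphere 0 1 \<Longrightarrow> f x \<le> f p"
    using continuous_attains_sup[OF compact_S _ cont] by blast
  then have "p \<in> K" using extremum_in_K by blast
  then obtain l where l: "has_index p l" by (rule K_has_index)
  note mi = has_index_imp(2)[OF l]
  have "DIM(real ^ 'm) - l = 0"
    by (rule morse_index_at_minimum[OF morse_index_uminus[OF mi]]) (use p(2) in auto)
  then have "l = CARD('m)" using morse_index_le[OF mi] by simp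
  then show ?thesis using l by blast
qed

lemma trivial_homology_sphere:
  assumes "k \<ge> 1" "k \<noteq> CARD('m)"
  shows "no_homology (int k) (sphere (0 :: real ^ 'n) 1) {}"
  using reduced_homology_sphere_in_subspace[OF subspace_UNIV, of 1 "int k", where 'a="real ^ 'n"] assms dim
  by (simp add: dim_UNIV un_reduced_homology_group)

lemma contractible_punctured_sphere:
  assumes "q \<in> sphere (0 :: real ^ 'n) 1"
  shows "contractible (sphere 0 1 - {q})"
proof -
  have "q \<noteq> 0" using assms by auto
  then have "(sphere 0 1 - {q}) homeomorphic {x. q \<bullet> x = 0}"
    using assms by (intro homeomorphic_punctured_sphere_hyperplane) auto
  moreover have "contractible {x. q \<bullet> x = 0}"
    by (intro convex_imp_contractible subspace_imp_convex subspace_hyperplane)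
  ultimately show ?thesis using homeomorphic_contractible_eq by blast
qed

lemma adjacent_index_exists:
  assumes k: "2 \<le> k" "k < CARD('m)" and p: "has_index p k"
  shows "\<exists>q. has_index q (k - 1) \<or> has_index q (k + 1)"
proof -
  have "no_homology (int k) (sphere (0 :: real ^ 'n) 1) {}"
    by (rule trivial_homology_sphere) (use k in auto)
  then obtain q where q: "q \<in> K" "\<And>l. morse_index TYPE(real ^ 'm) f (sphere 0 1) q l \<Longrightarrow> l = k - 1 \<or> l = k + 1"
    using adjacent_index[OF k(1) has_index_imp(1,2)[OF p]] by blast
  obtain l where l: "has_index q l" using K_has_index[OF q(1)] .
  then show ?thesis using q(2)[OF has_index_imp(2)[OF l]] by blast
qed

lemma below_top_index_exists:
  assumes "CARD('m) \<ge> 2" "has_index p CARD('m)" "has_index q CARD('m)" "p \<noteq> q"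
  shows "\<exists>x. has_index x (CARD('m) - 1)"
proof -
  have *: "\<exists>x. has_index x (CARD('m) - 1)"
    if pq: "has_index p CARD('m)" "has_index q CARD('m)" "p \<noteq> q" "f p \<le> f q" for p q
  proof -
    have q: "q \<in> sphere 0 1" using has_index_imp(1)[OF pq(2)] by (simp add: K_def)
    have "\<exists>x\<in>K. \<forall>l. morse_index TYPE(real ^ 'm) f (sphere 0 1) x l \<longrightarrow> l = DIM(real ^ 'm) - 1"
      by (intro index_below_top[of p q] has_index_imp(1)[OF pq(1)] q contractible_punctured_sphere[OF q])
        (use pq assms(1) has_index_imp(2)[OF pq(1)] in simp_all)
    then obtain x where x: "x \<in> K" "\<And>l. morse_index TYPE(real ^ 'm) f (sphere 0 1) x l \<Longrightarrow> l = CARD('m) - 1"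
      by auto
    obtain l where l: "has_index x l" using K_has_index[OF x(1)] .
    then show ?thesis using x(2)[OF has_index_imp(2)[OF l]] by blast
  qed
  show ?thesis
    using *[of p q] *[of q p] assms(2-) by (metis linear)
qed

lemma above_bottom_index_exists:
  assumes "CARD('m) \<ge> 2" "has_index p 0" "has_index q 0" "p \<noteq> q"
  shows "\<exists>x. has_index x 1"
proof -
  have *: "\<exists>x. has_index x 1" if pq: "has_index p 0" "has_index q 0" "p \<noteq> q" "f q \<le> f p" for p q
  proof -
    have q: "q \<in> sphere 0 1" using has_index_imp(1)[OF pq(2)] by (simp add: K_def)
    have "morse_index TYPE(real ^ 'm) (\<lambda>x. - f x) (sphere 0 1) p (DIM(real ^ 'm))"
      using morse_index_uminus[OF has_index_imp(2)[OF pq(1)]] by simp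
    then have "\<exists>x\<in>K. \<forall>l. morse_index TYPE(real ^ 'm) (\<lambda>x. - f x) (sphere 0 1) x l \<longrightarrow> l = DIM(real ^ 'm) - 1"
      by (intro neg.index_below_top[of p q] has_index_imp(1)[OF pq(1)] q contractible_punctured_sphere[OF q])
        (use pq assms(1) in simp_all)
    then obtain x where x: "x \<in> K" "\<And>l. morse_index TYPE(real ^ 'm) (\<lambda>x. - f x) (sphere 0 1) x l \<Longrightarrow> l = CARD('m) - 1"
      by auto
    obtain l where l: "has_index x l" using K_has_index[OF x(1)] .
    note mi = has_index_imp(2)[OF l]
    have "CARD('m) - l = CARD('m) - 1" using x(2)[OF morse_index_uminus[OF mi]] by simp
    then have "l = 1" using morse_index_le[OF mi] assms(1) by simp
    then show ?thesis using l by blast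
  qed
  show ?thesis
    using *[of p q] *[of q p] assms(2-) by (metis linear)
qed

end

theorem theorem5p5:
  fixes T :: "'n::finite tensor" and d :: nat and n :: int and c :: "int \<Rightarrow> nat"
  assumes dim: "CARD('n) = CARD('m::finite) + 1"
    and sym: "symmetric_tensor d T"
    and nondeg: "nondegenerate_tensor TYPE('m) d T"
    and n: "n = int CARD('n)"
    and c: "c = num_critical TYPE('m) d T"
  shows "(c 0 \<noteq> 1 \<longrightarrow> c 1 > 0) \<and>
         (\<forall>k\<in>{2..n - 2}. c k > 0 \<longrightarrow> c (k - 1) > 0 \<or> c (k + 1) > 0) \<and>
         (c n > 0 \<longrightarrow> c (n - 1) > 0) \<and>
         (c (n - 1) \<noteq> 1 \<longrightarrow> c (n - 2) > 0 \<or> c n > 0)"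
proof -
  let ?f = "tensor_poly d T"
  have smooth: "C_k_on k (?f \<circ> \<phi>) U" if "open U" "C_k_on k \<phi> U"
    for k U and \<phi> :: "'a::euclidean_space \<Rightarrow> real ^ 'n"
    by (rule C_k_on_tensor_poly[OF that])
  have "C_k_on 1 (?f \<circ> (\<lambda>x. x)) UNIV" by (intro smooth C_k_on_id open_UNIV)
  then have "C_k_on 1 ?f UNIV" by (simp add: o_def)
  then obtain grad where grad: "\<And>x. (?f has_derivative (\<lambda>v. grad x \<bullet> v)) (at x)" "continuous_on UNIV grad"
    using C1_imp_gradient by blast
  interpret morse_on_sphere ?f grad "TYPE('m)"
  proof
    show "C_k_on 2 (?f \<circ> \<phi>) U" if "sphere_coords U \<phi>" for U and \<phi> :: "real ^ 'm \<Rightarrow> real ^ 'n"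
      by (intro C_k_on_tensor_poly sphere_coords_facts[OF that])
    show "nondegenerate_critical_point TYPE('m) ?f x" if "sphere_critical_point TYPE('m) ?f x" for x
      using nondeg that unfolding nondegenerate_tensor_def unit_eigenvector_def by blast
  qed (use dim grad in auto)
  have cdef: "c (int l) = card {x. has_index x l}" for l
    unfolding c num_critical_def has_index_def ..
  have fin: "finite {x. has_index x l}" for l
    by (rule finite_subset[OF _ finite_K]) (use has_index_imp(1) in blast)
  have pos: "c (int l) > 0 \<longleftrightarrow> (\<exists>x. has_index x l)" for l
    unfolding cdef using fin[of l] by (auto simp: card_gt_0_iff)
  have two: "\<exists>p q. has_index p l \<and> has_index q l \<and> p \<noteq> q" if l: "c (int l) \<noteq> 1" "\<exists>p. has_index p l" for l
  proof (rule ccontr)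
    assume "\<not> ?thesis"
    then obtain p where "{x. has_index x l} = {p}" using l(2) by blast
    then show False using l(1) unfolding cdef by simp
  qed
  have no: "\<not> has_index x l" if "l > CARD('m)" for x l
    using morse_index_le[OF has_index_imp(2)] that by fastforce
  have m: "CARD('m) \<ge> 1" by simp
  have nm: "n = int (CARD('m) + 1)" "n - 1 = int (CARD('m))" "n - 2 = int (CARD('m) - 1)"
    using n dim m by auto
  \<comment> \<open>On the circle index 1 is the top index and is provided by the maximum; otherwise
    two minima are available.\<close>
  have c0: "c 1 > 0" if ne: "c 0 \<noteq> 1"
  proof (cases "CARD('m) = 1")
    case True
    then show ?thesis using pos[of 1] index_top_exists by simp
  next
    case False
    then have "CARD('m) \<ge> 2" using m by linarith
    moreover obtain p q where "has_index p 0" "has_index q 0" "p \<noteq> q"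
      using two[of 0] ne index_0_exists by auto
    ultimately show ?thesis
      using above_bottom_index_exists pos[of 1] by simp
  qed
  have ck: "c (k - 1) > 0 \<or> c (k + 1) > 0" if k: "k \<in> {2..n - 2}" "c k > 0" for k
  proof -
    define l where "l = nat k"
    have l: "k = int l" "2 \<le> l" "l < CARD('m)" using k(1) n dim by (auto simp: l_def)
    then obtain p where "has_index p l" using k(2) pos by blast
    then obtain q where "has_index q (l - 1) \<or> has_index q (l + 1)"
      using adjacent_index_exists[OF l(2,3)] by blast
    then have "c (int (l - 1)) > 0 \<or> c (int (l + 1)) > 0" unfolding pos by blast
    moreover have "k - 1 = int (l - 1)" "k + 1 = int (l + 1)" using l by auto
    ultimately show ?thesis by (simp only:)
  qed
  have cn: "\<not> c n > 0" unfolding nm(1) pos using no by simp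
  \<comment> \<open>Always the first alternative, as no point has index \<open>n\<close>. On the
    circle \<open>n - 2\<close> is 0, and the minimum settles it.\<close>
  have cn2: "c (n - 2) > 0" if ne: "c (n - 1) \<noteq> 1"
  proof (cases "CARD('m) = 1")
    case True
    then show ?thesis using index_0_exists pos[of 0] unfolding nm by simp
  next
    case False
    then have m2: "CARD('m) \<ge> 2" using m by linarith
    obtain p q where pq: "has_index p CARD('m)" "has_index q CARD('m)" "p \<noteq> q"
      using two[OF ne[unfolded nm(2)] index_top_exists] by blast
    show ?thesis unfolding nm(3) pos by (rule below_top_index_exists[OF m2 pq])
  qed
  show ?thesis
    by (intro conjI ballI impI) (use c0 ck cn cn2 in simp_all)
qed

end
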